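(* Let $1<p<\infty$, $\alpha>-1$, and let $\varphi$ be a measurable function on $(0,\infty)$ such that $\int_0^\infty t^{\frac{1+\alpha}{p}-1}|\varphi(t)|\,dt<\infty$. Then: (i) $\mathcal H_\varphi$ is bounded on $L^p_{|\cdot|^\alpha}(\mathbb R)$; moreover, $$\left|\int_0^\infty t^{\frac{1+\alpha}{p}-1}\varphi(t)\,dt\right|\leq\|\mathcal H_\varphi\|_{L^p_{|\cdot|^\alpha}(\mathbb R)\to L^p_{|\cdot|^\alpha}(\mathbb R)}\leq\int_0^\infty t^{\frac{1+\alpha}{p}-1}|\varphi(t)|\,dt.$$ (ii) If $-1<\alpha<p-1$, then $\mathcal H_\varphi$ commutes with the Hilbert transform $H$ on $L^p_{|\cdot|^\alpha}(\mathbb R)$, that is, $H(\mathcal H_\varphi f)=\mathcal H_\varphi(Hf)$ for all $f\in L^p_{|\cdot|^\alpha}(\mathbb R)$.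
   Context: Functions are complex-valued. For a measurable function $\varphi$ on $(0,\infty)$, the real Hausdorff operator is defined for suitable measurable functions $f$ on $\mathbb R$ by $\mathcal H_\varphi(f)(x)=\int_0^\infty f\left(\frac xt\right)\frac{\varphi(t)}{t}\,dt$, $x\in\mathbb R$. $L^p_{|\cdot|^\alpha}(\mathbb R)$ is the $L^p$ space on $\mathbb R$ with respect to the measure $|x|^\alpha dx$, with norm $\|f\|_{L^p_{|\cdot|^\alpha}(\mathbb R)}=\left(\int_{\mathbb R}|f(x)|^p|x|^\alpha\,dx\right)^{1/p}$. The Hilbert transform is $Hf(x)=\frac1\pi\,\mathrm{p.v.}\int_{-\infty}^\infty\frac{f(x-y)}{y}\,dy$ for a.e. $x\in\mathbb R$; it is well known that for $1<p<\infty$ and $-1<\alpha<p-1$ the weight $|x|^\alpha$ belongs to the Muckenhoupt class $A_p(\mathbb R)$ and hence $H$ is bounded on $L^p_{|\cdot|^\alpha}(\mathbb R)$. $\|\cdot\|_{X\to X}$ denotes the operator norm on a normed space $X$. *)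

theory Defs
  imports "HOL-Analysis.Analysis"
begin

text \<open>Elements of the space are represented by Lebesgue measurable functions, not by classes
  modulo null sets; identities between elements are therefore stated almost everywhere.\<close>

definition power_weight :: "real \<Rightarrow> real measure" where
  "power_weight \<alpha> = density lebesgue (\<lambda>x. ennreal (\<bar>x\<bar> powr \<alpha>))"

definition Lp_space :: "real \<Rightarrow> real \<Rightarrow> (real \<Rightarrow> complex) set" where
  "Lp_space p \<alpha> = {f \<in> borel_measurable lebesgue.
     integrable (power_weight \<alpha>) (\<lambda>x. norm (f x) powr p)}"

definition Lp_norm :: "real \<Rightarrow> real \<Rightarrow> (real \<Rightarrow> complex) \<Rightarrow> real" where
  "Lp_norm p \<alpha> f = (\<integral>x. norm (f x) powr p \<partial>power_weight \<alpha>) powr (1 / p)"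

text \<open>Linearity almost everywhere together with the norm bound implies that \<open>T\<close> sends almost
  everywhere equal functions to almost everywhere equal functions, so that \<open>T\<close> acts on classes.\<close>

definition bounded_on_Lp ::
  "real \<Rightarrow> real \<Rightarrow> ((real \<Rightarrow> complex) \<Rightarrow> real \<Rightarrow> complex) \<Rightarrow> bool" where
  "bounded_on_Lp p \<alpha> T \<longleftrightarrow>
     (\<forall>f\<in>Lp_space p \<alpha>. T f \<in> Lp_space p \<alpha>) \<and>
     (\<forall>f\<in>Lp_space p \<alpha>. \<forall>g\<in>Lp_space p \<alpha>. \<forall>a b.
        AE x in lebesgue. T (\<lambda>y. a * f y + b * g y) x = a * T f x + b * T g x) \<and>
     (\<exists>C. \<forall>f\<in>Lp_space p \<alpha>. Lp_norm p \<alpha> (T f) \<le> C * Lp_norm p \<alpha> f)"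

text \<open>A supremum of reals, hence meaningful only when \<open>bounded_on_Lp p \<alpha> T\<close> holds.\<close>

definition Lp_opnorm ::
  "real \<Rightarrow> real \<Rightarrow> ((real \<Rightarrow> complex) \<Rightarrow> real \<Rightarrow> complex) \<Rightarrow> real" where
  "Lp_opnorm p \<alpha> T = (SUP f\<in>{f \<in> Lp_space p \<alpha>. Lp_norm p \<alpha> f \<le> 1}. Lp_norm p \<alpha> (T f))"

definition hausdorff_op :: "(real \<Rightarrow> complex) \<Rightarrow> (real \<Rightarrow> complex) \<Rightarrow> real \<Rightarrow> complex" where
  "hausdorff_op \<phi> f x = (LINT t:{0<..}|lebesgue. f (x / t) * (\<phi> t / of_real t))"

text \<open>The Bochner integral is 0 for non-integrable integrands; this predicate says that the
  defining integral converges at \<open>x\<close>.\<close>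

definition hausdorff_defined_at ::
  "(real \<Rightarrow> complex) \<Rightarrow> (real \<Rightarrow> complex) \<Rightarrow> real \<Rightarrow> bool" where
  "hausdorff_defined_at \<phi> f x \<longleftrightarrow>
     set_integrable lebesgue {0<..} (\<lambda>t. f (x / t) * (\<phi> t / of_real t))"

definition truncated_hilbert :: "real \<Rightarrow> (real \<Rightarrow> complex) \<Rightarrow> real \<Rightarrow> complex" where
  "truncated_hilbert \<epsilon> f x =
     of_real (1 / pi) * (LINT y:{y. \<epsilon> < \<bar>y\<bar>}|lebesgue. f (x - y) / of_real y)"

definition hilbert_transform :: "(real \<Rightarrow> complex) \<Rightarrow> real \<Rightarrow> complex" where
  "hilbert_transform f x = Lim (at_right 0) (\<lambda>\<epsilon>. truncated_hilbert \<epsilon> f x)"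

text \<open>\<open>Lim\<close> is unspecified when there is no limit; this predicate says that the principal value
  exists at \<open>x\<close>.\<close>

definition hilbert_defined_at :: "(real \<Rightarrow> complex) \<Rightarrow> real \<Rightarrow> bool" where
  "hilbert_defined_at f x \<longleftrightarrow>
     (\<forall>\<epsilon>>0. set_integrable lebesgue {y. \<epsilon> < \<bar>y\<bar>} (\<lambda>y. f (x - y) / of_real y)) \<and>
     (\<exists>l. ((\<lambda>\<epsilon>. truncated_hilbert \<epsilon> f x) \<longlongrightarrow> l) (at_right 0))"

end

theory Submission
  imports Defs "HOL-Complex_Analysis.Complex_Analysis"
begin

text \<open>Part (i) is Minkowski's integral inequality, in the form of Jensen's inequality for the finite
  measure with density \<open>t powr (\<beta> - 1) * norm (\<phi> t)\<close>, where \<open>\<beta> = (1 + \<alpha>) / p\<close>; the lower bound comes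
  from testing on \<open>\<bar>x\<bar> powr - \<beta>\<close> restricted to the annulus \<open>1 \<le> \<bar>x\<bar> \<le> R\<close> and letting \<open>R\<close> tend to
  infinity.

  For part (ii), Fubini and dilation turn the truncated Hilbert transform of \<open>\<H>\<^sub>\<phi> f\<close> at \<open>x\<close> into the
  integral of \<open>\<phi> t / t\<close> against the transform of \<open>f\<close> truncated at \<open>\<epsilon> / t\<close> and evaluated at \<open>x / t\<close>, and
  one passes to the limit by dominated convergence. The dominating function is the maximal Hilbert
  transform of \<open>f\<close>. Its weighted boundedness is not needed: for almost everywhere convergence of a
  multiplicative convolution with an integrable function, scale-invariant bounds for the mean over
  the annuli \<open>r \<le> \<bar>x\<bar> \<le> 2 * r\<close> suffice. By scaling this is a local statement, where the weight plays no role, and it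
  holds for \<open>f\<close> in \<open>L\<^sup>q\<close> with \<open>1 < q < 2\<close>: for a nonnegative density \<open>h\<close> the Cauchy integral \<open>F\<close> of \<open>h\<close> has
  positive real part, the integral of \<open>F\<close> to the power \<open>q\<close> over a horizontal line vanishes, and so Riesz's
  inequality bounds \<open>F\<close> in \<open>L\<^sup>q\<close> by its real part, a Poisson integral of \<open>h\<close>. The Poisson formula and the
  Hardy--Littlewood maximal function then control all truncations simultaneously.\<close>

section \<open>The Hardy--Littlewood maximal function\<close>

text \<open>No boundary values of the Cauchy integral are used. Its bound in L^q on a horizontal
  line is uniform in the height, so the line of height \<open>1 / Suc n\<close> stands in for the
  boundary and Fatou's lemma removes \<open>n\<close>.

  Existence of the principal value is itself a consequence of the maximal estimate: it is explicit
  for intervals, passes to Borel sets by Dynkin's lemma and to functions in L^q through simple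
  functions.

  Annuli are the right sets because \<open>x = t * u\<close> carries annuli to annuli and the
  dilates \<open>r powr \<beta> * f (r * u)\<close> all have the same weighted integral. One
  inhomogeneous estimate on the annulus from 1 to 2 therefore yields the same constant at every
  scale. The restriction \<open>q < 2\<close> keeps the argument of \<open>z powr q\<close> below pi
  in the right half plane, where the cosine decreases.

  The exponent \<open>\<beta>\<close> is critical: \<open>\<bar>x\<bar> powr - \<beta>\<close> is
  formally an eigenfunction of the operator, with the integral of
  \<open>t powr (\<beta> - 1) * \<phi> t\<close> as eigenvalue, and it misses the space only
  logarithmically. Cutting it off therefore costs a bounded amount against
  \<open>ln R\<close>.\<close>

lemma measurable_cball_real [measurable]: "Measurable.pred borel (\<lambda>x::real. x \<in> cball c r)"
  unfolding mem_cball by measurable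

text \<open>Restricting to rational radii makes measurability immediate; the Poisson kernel below is therefore
  estimated for rational heights only.\<close>

definition hl_max :: "(real \<Rightarrow> ennreal) \<Rightarrow> real \<Rightarrow> ennreal" where
  "hl_max g x = (SUP r\<in>{r\<in>\<rat>. 0 < r}. (\<integral>\<^sup>+u. g u * indicator (cball x r) u \<partial>lborel) / ennreal (2 * r))"

lemma hl_max_measurable [measurable]:
  assumes [measurable]: "g \<in> borel_measurable borel"
  shows "hl_max g \<in> borel_measurable borel"
proof -
  have "countable {r\<in>\<rat>. 0 < (r::real)}"
    by (rule countable_subset[OF _ countable_rat]) auto
  moreover have "(\<lambda>x. (\<integral>\<^sup>+u. g u * indicator (cball x r) u \<partial>lborel) / ennreal (2 * r)) \<in> borel_measurable borel" for r :: real
  proof -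
    have "(\<lambda>x. \<integral>\<^sup>+u. g u * indicator {z. \<bar>fst z - snd z\<bar> \<le> r} (x, u) \<partial>lborel) \<in> borel_measurable borel"
      by measurable
    moreover have "indicator {z. \<bar>fst z - snd z\<bar> \<le> r} (x, u) = (indicator (cball x r) u :: ennreal)" for x u
      by (auto simp: indicator_def dist_real_def)
    ultimately show ?thesis by simp
  qed
  ultimately show ?thesis
    unfolding hl_max_def by (intro borel_measurable_SUP) auto
qed

lemma emeasure_cball_real: "0 \<le> r \<Longrightarrow> emeasure lborel (cball (x::real) r) = ennreal (2 * r)"
  by (simp add: cball_eq_atLeastAtMost)

text \<open>Each point of the level set is the centre of a ball on which the mean of
  \<open>g\<close> exceeds \<open>l\<close>. Vitali's covering lemma selects countably many disjoint
  balls of this kind whose fivefold enlargements still cover the set; the 5 in the constant is that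
  enlargement.\<close>

lemma hl_max_weak_type:
  assumes [measurable]: "g \<in> borel_measurable borel" and lam: "0 < (l::real)"
  shows "emeasure lborel {x. hl_max g x > ennreal l} \<le> ennreal (5 / l) * (\<integral>\<^sup>+u. g u \<partial>lborel)"
proof (cases "(\<integral>\<^sup>+u. g u \<partial>lborel) = \<infinity>")
  case True
  then show ?thesis using lam by (simp add: ennreal_mult_top)
next
  case False
  then obtain G where G: "(\<integral>\<^sup>+u. g u \<partial>lborel) = ennreal G" "0 \<le> G"
    by (cases "\<integral>\<^sup>+u. g u \<partial>lborel") auto
  define E where "E = {x. hl_max g x > ennreal l}"
  have "\<forall>x\<in>E. \<exists>r>0. (\<integral>\<^sup>+u. g u * indicator (cball x r) u \<partial>lborel) > ennreal (2 * r * l)"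
  proof
    fix x assume "x \<in> E"
    then have "\<exists>r\<in>{r\<in>\<rat>. 0 < r}. ennreal l < (\<integral>\<^sup>+u. g u * indicator (cball x r) u \<partial>lborel) / ennreal (2 * r)"
      unfolding E_def hl_max_def mem_Collect_eq less_SUP_iff .
    then obtain r :: real where r: "0 < r" "ennreal l < (\<integral>\<^sup>+u. g u * indicator (cball x r) u \<partial>lborel) / ennreal (2 * r)"
      by auto
    have "ennreal l * ennreal (2 * r) < (\<integral>\<^sup>+u. g u * indicator (cball x r) u \<partial>lborel)"
    proof (rule ccontr)
      assume "\<not> ?thesis"
      then have "(\<integral>\<^sup>+u. g u * indicator (cball x r) u \<partial>lborel) / ennreal (2 * r) \<le> ennreal l * ennreal (2 * r) / ennreal (2 * r)"
        by (intro divide_right_mono_ennreal) auto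
      then show False using r by (simp add: ennreal_mult_divide_eq)
    qed
    then show "\<exists>r>0. (\<integral>\<^sup>+u. g u * indicator (cball x r) u \<partial>lborel) > ennreal (2 * r * l)"
      using r(1) lam by (intro exI[of _ r]) (simp add: ennreal_mult[symmetric] mult_ac)
  qed
  then obtain r where r: "\<And>x. x \<in> E \<Longrightarrow> 0 < r x"
      "\<And>x. x \<in> E \<Longrightarrow> ennreal (2 * r x * l) < (\<integral>\<^sup>+u. g u * indicator (cball x (r x)) u \<partial>lborel)"
    by metis
  \<comment> \<open>The covering lemma needs bounded radii, and the finite total mass
    \<open>G\<close> supplies the bound.\<close>
  have rb: "0 < r x \<and> r x \<le> G / (2 * l)" if "x \<in> E" for x
  proof -
    have "ennreal (2 * r x * l) < (\<integral>\<^sup>+u. g u * indicator (cball x (r x)) u \<partial>lborel)"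
      using r(2)[OF that] .
    also have "\<dots> \<le> (\<integral>\<^sup>+u. g u \<partial>lborel)"
      by (intro nn_integral_mono) (auto simp: indicator_def)
    also have "\<dots> = ennreal G" using G by simp
    finally have "2 * r x * l \<le> G" using G(2) by (meson ennreal_le_iff less_imp_le)
    then show ?thesis using r(1)[OF that] lam by (simp add: field_simps)
  qed
  have "E \<subseteq> (\<Union>i\<in>E. cball (id i) (r i))" using r(1) by (auto simp: less_imp_le)
  then obtain C where C: "countable C" "C \<subseteq> E"
     "pairwise (\<lambda>i j. disjnt (cball (id i) (r i)) (cball (id j) (r j))) C"
     "E \<subseteq> (\<Union>i\<in>C. cball (id i) (5 * r i))"
    using Vitali_covering_lemma_cballs[of E id r E "G / (2 * l)"] rb by blast
  have meas_ball: "(\<lambda>x. ennreal (5 / l) * (g x * indicator (cball i (r i)) x)) \<in> borel_measurable lborel" for i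
  proof -
    have [measurable]: "cball i (r i) \<in> sets borel" by simp
    show ?thesis by measurable
  qed
  have "emeasure lborel E = (\<integral>\<^sup>+x. indicator E x \<partial>lborel)"
    unfolding E_def by (subst nn_integral_indicator) auto
  \<comment> \<open>The sum over the selected centres is written as an integral over
    \<open>count_space C\<close>, so that it can be interchanged with the integral in
    \<open>x\<close>; countability of \<open>C\<close> permits this.\<close>
  also have "\<dots> \<le> (\<integral>\<^sup>+x. \<integral>\<^sup>+i. indicator (cball i (5 * r i)) x \<partial>count_space C \<partial>lborel)"
  proof (rule nn_integral_mono)
    fix x :: real
    show "indicator E x \<le> (\<integral>\<^sup>+i. indicator (cball i (5 * r i)) x \<partial>count_space C)"
    proof (cases "x \<in> E")
      case True
      then obtain i where i: "i \<in> C" "x \<in> cball i (5 * r i)" using C(4) by auto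
      then have "1 \<le> (\<integral>\<^sup>+j. indicator {i} j \<partial>count_space C)"
        by (subst nn_integral_indicator) (auto simp: emeasure_count_space)
      also have "\<dots> \<le> (\<integral>\<^sup>+i. indicator (cball i (5 * r i)) x \<partial>count_space C)"
        using i by (intro nn_integral_mono) (auto simp: indicator_def)
      finally show ?thesis using True by simp
    qed simp
  qed
  also have "\<dots> = (\<integral>\<^sup>+i. \<integral>\<^sup>+x. indicator (cball i (5 * r i)) x \<partial>lborel \<partial>count_space C)"
    using C(1) by (intro nn_integral_count_space_nn_integral[where f="\<lambda>i x. indicator (cball i (5 * r i)) x"]) (auto intro!: borel_measurable_indicator)
  also have "\<dots> \<le> (\<integral>\<^sup>+i. \<integral>\<^sup>+x. ennreal (5 / l) * (g x * indicator (cball i (r i)) x) \<partial>lborel \<partial>count_space C)"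
  proof (rule nn_integral_mono)
    fix i assume "i \<in> space (count_space C)"
    then have i: "i \<in> E" using C(2) by auto
    have "(\<integral>\<^sup>+x. indicator (cball i (5 * r i)) x \<partial>lborel) = ennreal (5 / l * (2 * r i * l))"
      using r(1)[OF i] lam by (subst nn_integral_indicator) (auto simp: emeasure_cball_real field_simps)
    also have "\<dots> = ennreal (5 / l) * ennreal (2 * r i * l)"
      using r(1)[OF i] lam by (intro ennreal_mult) auto
    also have "\<dots> \<le> ennreal (5 / l) * (\<integral>\<^sup>+u. g u * indicator (cball i (r i)) u \<partial>lborel)"
      using r(2)[OF i] by (intro mult_left_mono) auto
    also have "\<dots> = (\<integral>\<^sup>+x. ennreal (5 / l) * (g x * indicator (cball i (r i)) x) \<partial>lborel)"
      by (rule nn_integral_cmult[symmetric]) (auto intro!: borel_measurable_times_ennreal borel_measurable_indicator)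
    finally show "(\<integral>\<^sup>+x. indicator (cball i (5 * r i)) x \<partial>lborel) \<le> \<dots>" .
  qed
  also have "\<dots> = (\<integral>\<^sup>+x. \<integral>\<^sup>+i. ennreal (5 / l) * (g x * indicator (cball i (r i)) x) \<partial>count_space C \<partial>lborel)"
    by (rule nn_integral_count_space_nn_integral[symmetric, where f="\<lambda>i x. ennreal (5 / l) * (g x * indicator (cball i (r i)) x)"], rule C(1), rule meas_ball)
  also have "\<dots> \<le> (\<integral>\<^sup>+x. ennreal (5 / l) * g x \<partial>lborel)"
  proof (rule nn_integral_mono)
    fix x :: real
    have "(\<integral>\<^sup>+i. ennreal (5 / l) * (g x * indicator (cball i (r i)) x) \<partial>count_space C)
        = ennreal (5 / l) * g x * (\<integral>\<^sup>+i. indicator {i\<in>C. x \<in> cball i (r i)} i \<partial>count_space C)"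
      by (subst nn_integral_cmult[symmetric]) (auto intro!: nn_integral_cong simp: indicator_def)
    \<comment> \<open>The selected balls are disjoint, so at most one of them contains
      \<open>x\<close>.\<close>
    also have "(\<integral>\<^sup>+i. indicator {i\<in>C. x \<in> cball i (r i)} i \<partial>count_space C) \<le> 1"
    proof (cases "{i\<in>C. x \<in> cball i (r i)} = {}")
      case False
      then obtain i where i: "i \<in> C" "x \<in> cball i (r i)" by auto
      have "{i\<in>C. x \<in> cball i (r i)} \<subseteq> {i}"
        using C(3) i unfolding pairwise_def disjnt_def id_def by blast
      then have "(\<integral>\<^sup>+j. indicator {i\<in>C. x \<in> cball i (r i)} j \<partial>count_space C) \<le> (\<integral>\<^sup>+j. indicator {i} j \<partial>count_space C)"
        by (intro nn_integral_mono) (auto simp: indicator_def)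
      also have "\<dots> = 1" using i by (subst nn_integral_indicator) (auto simp: emeasure_count_space)
      finally show ?thesis .
    qed simp
    then have "ennreal (5 / l) * g x * (\<integral>\<^sup>+i. indicator {i\<in>C. x \<in> cball i (r i)} i \<partial>count_space C) \<le> ennreal (5 / l) * g x * 1"
      by (rule mult_left_mono) auto
    finally show "(\<integral>\<^sup>+i. ennreal (5 / l) * (g x * indicator (cball i (r i)) x) \<partial>count_space C) \<le> ennreal (5 / l) * g x"
      by simp
  qed
  also have "\<dots> = ennreal (5 / l) * (\<integral>\<^sup>+u. g u \<partial>lborel)"
    by (rule nn_integral_cmult) measurable
  finally show ?thesis unfolding E_def .
qed

text \<open>The mean of the constant \<open>c\<close> over any interval is \<open>c\<close>, so a
  bounded part of a function can be split off before a weak type estimate is applied.\<close>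

lemma hl_max_add_le:
  assumes [measurable]: "g \<in> borel_measurable borel" and le: "\<And>u. g u \<le> k u + ennreal c"
    and [measurable]: "k \<in> borel_measurable borel"
  shows "hl_max g x \<le> hl_max k x + ennreal c"
  unfolding hl_max_def[of g]
proof (rule SUP_least)
  fix r :: real assume r: "r \<in> {r\<in>\<rat>. 0 < r}"
  have [measurable]: "cball x r \<in> sets borel" by simp
  have "(\<integral>\<^sup>+u. g u * indicator (cball x r) u \<partial>lborel) \<le> (\<integral>\<^sup>+u. k u * indicator (cball x r) u + ennreal c * indicator (cball x r) u \<partial>lborel)"
    by (intro nn_integral_mono) (auto simp: indicator_def le)
  also have "\<dots> = (\<integral>\<^sup>+u. k u * indicator (cball x r) u \<partial>lborel) + (\<integral>\<^sup>+u. ennreal c * indicator (cball x r) u \<partial>lborel)"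
    by (rule nn_integral_add) auto
  also have "(\<integral>\<^sup>+u. ennreal c * indicator (cball x r) u \<partial>lborel) = ennreal c * ennreal (2 * r)"
    using r by (subst nn_integral_cmult_indicator) (auto simp: emeasure_cball_real)
  finally have "(\<integral>\<^sup>+u. g u * indicator (cball x r) u \<partial>lborel) / ennreal (2 * r) \<le>
      ((\<integral>\<^sup>+u. k u * indicator (cball x r) u \<partial>lborel) + ennreal c * ennreal (2 * r)) / ennreal (2 * r)"
    by (rule divide_right_mono_ennreal)
  also have "\<dots> = (\<integral>\<^sup>+u. k u * indicator (cball x r) u \<partial>lborel) / ennreal (2 * r) + ennreal c"
    using r by (subst add_divide_distrib_ennreal) (simp add: ennreal_mult_divide_eq)
  also have "\<dots> \<le> hl_max k x + ennreal c"
    unfolding hl_max_def using r by (intro add_right_mono SUP_upper) auto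
  finally show "(\<integral>\<^sup>+u. g u * indicator (cball x r) u \<partial>lborel) / ennreal (2 * r) \<le> hl_max k x + ennreal c" .
qed

text \<open>Values of \<open>g\<close> up to \<open>m\<close> raise the maximal function by at most
  \<open>m\<close>, so only the part above \<open>m\<close> can lift it beyond \<open>2 * m\<close>.
  On that part \<open>g u \<le> m powr (1 - q) * g u powr q\<close>, which gives the weak type
  estimate the decay \<open>m powr - q\<close>, summable against dyadic heights because
  \<open>q > 1\<close>.\<close>

lemma hl_max_weak_type_powr:
  fixes g :: "real \<Rightarrow> real"
  assumes [measurable]: "g \<in> borel_measurable borel" and g0: "\<And>u. 0 \<le> g u" and m: "0 < m" and q: "1 < q"
  shows "emeasure lborel {x. hl_max (\<lambda>u. ennreal (g u)) x > ennreal (2 * m)}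
    \<le> ennreal (5 * m powr - q) * (\<integral>\<^sup>+u. ennreal (g u powr q) \<partial>lborel)"
proof -
  define k where "k = (\<lambda>u. ennreal (g u * indicator {u. g u > m} u))"
  have [measurable]: "k \<in> borel_measurable borel" unfolding k_def by measurable
  have sub: "{x. hl_max (\<lambda>u. ennreal (g u)) x > ennreal (2 * m)} \<subseteq> {x. hl_max k x > ennreal m}"
  proof safe
    fix x assume a: "hl_max (\<lambda>u. ennreal (g u)) x > ennreal (2 * m)"
    have "hl_max (\<lambda>u. ennreal (g u)) x \<le> hl_max k x + ennreal m"
    proof (rule hl_max_add_le)
      fix u show "ennreal (g u) \<le> k u + ennreal m"
        using g0[of u] m by (cases "g u > m") (auto simp: k_def ennreal_plus[symmetric] simp del: ennreal_plus intro!: ennreal_leI)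
    qed measurable
    then have "ennreal m + ennreal m < hl_max k x + ennreal m"
      using a m by (simp add: ennreal_plus[symmetric] del: ennreal_plus) 
    then show "hl_max k x > ennreal m" 
      by (metis add_right_mono not_less)
  qed
  have "emeasure lborel {x. hl_max (\<lambda>u. ennreal (g u)) x > ennreal (2 * m)} \<le> emeasure lborel {x. hl_max k x > ennreal m}"
    using sub by (intro emeasure_mono) auto
  also have "\<dots> \<le> ennreal (5 / m) * (\<integral>\<^sup>+u. k u \<partial>lborel)"
    by (rule hl_max_weak_type) (use m in auto)
  also have "\<dots> \<le> ennreal (5 / m) * (\<integral>\<^sup>+u. ennreal (m powr (1 - q)) * ennreal (g u powr q) \<partial>lborel)"
  proof (intro mult_left_mono nn_integral_mono)
    fix u
    show "k u \<le> ennreal (m powr (1 - q)) * ennreal (g u powr q)"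
    proof (cases "g u > m")
      case True
      have "g u = g u powr (1 - q) * g u powr q" using True m by (simp add: powr_add[symmetric])
      also have "\<dots> \<le> m powr (1 - q) * g u powr q"
        using True m q by (intro mult_right_mono powr_mono2') auto
      finally show ?thesis using True by (simp add: k_def ennreal_mult[symmetric] ennreal_leI)
    qed (simp add: k_def)
  qed auto
  also have "\<dots> = ennreal (5 / m) * ennreal (m powr (1 - q)) * (\<integral>\<^sup>+u. ennreal (g u powr q) \<partial>lborel)"
    by (subst nn_integral_cmult) (auto simp: mult.assoc)
  also have "ennreal (5 / m) * ennreal (m powr (1 - q)) = ennreal (5 * m powr - q)"
    using m by (simp add: ennreal_mult[symmetric] powr_diff powr_minus field_simps)
  finally show ?thesis .
qed

section \<open>Integrating the maximal function over a bounded interval\<close>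

lemma ennreal_term_le_suminf: "f n \<le> (\<Sum>j. f j)" for f :: "nat \<Rightarrow> ennreal"
proof -
  have "sum f {n} \<le> suminf f" by (rule sum_le_suminf) auto
  then show ?thesis by simp
qed

text \<open>A dyadic layer cake: for finite \<open>u > 1\<close> the largest power of two strictly
  below \<open>u\<close> occurs in the sum and is at least \<open>u / 2\<close>, while the summand 1
  covers the smaller values. For \<open>u = top\<close> every power occurs and the sum
  diverges.\<close>

lemma ennreal_le_dyadic_sum:
  "u \<le> 1 + 2 * (\<Sum>j. ennreal (2 ^ j) * indicator {v. v > ennreal (2 ^ j)} u)" (is "_ \<le> 1 + 2 * ?S")
proof -
  have term_le: "ennreal (2 ^ j) \<le> ?S" if "u > ennreal (2 ^ j)" for j
  proof -
    have "ennreal (2 ^ j) * indicator {v. v > ennreal (2 ^ j)} u \<le> ?S"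
      by (rule ennreal_term_le_suminf[of "\<lambda>j. ennreal (2 ^ j) * indicator {v. v > ennreal (2 ^ j)} u" j])
    then show ?thesis using that by simp
  qed
  show ?thesis
  proof (cases u)
    case top
    have "?S = top"
    proof (rule ccontr)
      assume "?S \<noteq> top"
      then obtain s where s: "?S = ennreal s" "0 \<le> s" by (cases ?S) auto
      obtain n where "s < 2 ^ n" using real_arch_pow[of 2 s] by auto
      moreover have "ennreal (2 ^ n) \<le> ?S" by (rule term_le) (simp add: top)
      ultimately show False using s(2) unfolding s(1) by (simp add: ennreal_le_iff)
    qed
    then show ?thesis by (simp add: ennreal_mult_top)
  next
    case (real a)
    show ?thesis
    proof (cases "a \<le> 1")
      case True
      then have "u \<le> 1" using real by simp
      then show ?thesis by (metis add_increasing2 zero_le)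
    next
      case False
      define n where "n = (LEAST n. a \<le> 2 ^ n)"
      have ex: "\<exists>n. a \<le> 2 ^ n" using real_arch_pow[of 2 a] by (auto intro: less_imp_le)
      have n: "a \<le> 2 ^ n" unfolding n_def using LeastI_ex[OF ex] .
      then obtain k where k: "n = Suc k" using False by (cases n) auto
      have "\<not> a \<le> 2 ^ k" using not_less_Least[of k "\<lambda>n. a \<le> 2 ^ n"] k n_def by auto
      then have "ennreal (2 ^ k) \<le> ?S" using real by (intro term_le) (auto simp: ennreal_less_iff)
      moreover have "u \<le> 2 * ennreal (2 ^ k)"
        using n k real by (simp add: ennreal_mult[symmetric] ennreal_leI flip: ennreal_numeral)
      ultimately have "u \<le> 2 * ?S" by (meson mult_left_mono order_trans zero_le)
      then show ?thesis by (simp add: add_increasing)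
    qed
  qed
qed

text \<open>Inserting the weak type bounds at the heights \<open>2 ^ j\<close> into the dyadic
  decomposition gives a geometric series with ratio \<open>w = 2 powr (1 - q) < 1\<close>. The 4 is
  the length of \<open>{-2..2}\<close> and comes from the constant term of that
  decomposition.\<close>

lemma hl_max_local_integral:
  assumes q: "1 < (q::real)"
  obtains C where "0 \<le> C" and
    "\<And>g :: real \<Rightarrow> real. g \<in> borel_measurable borel \<Longrightarrow> (\<And>u. 0 \<le> g u) \<Longrightarrow>
      (\<integral>\<^sup>+x\<in>{-2..2}. hl_max (\<lambda>u. ennreal (g u)) x \<partial>lborel) \<le> 4 + ennreal C * (\<integral>\<^sup>+u. ennreal (g u powr q) \<partial>lborel)"
proof -
  define w where "w = 2 powr (1 - q)"
  have w: "0 < w" "w < 1" unfolding w_def using q by (auto simp: powr_less_one)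
  define C where "C = 10 * 2 powr q * (1 / (1 - w))"
  show ?thesis
  proof
    show "0 \<le> C" unfolding C_def using w by simp
    fix g :: "real \<Rightarrow> real"
    assume [measurable]: "g \<in> borel_measurable borel" and g0: "\<And>u. 0 \<le> g u"
    let ?M = "hl_max (\<lambda>u. ennreal (g u))"
    let ?I = "\<integral>\<^sup>+u. ennreal (g u powr q) \<partial>lborel"
    have [measurable]: "?M \<in> borel_measurable borel" by measurable
    have "(\<integral>\<^sup>+x\<in>{-2..2}. ?M x \<partial>lborel) \<le> (\<integral>\<^sup>+x. indicator {-2..2} x + 2 * (\<Sum>j. ennreal (2 ^ j) * indicator {x. ?M x > ennreal (2 ^ j)} x) \<partial>lborel)"
    proof (rule nn_integral_mono)
      fix x :: real
      have "?M x \<le> 1 + 2 * (\<Sum>j. ennreal (2 ^ j) * indicator {v. v > ennreal (2 ^ j)} (?M x))"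
        by (rule ennreal_le_dyadic_sum)
      then show "?M x * indicator {-2..2} x \<le> indicator {-2..2} x + 2 * (\<Sum>j. ennreal (2 ^ j) * indicator {x. ?M x > ennreal (2 ^ j)} x)"
        by (auto simp: indicator_def)
    qed
    also have "\<dots> = 4 + 2 * (\<Sum>j. ennreal (2 ^ j) * emeasure lborel {x. ?M x > ennreal (2 ^ j)})"
      by (subst nn_integral_add) (auto simp: nn_integral_cmult nn_integral_suminf)
    also have "\<dots> \<le> 4 + 2 * (\<Sum>j. ennreal (5 * 2 powr q * w ^ j) * ?I)"
    proof (intro add_left_mono mult_left_mono suminf_le)
      fix j
      \<comment> \<open>The weak type estimate concerns the height \<open>2 * m\<close>, hence
        \<open>m = 2 ^ j / 2\<close>.\<close>
      have "emeasure lborel {x. ?M x > ennreal (2 ^ j)} \<le> ennreal (5 * (2 ^ j / 2) powr - q) * ?I"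
        using hl_max_weak_type_powr[of g "2 ^ j / 2" q] g0 q by simp
      then have "ennreal (2 ^ j) * emeasure lborel {x. ?M x > ennreal (2 ^ j)} \<le> ennreal (2 ^ j) * (ennreal (5 * (2 ^ j / 2) powr - q) * ?I)"
        by (rule mult_left_mono) simp
      also have "\<dots> = ennreal (2 ^ j * (5 * (2 ^ j / 2) powr - q)) * ?I"
        by (simp add: ennreal_mult mult.assoc)
      also have "2 ^ j * (5 * (2 ^ j / 2) powr - q) = 5 * 2 powr q * w ^ j"
      proof -
        have "(2::real) ^ j * (2 ^ j / 2) powr - q = 2 powr real j * (2 powr (real j - 1)) powr - q"
          by (simp add: powr_realpow powr_diff)
        also have "\<dots> = 2 powr q * 2 powr ((1 - q) * real j)"
          by (simp add: powr_powr powr_add[symmetric] algebra_simps)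
        also have "2 powr ((1 - q) * real j) = w ^ j"
          unfolding w_def by (simp add: powr_powr[symmetric] powr_realpow)
        finally show ?thesis by simp
      qed
      finally show "ennreal (2 ^ j) * emeasure lborel {x. ?M x > ennreal (2 ^ j)} \<le> ennreal (5 * 2 powr q * w ^ j) * ?I" .
    qed auto
    also have "\<dots> = 4 + 2 * (ennreal (5 * 2 powr q * (1 / (1 - w))) * ?I)"
    proof -
      have "(\<lambda>j. 5 * 2 powr q * w ^ j) sums (5 * 2 powr q * (1 / (1 - w)))"
        using geometric_sums[of w] w by (intro sums_mult) auto
      then have "(\<Sum>j. ennreal (5 * 2 powr q * w ^ j)) = ennreal (5 * 2 powr q * (1 / (1 - w)))"
        using w by (intro suminf_ennreal_eq) auto
      then show ?thesis by (simp add: ennreal_suminf_multc)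
    qed
    also have "\<dots> = 4 + ennreal C * ?I"
    proof -
      have "ennreal C = ennreal 2 * ennreal (5 * 2 powr q * (1 / (1 - w)))"
        unfolding C_def using w by (subst ennreal_mult[symmetric]) auto
      then show ?thesis by (simp add: mult.assoc)
    qed
    finally show "(\<integral>\<^sup>+x\<in>{-2..2}. ?M x \<partial>lborel) \<le> 4 + ennreal C * ?I" .
  qed
qed

text \<open>The kernel is dominated by a sum over the balls of radius \<open>2 ^ j * y\<close> with
  coefficients \<open>4 / (y * 4 ^ j)\<close>. Such a ball has length \<open>2 * 2 ^ j * y\<close>,
  so its term is at most \<open>8 * (1/2) ^ j\<close> times the maximal function, and these factors
  sum to 16. Rationality of \<open>y\<close> makes all the radii admissible in
  \<open>hl_max\<close>.\<close>

lemma poisson_le_hl_max: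
  assumes [measurable]: "g \<in> borel_measurable borel" and y: "0 < y" "y \<in> \<rat>"
  shows "(\<integral>\<^sup>+u. g u * ennreal (y / ((x - u)\<^sup>2 + y\<^sup>2)) \<partial>lborel) \<le> 16 * hl_max g x"
proof -
  let ?c = "\<lambda>j::nat. 4 / (y * 4 ^ j)"
  have ptw: "ennreal (y / ((x - u)\<^sup>2 + y\<^sup>2)) \<le> (\<Sum>j. ennreal (?c j) * indicator (cball x (2 ^ j * y)) u)" for u
  proof -
    define s where "s = \<bar>x - u\<bar>"
    have s2: "(x - u)\<^sup>2 = s\<^sup>2" unfolding s_def by simp
    \<comment> \<open>The smallest dyadic ball containing \<open>u\<close>. Unless
      \<open>n = 0\<close>, the point \<open>u\<close> lies outside the ball of half the radius,
      which bounds the denominator of the kernel from below.\<close>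
    define n where "n = (LEAST n. s \<le> 2 ^ n * y)"
    obtain k where "s / y < 2 ^ k" using real_arch_pow[of 2 "s / y"] by auto
    then have ex: "\<exists>n. s \<le> 2 ^ n * y" using y by (intro exI[of _ k]) (simp add: field_simps)
    have n: "s \<le> 2 ^ n * y" unfolding n_def using LeastI_ex[OF ex] .
    have "y / (s\<^sup>2 + y\<^sup>2) \<le> ?c n"
    proof (cases n)
      case 0
      have "y / (s\<^sup>2 + y\<^sup>2) \<le> y / y\<^sup>2" using y by (intro divide_left_mono mult_pos_pos) (auto intro: add_nonneg_pos)
      also have "\<dots> \<le> 4 / y" using y by (simp add: power2_eq_square field_simps)
      finally show ?thesis using 0 by simp
    next
      case (Suc k)
      have "\<not> s \<le> 2 ^ k * y" using not_less_Least[of k "\<lambda>n. s \<le> 2 ^ n * y"] Suc n_def by auto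
      then have "(2 ^ k * y)\<^sup>2 \<le> s\<^sup>2" using y by (intro power_mono) auto
      then have "(2 ^ k * y)\<^sup>2 \<le> s\<^sup>2 + y\<^sup>2" using zero_le_power2[of y] by linarith
      then have "y / (s\<^sup>2 + y\<^sup>2) \<le> y / (2 ^ k * y)\<^sup>2"
      proof (rule divide_left_mono)
        show "0 < (s\<^sup>2 + y\<^sup>2) * (2 ^ k * y)\<^sup>2"
          using y by (intro mult_pos_pos add_nonneg_pos zero_less_power) auto
      qed (use y in auto)
      also have "y / (2 ^ k * y)\<^sup>2 = ?c n"
      proof -
        have "(4::real) ^ k = 2 ^ k * 2 ^ k" by (simp flip: power_mult_distrib)
        then have "(2 ^ k * y)\<^sup>2 = 4 ^ k * y\<^sup>2" by (simp only: power2_eq_square mult_ac)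
        then show ?thesis using y Suc by (simp add: power2_eq_square field_simps)
      qed
      finally show ?thesis .
    qed
    then have "ennreal (y / ((x - u)\<^sup>2 + y\<^sup>2)) \<le> ennreal (?c n) * indicator (cball x (2 ^ n * y)) u"
      using n unfolding s2 by (simp add: s_def dist_real_def ennreal_leI)
    also have "\<dots> \<le> (\<Sum>j. ennreal (?c j) * indicator (cball x (2 ^ j * y)) u)"
      by (rule ennreal_term_le_suminf[of "\<lambda>j. ennreal (?c j) * indicator (cball x (2 ^ j * y)) u" n])
    finally show ?thesis .
  qed
  have "(\<integral>\<^sup>+u. g u * ennreal (y / ((x - u)\<^sup>2 + y\<^sup>2)) \<partial>lborel) \<le> (\<integral>\<^sup>+u. (\<Sum>j. ennreal (?c j) * (g u * indicator (cball x (2 ^ j * y)) u)) \<partial>lborel)"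
  proof (rule nn_integral_mono)
    fix u
    have "g u * ennreal (y / ((x - u)\<^sup>2 + y\<^sup>2)) \<le> g u * (\<Sum>j. ennreal (?c j) * indicator (cball x (2 ^ j * y)) u)"
      using ptw by (rule mult_left_mono) simp
    also have "\<dots> = (\<Sum>j. ennreal (?c j) * (g u * indicator (cball x (2 ^ j * y)) u))"
      by (subst ennreal_suminf_cmult[symmetric]) (simp add: mult.left_commute)
    finally show "g u * ennreal (y / ((x - u)\<^sup>2 + y\<^sup>2)) \<le> \<dots>" .
  qed
  also have "\<dots> = (\<Sum>j. ennreal (?c j) * (\<integral>\<^sup>+u. g u * indicator (cball x (2 ^ j * y)) u \<partial>lborel))"
  proof (subst nn_integral_suminf)
    show "(\<Sum>j. \<integral>\<^sup>+u. ennreal (?c j) * (g u * indicator (cball x (2 ^ j * y)) u) \<partial>lborel) =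
      (\<Sum>j. ennreal (?c j) * (\<integral>\<^sup>+u. g u * indicator (cball x (2 ^ j * y)) u \<partial>lborel))"
      by (intro suminf_cong nn_integral_cmult) measurable
  qed measurable
  also have "\<dots> \<le> (\<Sum>j. ennreal (8 * (1/2) ^ j) * hl_max g x)"
  proof (intro suminf_le)
    fix j :: nat
    let ?J = "\<integral>\<^sup>+u. g u * indicator (cball x (2 ^ j * y)) u \<partial>lborel"
    let ?r = "2 ^ j * y"
    have r: "?r \<in> {r\<in>\<rat>. 0 < r}" using y by (auto intro!: Rats_mult Rats_power)
    have "?J / ennreal (2 * ?r) \<le> hl_max g x" unfolding hl_max_def by (rule SUP_upper[OF r])
    then have "ennreal (2 * ?r) * (?J / ennreal (2 * ?r)) \<le> ennreal (2 * ?r) * hl_max g x" by (rule mult_left_mono) simp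
    moreover have "ennreal (2 * ?r) * (?J / ennreal (2 * ?r)) = ?J"
    proof -
      have "ennreal (2 * ?r) * (?J / ennreal (2 * ?r)) = ?J * ennreal (2 * ?r) / ennreal (2 * ?r)"
        by (simp only: ennreal_times_divide mult.commute)
      also have "\<dots> = ?J" using y by (intro ennreal_mult_divide_eq) auto
      finally show ?thesis .
    qed
    ultimately have "ennreal (?c j) * ?J \<le> ennreal (?c j) * (ennreal (2 * ?r) * hl_max g x)"
      by (intro mult_left_mono) auto
    also have "\<dots> = ennreal (?c j * (2 * ?r)) * hl_max g x"
    proof -
      have "ennreal (?c j * (2 * ?r)) = ennreal (?c j) * ennreal (2 * ?r)" using y by (intro ennreal_mult) auto
      then show ?thesis by (simp only: mult.assoc)
    qed
    also have "\<dots> = ennreal (8 * (1/2) ^ j) * hl_max g x"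
    proof -
      have "(4::real) ^ j = 2 ^ j * 2 ^ j" by (simp flip: power_mult_distrib)
      then have "?c j * (2 * ?r) = 8 * (1/2) ^ j" using y by (simp add: power_divide)
      then show ?thesis by (simp only:)
    qed
    finally show "ennreal (?c j) * ?J \<le> ennreal (8 * (1/2) ^ j) * hl_max g x" .
  qed auto
  also have "\<dots> = 16 * hl_max g x"
  proof -
    have "(\<lambda>j. 8 * (1/2) ^ j) sums (8 * (1 / (1 - 1/2)) :: real)"
      by (intro sums_mult geometric_sums) auto
    then have "(\<Sum>j. ennreal (8 * (1/2) ^ j)) = ennreal 16"
      by (intro suminf_ennreal_eq) auto
    then show ?thesis by (simp add: ennreal_suminf_multc)
  qed
  finally show ?thesis .
qed

section \<open>Integrals along horizontal lines\<close>

lemma nn_integral_even: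
  assumes [measurable]: "f \<in> borel_measurable borel"
  shows "(\<integral>\<^sup>+u. f \<bar>u::real\<bar> \<partial>lborel) = 2 * (\<integral>\<^sup>+u. f u * indicator {0..} u \<partial>lborel)"
proof -
  have "(\<integral>\<^sup>+u. f \<bar>u::real\<bar> \<partial>lborel) = (\<integral>\<^sup>+u. f u * indicator {0..} u + f (- u) * indicator {..<0} u \<partial>lborel)"
    by (intro nn_integral_cong) (auto simp: indicator_def)
  also have "\<dots> = (\<integral>\<^sup>+u. f u * indicator {0..} u \<partial>lborel) + (\<integral>\<^sup>+u. f (- u) * indicator {..<0} u \<partial>lborel)"
    by (rule nn_integral_add) auto
  also have "(\<integral>\<^sup>+u. f (- u) * indicator {..<0} u \<partial>lborel) = (\<integral>\<^sup>+u. f u * indicator {..<0} (- u) \<partial>lborel)"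
    using nn_integral_real_affine[of "\<lambda>u. f (- u) * indicator {..<0} u" "-1" 0] by simp
  also have "\<dots> = (\<integral>\<^sup>+u. f u * indicator {0..} u \<partial>lborel)"
  proof (rule nn_integral_cong_AE)
    have "AE u in lborel. u \<noteq> (0::real)" by (rule AE_lborel_singleton)
    then show "AE u in lborel. f u * indicator {..<0} (- u) = f u * indicator {0..} u"
      by eventually_elim (auto simp: indicator_def)
  qed
  finally show ?thesis by (simp add: mult_2)
qed

lemma nn_integral_poisson_kernel:
  assumes y: "0 < (y::real)"
  shows "(\<integral>\<^sup>+u. ennreal (y / ((x - u)\<^sup>2 + y\<^sup>2)) \<partial>lborel) = ennreal pi"
proof -
  have half: "(\<integral>\<^sup>+u. ennreal (y / (u\<^sup>2 + y\<^sup>2)) * indicator {0..} u \<partial>lborel) = ennreal (pi / 2 - arctan (0 / y))"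
  proof (rule nn_integral_FTC_atLeast[where F = "\<lambda>u. arctan (u / y)"])
    fix u :: real assume "0 \<le> u"
    have "((\<lambda>u. arctan (u / y)) has_real_derivative (1 / y) * inverse (1 + (u / y)\<^sup>2)) (at u)"
      using y by (auto intro!: derivative_eq_intros simp: field_simps)
    also have "(1 / y) * inverse (1 + (u / y)\<^sup>2) = y / (u\<^sup>2 + y\<^sup>2)"
      using y by (simp add: power2_eq_square divide_simps add_nonneg_eq_0_iff)
    finally show "((\<lambda>u. arctan (u / y)) has_real_derivative y / (u\<^sup>2 + y\<^sup>2)) (at u)" .
    show "0 \<le> y / (u\<^sup>2 + y\<^sup>2)" using y by simp
  next
    have "filterlim (\<lambda>u. u * (1 / y)) at_top at_top"
      using y by (intro filterlim_at_top_mult_tendsto_pos[OF tendsto_const]) (auto intro: filterlim_ident)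
    then have "filterlim (\<lambda>u. u / y) at_top at_top" by simp
    from filterlim_compose[OF tendsto_arctan_at_top this]
    show "((\<lambda>u. arctan (u / y)) \<longlongrightarrow> pi / 2) at_top" .
  qed measurable
  have "(\<integral>\<^sup>+u. ennreal (y / ((x - u)\<^sup>2 + y\<^sup>2)) \<partial>lborel) = (\<integral>\<^sup>+u. ennreal (y / (u\<^sup>2 + y\<^sup>2)) \<partial>lborel)"
    using nn_integral_real_affine[of "\<lambda>u. ennreal (y / ((x - u)\<^sup>2 + y\<^sup>2))" 1 x] by simp
  also have "\<dots> = 2 * (\<integral>\<^sup>+u. ennreal (y / (u\<^sup>2 + y\<^sup>2)) * indicator {0..} u \<partial>lborel)"
    using nn_integral_even[of "\<lambda>u. ennreal (y / (u\<^sup>2 + y\<^sup>2))"] by simp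
  also have "\<dots> = ennreal 2 * ennreal (pi / 2)" unfolding half by simp
  also have "\<dots> = ennreal pi" by (subst ennreal_mult[symmetric]) auto
  finally show ?thesis .
qed

text \<open>Young's inequality gives
  \<open>u x \<le> s powr (1 - p) / p * u x powr p + s * (1 - 1 / p)\<close> for every
  \<open>s > 0\<close>. Integrating against \<open>w\<close> and optimizing over \<open>s\<close>
  yields the claim; the choice \<open>s = 1\<close> already shows that the integral is
  finite.\<close>

lemma nn_integral_jensen_powr:
  fixes u w :: "'a \<Rightarrow> real"
  assumes p: "1 < p" and [measurable]: "u \<in> borel_measurable M" "w \<in> borel_measurable M"
    and u0: "\<And>x. 0 \<le> u x" and w0: "\<And>x. 0 \<le> w x"
    and W: "(\<integral>\<^sup>+x. ennreal (w x) \<partial>M) \<le> ennreal W" "0 \<le> W"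
    and K: "(\<integral>\<^sup>+x. ennreal (u x powr p * w x) \<partial>M) = ennreal K" "0 \<le> K"
  obtains I where "0 \<le> I" "(\<integral>\<^sup>+x. ennreal (u x * w x) \<partial>M) = ennreal I" "I powr p \<le> W powr (p - 1) * K"
proof -
  define J where "J = (\<integral>\<^sup>+x. ennreal (u x * w x) \<partial>M)"
  have bnd: "J \<le> ennreal (s powr (1 - p) / p * K + s * (1 - 1 / p) * W)" if s: "0 < s" for s
  proof -
    have ptw: "u x * w x \<le> s powr (1 - p) / p * (u x powr p * w x) + s * (1 - 1 / p) * w x" for x
    proof -
      have "u x / s * 1 \<le> (u x / s) powr p / p + 1 powr (p / (p - 1)) / (p / (p - 1))"
        by (rule Youngs_inequality) (use p u0[of x] s in \<open>auto simp: field_simps\<close>)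
      also have "(u x / s) powr p = u x powr p / s powr p" using u0[of x] s by (simp add: powr_divide)
      also have "1 powr (p / (p - 1)) / (p / (p - 1)) = 1 - 1 / p" using p by (simp add: field_simps)
      finally have "u x \<le> (u x powr p / s powr p / p + (1 - 1 / p)) * s" using s by (simp add: field_simps)
      also have "\<dots> = s powr (1 - p) / p * u x powr p + s * (1 - 1 / p)"
        using s by (simp add: powr_diff algebra_simps)
      finally have "u x * w x \<le> (s powr (1 - p) / p * u x powr p + s * (1 - 1 / p)) * w x"
        by (rule mult_right_mono) (rule w0)
      then show ?thesis by (simp add: algebra_simps)
    qed
    have "J \<le> (\<integral>\<^sup>+x. ennreal (s powr (1 - p) / p * (u x powr p * w x) + s * (1 - 1 / p) * w x) \<partial>M)"
      unfolding J_def by (intro nn_integral_mono ennreal_leI ptw)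
    also have "\<dots> = (\<integral>\<^sup>+x. ennreal (s powr (1 - p) / p) * ennreal (u x powr p * w x) + ennreal (s * (1 - 1 / p)) * ennreal (w x) \<partial>M)"
      using p s w0 by (intro nn_integral_cong) (simp add: ennreal_mult'[symmetric] ennreal_plus[symmetric] del: ennreal_plus)
    also have "\<dots> = ennreal (s powr (1 - p) / p) * ennreal K + ennreal (s * (1 - 1 / p)) * (\<integral>\<^sup>+x. ennreal (w x) \<partial>M)"
      by (simp add: nn_integral_add nn_integral_cmult K)
    also have "\<dots> \<le> ennreal (s powr (1 - p) / p) * ennreal K + ennreal (s * (1 - 1 / p)) * ennreal W"
      by (intro add_left_mono mult_left_mono W) auto
    also have "\<dots> = ennreal (s powr (1 - p) / p * K + s * (1 - 1 / p) * W)"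
      using p s K W by (simp add: ennreal_mult'[symmetric] ennreal_plus[symmetric] del: ennreal_plus)
    finally show ?thesis .
  qed
  have "J < \<infinity>" using bnd[of 1] by (auto simp: less_top[symmetric] top_unique)
  then obtain I where I: "J = ennreal I" "0 \<le> I" by (cases J) auto
  have Ibnd: "I \<le> s powr (1 - p) / p * K + s * (1 - 1 / p) * W" if s: "0 < s" for s
  proof -
    have "0 \<le> s powr (1 - p) / p * K + s * (1 - 1 / p) * W" using p s K W by simp
    then show ?thesis using bnd[OF s] I by simp
  qed
  \<comment> \<open>The optimal \<open>s\<close> is \<open>(K / W) powr (1 / p)\<close>. Enlarging
    both numbers by \<open>e\<close> keeps it defined and positive when \<open>K\<close> or
    \<open>W\<close> vanishes; \<open>e\<close> tends to 0 at the end.\<close>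
  have ev: "I powr p \<le> (W + e) powr (p - 1) * (K + e)" if e: "0 < e" for e
  proof -
    define s where "s = ((K + e) / (W + e)) powr (1 / p)"
    have pos: "0 < K + e" "0 < W + e" using K W e by auto
    have s: "0 < s" unfolding s_def using pos by simp
    have sp: "s powr p = (K + e) / (W + e)" unfolding s_def using p pos by (simp add: powr_powr)
    have "I \<le> s powr (1 - p) / p * (K + e) + s * (1 - 1 / p) * (W + e)"
      by (rule order_trans[OF Ibnd[OF s]]) (intro add_mono mult_left_mono, use p s e in auto)
    also have "s powr (1 - p) / p * (K + e) = s * (1 / p) * (W + e)"
    proof -
      have "s powr (1 - p) = s * (W + e) / (K + e)" using s pos sp by (simp add: powr_diff)
      then show ?thesis using pos by simp
    qed
    also have "s * (1 / p) * (W + e) + s * (1 - 1 / p) * (W + e) = s * (W + e)" by (simp add: algebra_simps)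
    finally have "I powr p \<le> (s * (W + e)) powr p" using I p by (intro powr_mono2) auto
    also have "\<dots> = (K + e) / (W + e) * (W + e) powr p" using s pos sp by (simp add: powr_mult)
    also have "\<dots> = (W + e) powr (p - 1) * (K + e)" using pos by (simp add: powr_diff)
    finally show ?thesis .
  qed
  have "((\<lambda>e. (W + e) powr (p - 1) * (K + e)) \<longlongrightarrow> (W + 0) powr (p - 1) * (K + 0)) (at_right 0)"
    using p W by (intro tendsto_intros tendsto_powr') (auto simp: eventually_at_filter)
  then have "I powr p \<le> (W + 0) powr (p - 1) * (K + 0)"
    by (rule tendsto_lowerbound) (auto simp: eventually_at_filter ev)
  then show ?thesis using I that[of I] unfolding J_def by simp
qed

text \<open>Cauchy's theorem for the half disc of radius \<open>R\<close> resting on the line: the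
  arc contributes at most \<open>C * pi * R powr (1 - \<kappa>)\<close>, which vanishes in the limit
  because \<open>\<kappa> > 1\<close>. The half plane of holomorphy is open and contains the line;
  its height \<open>b\<close> is a parameter because one application has a pole below the
  line.\<close>

lemma horizontal_line_integral_zero:
  assumes hol: "f holomorphic_on {z. b < Im z}" and y: "b < y" "0 < y" and k: "1 < \<kappa>" and C: "0 \<le> C"
    and decay: "\<And>z. y \<le> Im z \<Longrightarrow> L \<le> norm z \<Longrightarrow> norm (f z) \<le> C * norm z powr - \<kappa>"
    and int: "integrable lborel (\<lambda>x. f (Complex x y))"
  shows "(\<integral>x. f (Complex x y) \<partial>lborel) = 0"
proof -
  let ?g = "\<lambda>x. f (Complex x y)"
  let ?A = "\<lambda>R::real. LINT x:{-R..R}|lborel. ?g x"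
  have cont: "continuous_on {z. b < Im z} f" using hol by (rule holomorphic_on_imp_continuous_on)
  have bound: "norm (?A R) \<le> C * pi * R powr (1 - \<kappa>)" if R: "R \<ge> max 1 L" for R
  proof -
    have R0: "0 < R" "L \<le> R" using R by auto
    let ?l = "linepath (Complex (-R) y) (Complex R y)"
    let ?c = "part_circlepath (Complex 0 y) R 0 pi"
    have pl: "path_image ?l \<subseteq> {z. b < Im z}"
    proof -
      have "closed_segment (Complex (-R) y) (Complex R y) \<subseteq> {z. b < Im z}"
        using y by (intro closed_segment_subset) (auto simp: convex_halfspace_Im_gt)
      then show ?thesis by simp
    qed
    \<comment> \<open>The centre \<open>Complex 0 y\<close> lies on the upper imaginary axis, so the
      upper arc of radius \<open>R\<close> around it never comes closer than \<open>R\<close> to the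
      origin, and the decay hypothesis applies on it.\<close>
    have imc: "y \<le> Im z \<and> R \<le> norm z" if z: "z \<in> path_image ?c" for z
    proof -
      obtain t where t: "0 \<le> t" "t \<le> pi" "z = Complex 0 y + of_real R * cis t"
        using z by (auto simp: path_image_part_circlepath' closed_segment_eq_real_ivl)
      have Re: "Re z = R * cos t" and Im: "Im z = y + R * sin t" using t(3) by auto
      have st: "0 \<le> R * sin t" using t R0 by (simp add: sin_ge_zero)
      have "R\<^sup>2 = (R * cos t)\<^sup>2 + (R * sin t)\<^sup>2" by (simp add: power_mult_distrib flip: distrib_left)
      also have "\<dots> \<le> (R * cos t)\<^sup>2 + (y + R * sin t)\<^sup>2" using st y by (intro add_left_mono power_mono) auto
      also have "\<dots> = (norm z)\<^sup>2" by (simp add: cmod_power2 Re Im)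
      finally have "R \<le> norm z" by (rule power2_le_imp_le) simp
      then show ?thesis using Im st by simp
    qed
    have pc: "path_image ?c \<subseteq> {z. b < Im z}" using imc y by fastforce
    have ij: "f contour_integrable_on ?l" "f contour_integrable_on ?c"
      using cont pl pc by (auto intro!: contour_integrable_continuous_linepath contour_integrable_continuous_part_circlepath intro: continuous_on_subset)
    have join: "pathfinish ?l = pathstart ?c" "pathfinish ?c = pathstart ?l"
      by (auto simp: complex_eq_iff exp_pi_i exp_pi_i' pathfinish_part_circlepath)
    have "(f has_contour_integral 0) (?l +++ ?c)"
      using hol pl pc join by (intro Cauchy_theorem_convex_simple[of _ "{z. b < Im z}"])
        (auto simp: convex_halfspace_Im_gt path_image_join valid_path_join)
    then have "contour_integral ?l f + contour_integral ?c f = 0"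
      using ij join by (metis contour_integral_join contour_integral_unique valid_path_linepath valid_path_part_circlepath)
    moreover have "norm (contour_integral ?c f) \<le> (C * R powr - \<kappa>) * R * \<bar>pi - 0\<bar>"
    proof (rule contour_integral_bound_part_circlepath)
      fix z assume z: "z \<in> path_image ?c"
      have "norm (f z) \<le> C * norm z powr - \<kappa>" using imc[OF z] R0 by (intro decay) auto
      also have "\<dots> \<le> C * R powr - \<kappa>" using imc[OF z] R0 k C by (intro mult_left_mono powr_mono2') auto
      finally show "norm (f z) \<le> C * R powr - \<kappa>" .
    qed (use ij R0 C in auto)
    moreover have "(C * R powr - \<kappa>) * R * \<bar>pi - 0\<bar> = C * pi * R powr (1 - \<kappa>)"
      using R0 by (simp add: powr_diff powr_minus field_simps)
    moreover have "contour_integral ?l f = ?A R"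
    proof -
      have "contour_integral ?l f = integral {0..1} (\<lambda>t. f (?l t) * (Complex R y - Complex (-R) y))"
        by (simp add: contour_integral_integral)
      also have "(\<lambda>t. f (?l t) * (Complex R y - Complex (-R) y)) = (\<lambda>t. of_real (2 * R) * ?g (-R + 2 * R * t))"
      proof
        fix t
        have "?l t = Complex (-R + 2 * R * t) y" by (simp add: linepath_def complex_eq_iff algebra_simps)
        moreover have "Complex R y - Complex (-R) y = of_real (2 * R)" by (simp add: complex_eq_iff)
        ultimately show "f (?l t) * (Complex R y - Complex (-R) y) = of_real (2 * R) * ?g (-R + 2 * R * t)" by simp
      qed
      also have "integral {0..1} \<dots> = (LINT t:{0..1}|lborel. of_real (2 * R) * ?g (-R + 2 * R * t))"
      proof (rule set_borel_integral_eq_integral(2)[symmetric])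
        have "integrable lborel (\<lambda>t. ?g (-R + 2 * R * t))"
          using R0 by (intro lborel_integrable_real_affine int) auto
        then show "set_integrable lborel {0..1} (\<lambda>t. of_real (2 * R) * ?g (-R + 2 * R * t))"
          unfolding set_integrable_def by (intro integrable_mult_indicator integrable_mult_right) auto
      qed
      also have "\<dots> = (2 * R) *\<^sub>R (\<integral>t. indicator {-R..R} (-R + 2 * R * t) *\<^sub>R ?g (-R + 2 * R * t) \<partial>lborel)"
      proof -
        have "indicator {0..1} t = (indicator {-R..R} (-R + 2 * R * t) :: real)" for t
          using R0 by (auto simp: indicator_def field_simps zero_le_mult_iff)
        then show ?thesis unfolding set_lebesgue_integral_def
          by (simp add: scaleR_conv_of_real mult.left_commute)
      qed
      also have "\<dots> = ?A R"
        unfolding set_lebesgue_integral_def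
        using lborel_integral_real_affine[of "2 * R" "\<lambda>x. indicator {-R..R} x *\<^sub>R ?g x" "-R"] R0 by simp
      finally show ?thesis .
    qed
    ultimately show ?thesis by (metis add_eq_0_iff norm_minus_cancel)
  qed
  have "(\<lambda>n. ?A (real n)) \<longlonglongrightarrow> (\<integral>x. ?g x \<partial>lborel)"
    unfolding set_lebesgue_integral_def
  proof (rule integral_dominated_convergence[where w = "\<lambda>x. norm (?g x)"])
    show "AE x in lborel. (\<lambda>n. indicator {- real n..real n} x *\<^sub>R ?g x) \<longlonglongrightarrow> ?g x"
    proof (rule AE_I2)
      fix x :: real
      obtain N :: nat where N: "\<bar>x\<bar> \<le> real N" using real_arch_simple by blast
      have "\<forall>\<^sub>F n in sequentially. indicator {- real n..real n} x *\<^sub>R ?g x = ?g x"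
        using eventually_ge_at_top[of N] by eventually_elim (use N in \<open>auto simp: indicator_def\<close>)
      then show "(\<lambda>n. indicator {- real n..real n} x *\<^sub>R ?g x) \<longlonglongrightarrow> ?g x" by (rule tendsto_eventually)
    qed
    show "AE x in lborel. norm (indicator {- real n..real n} x *\<^sub>R ?g x) \<le> norm (?g x)" for n
      by (rule AE_I2) (auto simp: indicator_def)
  qed (use int in auto)
  moreover have "(\<lambda>n. ?A (real n)) \<longlonglongrightarrow> 0"
  proof (rule Lim_null_comparison)
    show "\<forall>\<^sub>F n in sequentially. norm (?A (real n)) \<le> C * pi * real n powr (1 - \<kappa>)"
      using eventually_ge_at_top[of "nat \<lceil>max 1 L\<rceil>"] by eventually_elim (rule bound, linarith)
    show "(\<lambda>n. C * pi * real n powr (1 - \<kappa>)) \<longlonglongrightarrow> 0"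
      using k by (intro tendsto_mult_right_zero tendsto_neg_powr filterlim_real_sequentially) auto
  qed
  ultimately show ?thesis by (rule LIMSEQ_unique)
qed

text \<open>After division by \<open>norm z powr q\<close>, with
  \<open>t = \<bar>Arg z\<bar>\<close>, the claim reads
  \<open>1 \<le> A * cos t powr q - B * cos (q * t)\<close> for \<open>t < pi / 2\<close>. Up to
  \<open>t0\<close> the first cosine is bounded below; beyond \<open>t0\<close> the second is
  negative and bounded away from 0, since \<open>q < 2\<close> keeps \<open>q * t\<close> in the
  range where the cosine decreases.\<close>

lemma riesz_pointwise_inequality:
  assumes q: "1 < q" "q < (2::real)"
  obtains A B where "0 \<le> A" "0 \<le> B"
    "\<And>z. 0 < Re z \<Longrightarrow> norm z powr q \<le> A * Re z powr q - B * Re (z powr of_real q)"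
proof -
  \<comment> \<open>Chosen so that \<open>q * t0\<close> is the midpoint of \<open>pi / 2\<close>
    and \<open>q * pi / 2\<close>.\<close>
  define t0 where "t0 = pi / 2 * ((1 + q) / (2 * q))"
  have t0: "0 < t0" "t0 < pi / 2" "pi / 2 < q * t0" "q * t0 < pi"
  proof -
    have 1: "0 < (1 + q) / (2 * q)" "(1 + q) / (2 * q) < 1" using q by auto
    show "0 < t0" unfolding t0_def using 1(1) by (intro mult_pos_pos) auto
    show "t0 < pi / 2" unfolding t0_def using mult_strict_left_mono[OF 1(2), of "pi / 2"] by simp
    have 2: "q * t0 = pi / 2 * ((1 + q) / 2)" unfolding t0_def using q by simp
    have 3: "1 < (1 + q) / 2" "(1 + q) / 2 < 2" using q by auto
    show "pi / 2 < q * t0" unfolding 2 using mult_strict_left_mono[OF 3(1), of "pi / 2"] by simp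
    show "q * t0 < pi" unfolding 2 using mult_strict_left_mono[OF 3(2), of "pi / 2"] by simp
  qed
  \<comment> \<open>\<open>B\<close> makes \<open>- B * cos (q * t)\<close> at least 1 beyond
    \<open>t0\<close>; \<open>A\<close> then makes the first term at least \<open>1 + B\<close> up
    to \<open>t0\<close>, enough to absorb \<open>B * cos (q * t)\<close> there.\<close>
  define B where "B = 1 / - cos (q * t0)"
  have cneg: "cos (q * t0) < 0" using t0 by (intro cos_lt_zero_pi) auto
  have B: "0 < B" unfolding B_def using cneg by (simp add: divide_pos_neg)
  have c0: "0 < cos t0" using t0 by (intro cos_gt_zero_pi) auto
  define A where "A = (1 + B) / cos t0 powr q"
  have A: "0 \<le> A" unfolding A_def using B c0 by simp
  show ?thesis
  proof (rule that[of A B])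
    fix z :: complex assume z: "0 < Re z"
    define r where "r = norm z"
    define t where "t = \<bar>Arg z\<bar>"
    have z0: "z \<noteq> 0" using z by auto
    have r: "0 < r" using z0 by (simp add: r_def)
    have t: "0 \<le> t" "t < pi / 2" using Arg_Re_pos[of z] z by (auto simp: t_def)
    have Rez: "Re z = r * cos t"
      unfolding r_def t_def using cos_Arg z0 by (metis cos_abs_real nonzero_mult_div_cancel_left norm_eq_zero times_divide_eq_right)
    have Req: "Re (z powr of_real q) = r powr q * cos (q * t)"
    proof -
      have "z powr of_real q = exp (of_real q * Ln z)" using z0 by (simp add: powr_def)
      then have "Re (z powr of_real q) = exp (q * ln r) * cos (q * Arg z)"
        using z0 by (simp add: Re_exp Arg_eq_Im_Ln r_def)
      also have "cos (q * Arg z) = cos (q * t)" using q unfolding t_def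
        by (metis abs_mult abs_of_pos cos_abs_real less_trans zero_less_one)
      finally show ?thesis using r by (simp add: powr_def mult.commute)
    qed
    have main: "1 \<le> A * cos t powr q - B * cos (q * t)"
    proof (cases "t \<le> t0")
      case True
      have "cos t0 \<le> cos t" using True t t0 by (intro cos_monotone_0_pi_le) auto
      then have "cos t0 powr q \<le> cos t powr q" using c0 q by (intro powr_mono2) auto
      then have "A * cos t0 powr q \<le> A * cos t powr q" using A by (rule mult_left_mono)
      moreover have "A * cos t0 powr q = 1 + B" using c0 by (simp add: A_def)
      moreover have "B * cos (q * t) \<le> B * 1" using B by (intro mult_left_mono) auto
      ultimately show ?thesis by simp
    next
      case False
      have "cos (q * t) \<le> cos (q * t0)"
      proof (rule cos_monotone_0_pi_le)
        have "q * t \<le> 2 * (pi / 2)" using q t by (intro mult_mono) auto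
        then show "q * t \<le> pi" by simp
      qed (use False q t0 in auto)
      then have "B * cos (q * t) \<le> B * cos (q * t0)" using B by (intro mult_left_mono) auto
      also have "\<dots> = -1" using cneg by (simp add: B_def)
      finally have "B * cos (q * t) \<le> -1" .
      moreover have "0 \<le> A * cos t powr q" using A by (intro mult_nonneg_nonneg) auto
      ultimately show ?thesis by linarith
    qed
    have ct: "0 < cos t" using t by (intro cos_gt_zero_pi) auto
    have "r powr q * 1 \<le> r powr q * (A * cos t powr q - B * cos (q * t))"
      using main by (rule mult_left_mono) simp
    also have "\<dots> = A * Re z powr q - B * Re (z powr of_real q)"
      using r ct by (simp add: Rez Req powr_mult algebra_simps)
    finally show "norm z powr q \<le> A * Re z powr q - B * Re (z powr of_real q)" by (simp add: r_def)
  qed (use A B in auto)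
qed

section \<open>The Cauchy integral of a nonnegative density\<close>

text \<open>With this normalization the real part is the Poisson integral of \<open>h\<close> and the imaginary part the
  conjugate Poisson integral.\<close>

definition cauchy_ext :: "(real \<Rightarrow> real) \<Rightarrow> complex \<Rightarrow> complex" where
  "cauchy_ext h z = (\<integral>t. of_real (h t) / (of_real pi * \<i> * (of_real t - z)) \<partial>lborel)"

text \<open>Such densities arise as the positive and negative parts of the components of a function
  cut off to a bounded set. The support radius 4 leaves room around \<open>{-2..2}\<close>, over
  which the maximal functions are integrated.\<close>

locale nonneg_density =
  fixes h :: "real \<Rightarrow> real" and q :: real
  assumes h_meas [measurable]: "h \<in> borel_measurable borel"
    and h_nonneg: "\<And>t. 0 \<le> h t"
    and h_supp: "\<And>t. 4 < \<bar>t\<bar> \<Longrightarrow> h t = 0"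
    and h_int: "integrable lborel h"
    and q: "1 < q" "q < 2"
begin

lemma norm_kernel_le:
  assumes "0 < Im z"
  shows "norm (of_real (h t) / (of_real pi * \<i> * (of_real t - z))) \<le> h t / Im z"
proof -
  have a: "Im z \<le> norm (of_real t - z)"
    using abs_Im_le_cmod[of "of_real t - z"] by simp
  have "1 * Im z \<le> pi * norm (of_real t - z)"
    using a assms pi_gt3 by (intro mult_mono) auto
  then have "h t / (pi * norm (of_real t - z)) \<le> h t / Im z"
    using assms h_nonneg a by (intro divide_left_mono mult_pos_pos) auto
  then show ?thesis using h_nonneg[of t] by (simp add: norm_mult norm_divide)
qed

lemma integrable_kernel:
  assumes "0 < Im z"
  shows "integrable lborel (\<lambda>t. of_real (h t) / (of_real pi * \<i> * (of_real t - z)))"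
proof (rule Bochner_Integration.integrable_bound)
  show "integrable lborel (\<lambda>t. h t / Im z)" using h_int by simp
  show "AE t in lborel. norm (of_real (h t) / (of_real pi * \<i> * (of_real t - z))) \<le> norm (h t / Im z)"
    using norm_kernel_le[OF assms] h_nonneg assms by (intro AE_I2) (auto intro: order_trans)
qed measurable

lemma norm_cauchy_ext_le:
  assumes "0 < Im z"
  shows "norm (cauchy_ext h z) \<le> (\<integral>t. h t \<partial>lborel) / Im z"
proof -
  have "norm (cauchy_ext h z) \<le> (\<integral>t. h t / Im z \<partial>lborel)"
    unfolding cauchy_ext_def
    by (intro Bochner_Integration.integral_norm_bound_integral integrable_kernel assms norm_kernel_le)
      (use h_int in auto)
  then show ?thesis by simp
qed

text \<open>For \<open>\<bar>t\<bar> \<le> 4\<close> and \<open>8 \<le> norm z\<close> the distance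
  from \<open>t\<close> to \<open>z\<close> is at least \<open>norm z / 2\<close>. Decay of order 1
  makes powers with exponent above 1 integrable along lines and negligible on large arcs.\<close>

lemma norm_cauchy_ext_decay:
  assumes "0 < Im z" "8 \<le> norm z"
  shows "norm (cauchy_ext h z) \<le> 2 * (\<integral>t. h t \<partial>lborel) / norm z"
proof -
  have "norm (cauchy_ext h z) \<le> (\<integral>t. h t * (2 / norm z) \<partial>lborel)"
    unfolding cauchy_ext_def
  proof (intro Bochner_Integration.integral_norm_bound_integral integrable_kernel assms)
    fix t
    show "norm (of_real (h t) / (of_real pi * \<i> * (of_real t - z))) \<le> h t * (2 / norm z)"
    proof (cases "\<bar>t\<bar> \<le> 4")
      case True
      have "norm z - \<bar>t\<bar> \<le> norm (of_real t - z)"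
        using norm_triangle_ineq2[of z "of_real t"] by (simp add: norm_minus_commute)
      then have a: "norm z / 2 \<le> norm (of_real t - z)" using assms True by linarith
      have "1 * (norm z / 2) \<le> pi * norm (of_real t - z)"
        using a assms pi_gt3 by (intro mult_mono) auto
      moreover have "0 < norm z" using assms by linarith
      ultimately have "h t / (pi * norm (of_real t - z)) \<le> h t / (norm z / 2)"
        using assms h_nonneg[of t] a by (intro divide_left_mono mult_pos_pos) auto
      then show ?thesis using h_nonneg[of t] by (simp add: norm_mult norm_divide)
      qed (use h_supp in auto)
  qed (use h_int in auto)
  then show ?thesis by (simp add: mult.commute)
qed

text \<open>The difference quotient minus the candidate derivative has the kernel
  \<open>h t * (w - z) / (pi * \<i> * (t - w) * (t - z)^2)\<close>. It is of order
  \<open>norm (w - z)\<close> uniformly in \<open>t\<close> as long as \<open>w\<close> stays within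
  half the height of \<open>z\<close>, which keeps \<open>w\<close> away from the real line.\<close>

lemma cauchy_ext_deriv:
  assumes z: "0 < Im z"
  shows "(cauchy_ext h has_field_derivative
    (\<integral>t. of_real (h t) / (of_real pi * \<i> * (of_real t - z)\<^sup>2) \<partial>lborel)) (at z)"
proof -
  define d where "d = Im z"
  have d: "0 < d" using z by (simp add: d_def)
  define D where "D = (\<integral>t. of_real (h t) / (of_real pi * \<i> * (of_real t - z)\<^sup>2) \<partial>lborel)"
  have zt: "d \<le> norm (of_real t - z)" for t
    using abs_Im_le_cmod[of "of_real t - z"] by (simp add: d_def)
  have intD: "integrable lborel (\<lambda>t. of_real (h t) / (of_real pi * \<i> * (of_real t - z)\<^sup>2))"
  proof (rule Bochner_Integration.integrable_bound)
    show "integrable lborel (\<lambda>t. h t / d\<^sup>2)" using h_int by simp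
    show "AE t in lborel. norm (of_real (h t) / (of_real pi * \<i> * (of_real t - z)\<^sup>2)) \<le> norm (h t / d\<^sup>2)"
    proof (rule AE_I2)
      fix t
      have "1 * d\<^sup>2 \<le> pi * (norm (of_real t - z))\<^sup>2"
        using zt d pi_gt3 by (intro mult_mono power_mono) auto
      then have "h t / (pi * (norm (of_real t - z))\<^sup>2) \<le> h t / d\<^sup>2"
        using d h_nonneg[of t] zt[of t] by (intro divide_left_mono mult_pos_pos) auto
      then show "norm (of_real (h t) / (of_real pi * \<i> * (of_real t - z)\<^sup>2)) \<le> norm (h t / d\<^sup>2)"
        using h_nonneg[of t] by (simp add: norm_mult norm_divide norm_power)
    qed
  qed measurable
  define K where "K = 2 * (\<integral>t. h t \<partial>lborel) / d ^ 3"
  have "\<forall>\<^sub>F w in at z. dist w z < d / 2 \<and> w \<noteq> z"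
    using eventually_at_ball'[of "d / 2" z UNIV] d by (simp add: dist_commute)
  then have ev: "\<forall>\<^sub>F w in at z. norm ((cauchy_ext h w - cauchy_ext h z) / (w - z) - D) \<le> norm (w - z) * K"
  proof eventually_elim
    case (elim w)
    have "\<bar>Im (w - z)\<bar> < d / 2" using elim abs_Im_le_cmod[of "w - z"] by (simp add: dist_norm)
    then have Imw: "d / 2 < Im w" by (simp add: d_def abs_if split: if_splits)
    then have w: "0 < Im w" using d by linarith
    have wt: "d / 2 \<le> norm (of_real t - w)" for t
      using abs_Im_le_cmod[of "of_real t - w"] Imw by simp
    have ne: "of_real t \<noteq> z" "of_real t \<noteq> w" for t using z w by auto
    let ?k = "\<lambda>t. (of_real (h t) / (of_real pi * \<i> * (of_real t - w)) - of_real (h t) / (of_real pi * \<i> * (of_real t - z))) / (w - z)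
        - of_real (h t) / (of_real pi * \<i> * (of_real t - z)\<^sup>2)"
    have eq: "(cauchy_ext h w - cauchy_ext h z) / (w - z) - D = (\<integral>t. ?k t \<partial>lborel)"
      unfolding cauchy_ext_def D_def using integrable_kernel[OF z] integrable_kernel[OF w] intD by simp
    have "norm (\<integral>t. ?k t \<partial>lborel) \<le> (\<integral>t. h t * (norm (w - z) * 2 / d ^ 3) \<partial>lborel)"
    proof (rule Bochner_Integration.integral_norm_bound_integral)
      fix t
      have "?k t = of_real (h t) * (w - z) / (of_real pi * \<i> * ((of_real t - w) * (of_real t - z)\<^sup>2))"
        using ne[of t] elim pi_gt_zero by (simp add: divide_simps power2_eq_square) (simp add: algebra_simps)
      then have n: "norm (?k t) = h t * norm (w - z) / (pi * (norm (of_real t - w) * (norm (of_real t - z))\<^sup>2))"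
        using h_nonneg[of t] by (simp add: norm_mult norm_divide norm_power)
      have "1 * (d / 2 * d\<^sup>2) \<le> pi * (norm (of_real t - w) * (norm (of_real t - z))\<^sup>2)"
        using wt zt d pi_gt3 by (intro mult_mono power_mono) auto
      then have "norm (?k t) \<le> h t * norm (w - z) / (d / 2 * d\<^sup>2)"
        unfolding n using ne d h_nonneg[of t] by (intro divide_left_mono mult_pos_pos) auto
      also have "\<dots> = h t * (norm (w - z) * 2 / d ^ 3)" by (simp add: power3_eq_cube power2_eq_square)
      finally show "norm (?k t) \<le> \<dots>" .
    next
      show "integrable lborel ?k"
        by (rule Bochner_Integration.integrable_diff[OF integrable_divide_zero[OF Bochner_Integration.integrable_diff[OF integrable_kernel[OF w] integrable_kernel[OF z]]] intD])
      show "integrable lborel (\<lambda>t. h t * (norm (w - z) * 2 / d ^ 3))"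
        by (rule integrable_mult_left[OF h_int])
    qed
    also have "\<dots> = norm (w - z) * K" by (simp add: K_def)
    finally show ?case unfolding eq .
  qed
  have "((\<lambda>w. norm (w - z) * K) \<longlongrightarrow> norm (z - z) * K) (at z)" by (intro tendsto_intros)
  then have "((\<lambda>w. (cauchy_ext h w - cauchy_ext h z) / (w - z) - D) \<longlongrightarrow> 0) (at z)"
    by (intro Lim_null_comparison[OF ev]) simp
  then show ?thesis unfolding has_field_derivative_iff D_def using LIM_zero_iff by blast
qed

lemma cauchy_ext_holomorphic: "cauchy_ext h holomorphic_on {z. 0 < Im z}"
  unfolding holomorphic_on_def field_differentiable_def
  using cauchy_ext_deriv has_field_derivative_at_within by blast

lemma cauchy_ext_line_continuous:
  assumes "0 < y"
  shows "continuous_on UNIV (\<lambda>x. cauchy_ext h (Complex x y))"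
proof -
  have "continuous_on UNIV (\<lambda>x. Complex x y)"
    unfolding Complex_eq by (intro continuous_intros)
  then show ?thesis
    using assms by (intro continuous_on_compose2[OF holomorphic_on_imp_continuous_on[OF cauchy_ext_holomorphic]]) auto
qed

lemma cauchy_ext_line_measurable [measurable]:
  "0 < y \<Longrightarrow> (\<lambda>x. cauchy_ext h (Complex x y)) \<in> borel_measurable borel"
  by (rule borel_measurable_continuous_onI) (rule cauchy_ext_line_continuous)

lemma kernel_components:
  "Re (of_real (h t) / (of_real pi * \<i> * (of_real t - Complex x y))) = h t * y / (pi * ((x - t)\<^sup>2 + y\<^sup>2))"
  "Im (of_real (h t) / (of_real pi * \<i> * (of_real t - Complex x y))) = h t * (x - t) / (pi * ((x - t)\<^sup>2 + y\<^sup>2))"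
proof -
  have eq: "complex_of_real pi * \<i> * (of_real t - Complex x y) = Complex (pi * y) (pi * (t - x))"
    by (simp add: complex_eq_iff)
  have s: "(pi * y)\<^sup>2 + (pi * (t - x))\<^sup>2 = pi * (pi * ((x - t)\<^sup>2 + y\<^sup>2))"
    by (simp add: power2_eq_square algebra_simps)
  show "Re (of_real (h t) / (of_real pi * \<i> * (of_real t - Complex x y))) = h t * y / (pi * ((x - t)\<^sup>2 + y\<^sup>2))"
  proof -
    have "Re (of_real (h t) / Complex (pi * y) (pi * (t - x))) = h t * (pi * y) / (pi * (pi * ((x - t)\<^sup>2 + y\<^sup>2)))"
      unfolding Re_divide s complex.sel by simp
    also have "h t * (pi * y) = pi * (h t * y)" by (rule mult.left_commute)
    finally show ?thesis unfolding eq by simp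
  qed
  have "Im (of_real (h t) / Complex (pi * y) (pi * (t - x))) = (- (h t * (pi * (t - x)))) / (pi * (pi * ((x - t)\<^sup>2 + y\<^sup>2)))"
    unfolding Im_divide s complex.sel by simp
  also have "- (h t * (pi * (t - x))) = pi * (h t * (x - t))" by (simp add: algebra_simps)
  finally show "Im (of_real (h t) / (of_real pi * \<i> * (of_real t - Complex x y))) = h t * (x - t) / (pi * ((x - t)\<^sup>2 + y\<^sup>2))"
    unfolding eq by simp
qed

lemma cauchy_ext_components:
  assumes "0 < y"
  shows "Re (cauchy_ext h (Complex x y)) = (\<integral>t. h t * y / (pi * ((x - t)\<^sup>2 + y\<^sup>2)) \<partial>lborel)"
    and "Im (cauchy_ext h (Complex x y)) = (\<integral>t. h t * (x - t) / (pi * ((x - t)\<^sup>2 + y\<^sup>2)) \<partial>lborel)"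
    and "integrable lborel (\<lambda>t. h t * y / (pi * ((x - t)\<^sup>2 + y\<^sup>2)))"
    and "integrable lborel (\<lambda>t. h t * (x - t) / (pi * ((x - t)\<^sup>2 + y\<^sup>2)))"
proof -
  have i: "integrable lborel (\<lambda>t. of_real (h t) / (of_real pi * \<i> * (of_real t - Complex x y)))"
    using assms by (intro integrable_kernel) simp
  show "Re (cauchy_ext h (Complex x y)) = (\<integral>t. h t * y / (pi * ((x - t)\<^sup>2 + y\<^sup>2)) \<partial>lborel)"
    unfolding cauchy_ext_def using integral_Re[OF i] by (simp only: kernel_components)
  show "Im (cauchy_ext h (Complex x y)) = (\<integral>t. h t * (x - t) / (pi * ((x - t)\<^sup>2 + y\<^sup>2)) \<partial>lborel)"
    unfolding cauchy_ext_def using integral_Im[OF i] by (simp only: kernel_components)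
  show "integrable lborel (\<lambda>t. h t * y / (pi * ((x - t)\<^sup>2 + y\<^sup>2)))"
    using integrable_Re[OF i] by (simp only: kernel_components)
  show "integrable lborel (\<lambda>t. h t * (x - t) / (pi * ((x - t)\<^sup>2 + y\<^sup>2)))"
    using integrable_Im[OF i] by (simp only: kernel_components)
qed

text \<open>The truncated kernel differs from the conjugate Poisson kernel at height \<open>e\<close> by at most the
  Poisson kernel at the same height.\<close>

lemma truncated_le_cauchy_ext:
  assumes e: "0 < e"
  shows "integrable lborel (\<lambda>t. indicator {t. e < \<bar>x - t\<bar>} t * (h t / (x - t)))"
    and "\<bar>1 / pi * (\<integral>t. indicator {t. e < \<bar>x - t\<bar>} t * (h t / (x - t)) \<partial>lborel)\<bar> \<le> 2 * norm (cauchy_ext h (Complex x e))"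
proof -
  let ?T = "\<lambda>t. indicator {t. e < \<bar>x - t\<bar>} t * (h t / (x - t))"
  show i: "integrable lborel ?T"
  proof (rule Bochner_Integration.integrable_bound)
    show "integrable lborel (\<lambda>t. h t / e)" using h_int by simp
    show "AE t in lborel. norm (?T t) \<le> norm (h t / e)"
      using e h_nonneg by (intro AE_I2) (auto simp: indicator_def intro!: frac_le)
  qed measurable
  let ?Q = "\<lambda>t. h t * (x - t) / (pi * ((x - t)\<^sup>2 + e\<^sup>2))"
  let ?P = "\<lambda>t. h t * e / (pi * ((x - t)\<^sup>2 + e\<^sup>2))"
  note c = cauchy_ext_components[OF e, of x]
  have "\<bar>1 / pi * (\<integral>t. ?T t \<partial>lborel) - (\<integral>t. ?Q t \<partial>lborel)\<bar> = norm (\<integral>t. 1 / pi * ?T t - ?Q t \<partial>lborel)"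
    by (simp only: Bochner_Integration.integral_diff[OF integrable_mult_right[OF i] c(4)] integral_mult_right_zero real_norm_def)
  also have "\<dots> \<le> (\<integral>t. ?P t \<partial>lborel)"
  proof (rule Bochner_Integration.integral_norm_bound_integral)
    fix t
    define s where "s = x - t"
    have pos: "0 < s\<^sup>2 + e\<^sup>2" using e by (simp add: add_nonneg_pos)
    \<comment> \<open>Where the truncated kernel is present the difference is
      \<open>e^2 / (s * (s^2 + e^2))\<close>, and where it is cut off the difference is
      \<open>- s / (s^2 + e^2)\<close>; comparing \<open>\<bar>s\<bar>\<close> with \<open>e\<close>
      bounds both by the Poisson kernel.\<close>
    have key: "\<bar>indicator {t. e < \<bar>x - t\<bar>} t / s - s / (s\<^sup>2 + e\<^sup>2)\<bar> \<le> e / (s\<^sup>2 + e\<^sup>2)"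
    proof (cases "e < \<bar>s\<bar>")
      case True
      then have s0: "s \<noteq> 0" using e by auto
      have "1 / s - s / (s\<^sup>2 + e\<^sup>2) = e / s * (e / (s\<^sup>2 + e\<^sup>2))"
        using s0 pos by (simp add: divide_simps) (simp add: power2_eq_square algebra_simps)
      moreover have "\<bar>e / s * (e / (s\<^sup>2 + e\<^sup>2))\<bar> \<le> 1 * (e / (s\<^sup>2 + e\<^sup>2))"
        unfolding abs_mult using True e pos by (intro mult_mono) auto
      ultimately show ?thesis using True by (simp add: s_def)
    next
      case False
      then have "\<bar>s\<bar> / (s\<^sup>2 + e\<^sup>2) \<le> e / (s\<^sup>2 + e\<^sup>2)" using pos by (intro divide_right_mono) auto
      then show ?thesis using False pos by (simp add: s_def[symmetric])
    qed
    have "1 / pi * ?T t - ?Q t = h t / pi * (indicator {t. e < \<bar>x - t\<bar>} t / s - s / (s\<^sup>2 + e\<^sup>2))"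
      by (simp add: s_def algebra_simps)
    then have "norm (1 / pi * ?T t - ?Q t) = h t / pi * \<bar>indicator {t. e < \<bar>x - t\<bar>} t / s - s / (s\<^sup>2 + e\<^sup>2)\<bar>"
      using h_nonneg[of t] by (simp add: abs_mult)
    also have "\<dots> \<le> h t / pi * (e / (s\<^sup>2 + e\<^sup>2))" using key h_nonneg[of t] by (intro mult_left_mono) auto
    also have "\<dots> = ?P t" by (simp add: s_def)
    finally show "norm (1 / pi * ?T t - ?Q t) \<le> ?P t" .
  qed (rule Bochner_Integration.integrable_diff[OF integrable_mult_right[OF i] c(4)], rule c(3))
  finally have "\<bar>1 / pi * (\<integral>t. ?T t \<partial>lborel) - Im (cauchy_ext h (Complex x e))\<bar> \<le> Re (cauchy_ext h (Complex x e))"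
    using c by simp
  then show "\<bar>1 / pi * (\<integral>t. ?T t \<partial>lborel)\<bar> \<le> 2 * norm (cauchy_ext h (Complex x e))"
    using abs_Im_le_cmod[of "cauchy_ext h (Complex x e)"] abs_Re_le_cmod[of "cauchy_ext h (Complex x e)"] by linarith
qed

end

section \<open>Integrability and Poisson representation on horizontal lines\<close>

lemma nn_integral_powr_tail_finite:
  assumes "0 < (a::real)" "e < -1"
  shows "(\<integral>\<^sup>+u. ennreal (\<bar>u\<bar> powr e * indicator {a..} \<bar>u\<bar>) \<partial>lborel) < \<infinity>"
proof -
  have "(\<integral>\<^sup>+u. ennreal (u powr e) * indicator {a..} u \<partial>lborel) = ennreal (- (a powr (e + 1)) / (e + 1))"
    by (rule nn_integral_has_integral_lebesgue'[OF _ has_integral_powr_to_inf]) (use assms in auto)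
  moreover have "(\<integral>\<^sup>+u. ennreal (\<bar>u\<bar> powr e * indicator {a..} \<bar>u\<bar>) \<partial>lborel) =
      2 * (\<integral>\<^sup>+u. ennreal (u powr e * indicator {a..} u) * indicator {0..} u \<partial>lborel)"
    by (rule nn_integral_even) measurable
  moreover have "(\<integral>\<^sup>+u. ennreal (u powr e * indicator {a..} u) * indicator {0..} u \<partial>lborel) =
      (\<integral>\<^sup>+u. ennreal (u powr e) * indicator {a..} u \<partial>lborel)"
    using assms by (intro nn_integral_cong) (auto simp: indicator_def)
  ultimately show ?thesis by (simp add: ennreal_mult_less_top)
qed

lemma nn_integral_powr_head_finite:
  assumes "0 \<le> (a::real)" "-1 < e"
  shows "(\<integral>\<^sup>+u. ennreal (\<bar>u\<bar> powr e * indicator {..a} \<bar>u\<bar>) \<partial>lborel) < \<infinity>"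
proof -
  have "(\<integral>\<^sup>+u. ennreal (u powr e) * indicator {0..a} u \<partial>lborel) = ennreal (a powr (e + 1) / (e + 1))"
    by (rule nn_integral_has_integral_lebesgue'[OF _ has_integral_powr_from_0]) (use assms in auto)
  moreover have "(\<integral>\<^sup>+u. ennreal (\<bar>u\<bar> powr e * indicator {..a} \<bar>u\<bar>) \<partial>lborel) =
      2 * (\<integral>\<^sup>+u. ennreal (u powr e * indicator {..a} u) * indicator {0..} u \<partial>lborel)"
    by (rule nn_integral_even) measurable
  moreover have "(\<integral>\<^sup>+u. ennreal (u powr e * indicator {..a} u) * indicator {0..} u \<partial>lborel) =
      (\<integral>\<^sup>+u. ennreal (u powr e) * indicator {0..a} u \<partial>lborel)"
    using assms by (intro nn_integral_cong) (auto simp: indicator_def)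
  ultimately show ?thesis by (simp add: ennreal_mult_less_top)
qed

context nonneg_density
begin

text \<open>A qualitative statement, with a bound that degenerates as \<open>y\<close> tends to 0:
  finiteness is what allows the integral of Riesz's inequality to be split. The integrand is bounded
  for \<open>\<bar>x\<bar> \<le> 8\<close> and decays like \<open>\<bar>x\<bar> powr - q\<close>
  beyond.\<close>

lemma integrable_cauchy_ext_powr:
  assumes y: "0 < y"
  shows "integrable lborel (\<lambda>x. norm (cauchy_ext h (Complex x y)) powr q)"
proof -
  define H where "H = (\<integral>t. h t \<partial>lborel)"
  have H: "0 \<le> H" unfolding H_def using h_nonneg by simp
  have [measurable]: "(\<lambda>x. cauchy_ext h (Complex x y)) \<in> borel_measurable borel"
    using y by (rule cauchy_ext_line_measurable)
  let ?b = "\<lambda>x. ennreal ((H / y) powr q) * indicator {-8..8} x + ennreal ((2 * H) powr q) * ennreal (\<bar>x\<bar> powr - q * indicator {8..} \<bar>x\<bar>)"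
  have "(\<integral>\<^sup>+x. ennreal (norm (cauchy_ext h (Complex x y)) powr q) \<partial>lborel) \<le> (\<integral>\<^sup>+x. ?b x \<partial>lborel)"
  proof (rule nn_integral_mono)
    fix x :: real
    let ?F = "norm (cauchy_ext h (Complex x y))"
    show "ennreal (?F powr q) \<le> ?b x"
    proof (cases "\<bar>x\<bar> \<le> 8")
      case True
      have "?F \<le> H / y" unfolding H_def using norm_cauchy_ext_le[of "Complex x y"] y by simp
      then have "?F powr q \<le> (H / y) powr q" using q by (intro powr_mono2) auto
      then have "ennreal (?F powr q) \<le> ennreal ((H / y) powr q) * indicator {-8..8} x"
        using True by (auto simp: indicator_def intro: ennreal_leI)
      then show ?thesis by (rule add_increasing2[rotated]) simp
    next
      case False
      have nx: "\<bar>x\<bar> \<le> norm (Complex x y)" using abs_Re_le_cmod[of "Complex x y"] by simp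
      have "?F \<le> 2 * H / norm (Complex x y)"
        unfolding H_def using y False nx by (intro norm_cauchy_ext_decay) auto
      also have "\<dots> \<le> 2 * H / \<bar>x\<bar>" using nx False H y by (intro divide_left_mono mult_pos_pos) auto
      finally have "?F powr q \<le> (2 * H / \<bar>x\<bar>) powr q" using q by (intro powr_mono2) auto
      also have "\<dots> = (2 * H) powr q * \<bar>x\<bar> powr - q" using H False by (subst powr_divide) (auto simp: powr_minus divide_inverse)
      finally have "ennreal (?F powr q) \<le> ennreal ((2 * H) powr q) * ennreal (\<bar>x\<bar> powr - q * indicator {8..} \<bar>x\<bar>)"
        using False by (simp add: ennreal_mult'[symmetric] ennreal_leI)
      then show ?thesis by (rule add_increasing[rotated]) simp
    qed
  qed
  also have "\<dots> = ennreal ((H / y) powr q) * 16 + ennreal ((2 * H) powr q) * (\<integral>\<^sup>+x. ennreal (\<bar>x\<bar> powr - q * indicator {8..} \<bar>x\<bar>) \<partial>lborel)"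
    by (simp add: nn_integral_add nn_integral_cmult nn_integral_cmult_indicator)
  also have "\<dots> < \<infinity>"
    using nn_integral_powr_tail_finite[of 8 "- q"] q by (simp add: ennreal_mult_less_top ennreal_add_less_top)
  finally show ?thesis by (intro integrableI_nonneg) auto
qed

text \<open>Strict positivity keeps the values in the right half plane, where the principal branch
  of the power is holomorphic and Riesz's inequality applies. If the Poisson integral vanished at
  one point, its positive kernel would force \<open>h\<close> to vanish almost everywhere.\<close>

lemma Re_cauchy_ext_pos:
  assumes "0 < Im z" and pos: "0 < (\<integral>t. h t \<partial>lborel)"
  shows "0 < Re (cauchy_ext h z)"
proof -
  obtain x y where z: "z = Complex x y" by (cases z)
  have y: "0 < y" using assms z by simp
  let ?w = "\<lambda>t. h t * y / (pi * ((x - t)\<^sup>2 + y\<^sup>2))"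
  have sq: "0 < (x - t)\<^sup>2 + y\<^sup>2" for t using y by (simp add: add_nonneg_pos)
  have w0: "0 \<le> ?w t" for t using h_nonneg[of t] y by simp
  note c = cauchy_ext_components[OF y, of x]
  have "(\<integral>t. ?w t \<partial>lborel) \<noteq> 0"
  proof
    assume "(\<integral>t. ?w t \<partial>lborel) = 0"
    then have "AE t in lborel. ?w t = 0" using integral_nonneg_eq_0_iff_AE[OF c(3)] w0 by simp
    then have "AE t in lborel. h t = 0"
    proof eventually_elim
      case (elim t)
      then show ?case using sq[of t] y pi_gt_zero by auto
    qed
    then have "(\<integral>t. h t \<partial>lborel) = 0" by (simp add: integral_eq_zero_AE)
    then show False using pos by simp
  qed
  moreover have "0 \<le> (\<integral>t. ?w t \<partial>lborel)" using w0 by simp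
  ultimately show ?thesis unfolding z c(1) by linarith
qed

text \<open>For fixed \<open>x\<close> the Poisson kernel is a probability density in
  \<open>t\<close>, so Jensen's inequality moves the power inside; by Tonelli and the symmetry of
  the kernel it integrates to 1 in \<open>x\<close> as well.\<close>

lemma nn_integral_Re_cauchy_ext_powr:
  assumes y: "0 < y"
  shows "(\<integral>\<^sup>+x. ennreal (Re (cauchy_ext h (Complex x y)) powr q) \<partial>lborel) \<le> (\<integral>\<^sup>+t. ennreal (h t powr q) \<partial>lborel)"
proof -
  let ?w = "\<lambda>x t. y / (pi * ((x - t)\<^sup>2 + y\<^sup>2))"
  have w0: "0 \<le> ?w x t" for x t using y by simp
  have w1: "(\<integral>\<^sup>+t. ennreal (?w x t) \<partial>lborel) = 1" for x
  proof -
    have "(\<integral>\<^sup>+t. ennreal (?w x t) \<partial>lborel) = (\<integral>\<^sup>+t. ennreal (1 / pi) * ennreal (y / ((x - t)\<^sup>2 + y\<^sup>2)) \<partial>lborel)"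
      using y by (intro nn_integral_cong) (simp add: ennreal_mult'[symmetric])
    also have "\<dots> = ennreal (1 / pi) * ennreal pi"
      by (subst nn_integral_cmult) (auto simp: nn_integral_poisson_kernel y)
    also have "\<dots> = 1" by (simp add: ennreal_mult'[symmetric])
    finally show ?thesis .
  qed
  have "(\<integral>\<^sup>+x. ennreal (Re (cauchy_ext h (Complex x y)) powr q) \<partial>lborel)
      \<le> (\<integral>\<^sup>+x. \<integral>\<^sup>+t. ennreal (h t powr q * ?w x t) \<partial>lborel \<partial>lborel)"
  proof (rule nn_integral_mono)
    fix x :: real
    show "ennreal (Re (cauchy_ext h (Complex x y)) powr q) \<le> (\<integral>\<^sup>+t. ennreal (h t powr q * ?w x t) \<partial>lborel)"
    proof (cases "\<integral>\<^sup>+t. ennreal (h t powr q * ?w x t) \<partial>lborel")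
      case (real K)
      obtain I where I: "0 \<le> I" "(\<integral>\<^sup>+t. ennreal (h t * ?w x t) \<partial>lborel) = ennreal I" "I powr q \<le> 1 powr (q - 1) * K"
        by (rule nn_integral_jensen_powr[where u = h and w = "?w x" and M = lborel and p = q and W = 1 and K = K])
          (use q real h_nonneg w0 w1 in auto)
      have "Re (cauchy_ext h (Complex x y)) = (\<integral>t. h t * ?w x t \<partial>lborel)"
        unfolding cauchy_ext_components(1)[OF y] by simp
      also have "\<dots> = enn2real (\<integral>\<^sup>+t. ennreal (h t * ?w x t) \<partial>lborel)"
        by (intro integral_eq_nn_integral AE_I2 mult_nonneg_nonneg h_nonneg w0) measurable
      also have "\<dots> = I" using I by simp
      finally have "Re (cauchy_ext h (Complex x y)) = I" .
      then show ?thesis using I real by (simp add: ennreal_leI)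
    qed simp
  qed
  also have "\<dots> = (\<integral>\<^sup>+t. \<integral>\<^sup>+x. ennreal (h t powr q * ?w x t) \<partial>lborel \<partial>lborel)"
    by (rule lborel_pair.Fubini'[symmetric]) measurable
  also have "\<dots> = (\<integral>\<^sup>+t. ennreal (h t powr q) * (\<integral>\<^sup>+x. ennreal (?w t x) \<partial>lborel) \<partial>lborel)"
  proof (intro nn_integral_cong)
    fix t
    show "(\<integral>\<^sup>+x. ennreal (h t powr q * ?w x t) \<partial>lborel) = ennreal (h t powr q) * (\<integral>\<^sup>+x. ennreal (?w t x) \<partial>lborel)"
      by (subst nn_integral_cmult[symmetric]) (auto simp: ennreal_mult'[symmetric] power2_commute)
  qed
  also have "\<dots> = (\<integral>\<^sup>+t. ennreal (h t powr q) \<partial>lborel)" by (simp add: w1)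
  finally show ?thesis .
qed

text \<open>The function \<open>\<Phi>\<close> is the difference quotient of \<open>F\<close> at \<open>z1\<close> divided by \<open>z - z2\<close>, where \<open>z2\<close> is the
  reflection of \<open>z1\<close> in the line of height \<open>y0\<close>; on that line \<open>(z - z1) * (z - z2)\<close> is the real
  denominator of the Poisson kernel.\<close>

lemma cauchy_ext_poisson:
  assumes y0: "0 < y0" and y: "0 < y"
  shows "ennreal (pi * norm (cauchy_ext h (Complex x (y + y0))))
    \<le> (\<integral>\<^sup>+u. ennreal (norm (cauchy_ext h (Complex u y0))) * ennreal (y / ((x - u)\<^sup>2 + y\<^sup>2)) \<partial>lborel)"
proof -
  let ?F = "cauchy_ext h"
  define H where "H = (\<integral>t. h t \<partial>lborel)"
  have H: "0 \<le> H" unfolding H_def using h_nonneg by simp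
  define z1 where "z1 = Complex x (y + y0)"
  define z2 where "z2 = Complex x (y0 - y)"
  define G where "G = (\<lambda>z. if z = z1 then deriv ?F z1 else (?F z - ?F z1) / (z - z1))"
  define \<Phi> where "\<Phi> = (\<lambda>z. G z / (z - z2))"
  \<comment> \<open>The half plane above height \<open>b\<close> contains the line of height
    \<open>y0\<close>, but neither \<open>z2\<close> nor points outside the domain of the Cauchy
    integral.\<close>
  define b where "b = max 0 (y0 - y)"
  have b: "b < y0" "0 \<le> b" "y0 - y \<le> b" using y y0 by (auto simp: b_def)
  have [measurable]: "(\<lambda>x. ?F (Complex x y0)) \<in> borel_measurable borel"
    using y0 by (rule cauchy_ext_line_measurable)
  have Gh: "G holomorphic_on {z. 0 < Im z}"
    unfolding G_def by (rule pole_lemma_open[OF cauchy_ext_holomorphic]) (simp add: open_halfspace_Im_gt)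
  have \<Phi>h: "\<Phi> holomorphic_on {z. b < Im z}"
    unfolding \<Phi>_def
  proof (intro holomorphic_on_divide holomorphic_intros)
    show "G holomorphic_on {z. b < Im z}" by (rule holomorphic_on_subset[OF Gh]) (use b in auto)
    show "z - z2 \<noteq> 0" if "z \<in> {z. b < Im z}" for z using that b by (auto simp: z2_def)
  qed
  have Fb: "norm (?F z) \<le> H / y0" if "y0 \<le> Im z" for z
  proof -
    have "norm (?F z) \<le> H / Im z" unfolding H_def using that y0 by (intro norm_cauchy_ext_le) auto
    also have "\<dots> \<le> H / y0" using that y0 H by (intro divide_left_mono) auto
    finally show ?thesis .
  qed
  have Fdiff: "norm (?F z - ?F z1) \<le> 2 * H / y0" if "y0 \<le> Im z" for z
    using norm_triangle_ineq4[of "?F z" "?F z1"] Fb[OF that] Fb[of z1] y by (simp add: z1_def)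
  have line: "\<Phi> (Complex u y0) = (?F (Complex u y0) - ?F z1) / of_real ((x - u)\<^sup>2 + y\<^sup>2)" for u
  proof -
    have "Complex u y0 \<noteq> z1" using y by (simp add: z1_def)
    moreover have "(Complex u y0 - z1) * (Complex u y0 - z2) = of_real ((x - u)\<^sup>2 + y\<^sup>2)"
      by (simp add: z1_def z2_def complex_eq_iff power2_eq_square algebra_simps)
    ultimately show ?thesis by (simp add: \<Phi>_def G_def)
  qed
  have pk: "integrable lborel (\<lambda>u. y / ((x - u)\<^sup>2 + y\<^sup>2))"
    using y nn_integral_poisson_kernel[OF y, of x] by (intro integrableI_nonneg) auto
  have pki: "(\<integral>u. y / ((x - u)\<^sup>2 + y\<^sup>2) \<partial>lborel) = pi"
    using y nn_integral_poisson_kernel[OF y, of x] by (subst integral_eq_nn_integral) auto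
  have i1: "integrable lborel (\<lambda>u. ?F (Complex u y0) * of_real (y / ((x - u)\<^sup>2 + y\<^sup>2)))"
  proof (rule Bochner_Integration.integrable_bound)
    show "integrable lborel (\<lambda>u. H / y0 * (y / ((x - u)\<^sup>2 + y\<^sup>2)))" using pk by (rule integrable_mult_right)
    show "AE u in lborel. norm (?F (Complex u y0) * of_real (y / ((x - u)\<^sup>2 + y\<^sup>2))) \<le> norm (H / y0 * (y / ((x - u)\<^sup>2 + y\<^sup>2)))"
    proof (rule AE_I2)
      fix u
      have "norm (?F (Complex u y0)) * (y / ((x - u)\<^sup>2 + y\<^sup>2)) \<le> H / y0 * (y / ((x - u)\<^sup>2 + y\<^sup>2))"
        using Fb[of "Complex u y0"] y by (intro mult_right_mono) auto
      then show "norm (?F (Complex u y0) * of_real (y / ((x - u)\<^sup>2 + y\<^sup>2))) \<le> norm (H / y0 * (y / ((x - u)\<^sup>2 + y\<^sup>2)))"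
        unfolding norm_mult norm_of_real using y H y0 by simp
    qed
  qed measurable
  have i2: "integrable lborel (\<lambda>u. ?F z1 * of_real (y / ((x - u)\<^sup>2 + y\<^sup>2)))"
    by (intro integrable_mult_right integrable_of_real pk)
  have \<Phi>y: "of_real y * \<Phi> (Complex u y0) = ?F (Complex u y0) * of_real (y / ((x - u)\<^sup>2 + y\<^sup>2)) - ?F z1 * of_real (y / ((x - u)\<^sup>2 + y\<^sup>2))" for u
    unfolding line by (simp add: diff_divide_distrib algebra_simps)
  have i3: "integrable lborel (\<lambda>u. of_real y * \<Phi> (Complex u y0))"
    unfolding \<Phi>y using i1 i2 by (rule Bochner_Integration.integrable_diff)
  have i4: "integrable lborel (\<lambda>u. \<Phi> (Complex u y0))"
    using integrable_mult_right[OF i3, of "of_real (1 / y)"] y by simp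
  have zero: "(\<integral>u. \<Phi> (Complex u y0) \<partial>lborel) = 0"
  \<comment> \<open>Two linear denominators under a bounded numerator give decay of order 2. Beyond
    \<open>L\<close> the distances to \<open>z1\<close> and \<open>z2\<close> are at least
    \<open>norm z / 2\<close>, so the constant is four times the bound \<open>2 * H / y0\<close> of
    the numerator.\<close>
  proof (rule horizontal_line_integral_zero[OF \<Phi>h b(1) y0, where \<kappa> = 2 and C = "8 * H / y0" and L = "2 * norm z1 + 2 * norm z2 + 1"])
    fix z assume z: "y0 \<le> Im z" "2 * norm z1 + 2 * norm z2 + 1 \<le> norm z"
    have z0: "0 < norm z" using z norm_ge_zero[of z1] norm_ge_zero[of z2] by linarith
    have a: "norm z / 2 \<le> norm (z - z1)" using norm_triangle_ineq2[of z z1] z norm_ge_zero[of z2] by linarith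
    have c: "norm z / 2 \<le> norm (z - z2)" using norm_triangle_ineq2[of z z2] z norm_ge_zero[of z1] by linarith
    have ne: "z \<noteq> z1" using a z0 by auto
    have "norm (\<Phi> z) = norm (?F z - ?F z1) / (norm (z - z1) * norm (z - z2))"
      using ne by (simp add: \<Phi>_def G_def norm_divide norm_mult)
    also have "\<dots> \<le> (2 * H / y0) / (norm z / 2 * (norm z / 2))"
      using a c z0 H y0 Fdiff[OF z(1)] by (intro frac_le mult_mono) auto
    also have "\<dots> = 8 * H / y0 * norm z powr - 2"
      using z0 by (simp add: powr_minus power2_eq_square field_simps)
    finally show "norm (\<Phi> z) \<le> 8 * H / y0 * norm z powr - 2" .
  qed (use H y0 i4 in auto)
  have "(\<integral>u. of_real y * \<Phi> (Complex u y0) \<partial>lborel) = 0" using zero by simp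
  then have "(\<integral>u. ?F (Complex u y0) * of_real (y / ((x - u)\<^sup>2 + y\<^sup>2)) \<partial>lborel) = (\<integral>u. ?F z1 * of_real (y / ((x - u)\<^sup>2 + y\<^sup>2)) \<partial>lborel)"
    unfolding \<Phi>y using Bochner_Integration.integral_diff[OF i1 i2] by simp
  also have "\<dots> = ?F z1 * of_real pi"
    using pki by (simp only: integral_mult_right_zero integral_complex_of_real)
  finally have eq: "(\<integral>u. ?F (Complex u y0) * of_real (y / ((x - u)\<^sup>2 + y\<^sup>2)) \<partial>lborel) = ?F z1 * of_real pi" .
  have "ennreal (norm (?F z1 * of_real pi)) \<le> (\<integral>\<^sup>+u. ennreal (norm (?F (Complex u y0) * of_real (y / ((x - u)\<^sup>2 + y\<^sup>2)))) \<partial>lborel)"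
    unfolding eq[symmetric] using i1 by (rule integral_norm_bound_ennreal)
  also have "\<dots> = (\<integral>\<^sup>+u. ennreal (norm (?F (Complex u y0))) * ennreal (y / ((x - u)\<^sup>2 + y\<^sup>2)) \<partial>lborel)"
  proof (intro nn_integral_cong)
    fix u
    have "norm (?F (Complex u y0) * of_real (y / ((x - u)\<^sup>2 + y\<^sup>2))) = norm (?F (Complex u y0)) * (y / ((x - u)\<^sup>2 + y\<^sup>2))"
      unfolding norm_mult norm_of_real using y by simp
    then show "ennreal (norm (?F (Complex u y0) * of_real (y / ((x - u)\<^sup>2 + y\<^sup>2)))) = ennreal (norm (?F (Complex u y0))) * ennreal (y / ((x - u)\<^sup>2 + y\<^sup>2))"
      using y by (simp only:) (rule ennreal_mult, auto)
  qed
  finally show ?thesis by (simp add: z1_def norm_mult mult.commute)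
qed

end

text \<open>Riesz's inequality is integrated along the line: the term with the real part of the q-th
  power drops out by Cauchy's theorem, since that power decays like \<open>norm z powr - q\<close>,
  and the rest is bounded by \<open>nn_integral_Re_cauchy_ext_powr\<close>. Independence of
  \<open>A\<close> from \<open>y\<close> is what later permits heights tending to 0.\<close>

lemma cauchy_ext_powr_bound:
  assumes q: "1 < q" "q < 2"
  obtains A where "0 \<le> A"
    "\<And>h y. nonneg_density h q \<Longrightarrow> 0 < y \<Longrightarrow>
      (\<integral>\<^sup>+x. ennreal (norm (cauchy_ext h (Complex x y)) powr q) \<partial>lborel) \<le> ennreal A * (\<integral>\<^sup>+t. ennreal (h t powr q) \<partial>lborel)"
proof -
  obtain A B where AB: "0 \<le> A" "0 \<le> B"
    "\<And>z. 0 < Re z \<Longrightarrow> norm z powr q \<le> A * Re z powr q - B * Re (z powr of_real q)"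
    using riesz_pointwise_inequality[OF q] by blast
  show ?thesis
  proof (rule that[OF AB(1)])
    fix h y assume "nonneg_density h q" and y: "0 < (y::real)"
    then interpret nonneg_density h q by simp
    let ?F = "\<lambda>x. cauchy_ext h (Complex x y)"
    have [measurable]: "?F \<in> borel_measurable borel"
      using y by (rule cauchy_ext_line_measurable)
    define H where "H = (\<integral>t. h t \<partial>lborel)"
    have H: "0 \<le> H" unfolding H_def using h_nonneg by simp
    show "(\<integral>\<^sup>+x. ennreal (norm (?F x) powr q) \<partial>lborel) \<le> ennreal A * (\<integral>\<^sup>+t. ennreal (h t powr q) \<partial>lborel)"
    \<comment> \<open>For \<open>H = 0\<close> the real part is not strictly positive, but then the
      Cauchy integral vanishes identically.\<close>
    proof (cases "H = 0")
      case True
      have "norm (?F x) = 0" for x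
        using norm_cauchy_ext_le[of "Complex x y"] True y norm_ge_zero[of "?F x"] by (simp add: H_def)
      then have "(\<integral>\<^sup>+x. ennreal (norm (?F x) powr q) \<partial>lborel) = 0" by (simp add: q)
      then show ?thesis by simp
    next
      case False
      then have Hpos: "0 < (\<integral>t. h t \<partial>lborel)" using H by (simp add: H_def)
      have Re: "0 < Re (cauchy_ext h z)" if "0 < Im z" for z using Re_cauchy_ext_pos[OF that Hpos] .
      have hol: "(\<lambda>z. cauchy_ext h z powr of_real q) holomorphic_on {z. 0 < Im z}"
      proof (rule holomorphic_on_powr[OF cauchy_ext_holomorphic])
        fix z assume "z \<in> {z. 0 < Im z}"
        then show "cauchy_ext h z \<notin> \<real>\<^sub>\<le>\<^sub>0" using Re[of z] by (auto simp: complex_nonpos_Reals_iff)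
      qed auto
      have n: "norm (w powr of_real q) = norm w powr q" for w :: complex
        by (subst norm_powr_real_powr') auto
      have [measurable]: "(\<lambda>x. ?F x powr of_real q) \<in> borel_measurable borel"
      proof (rule borel_measurable_continuous_onI)
        have "continuous_on UNIV (\<lambda>x. Complex x y)" unfolding Complex_eq by (intro continuous_intros)
        then show "continuous_on UNIV (\<lambda>x. ?F x powr of_real q)"
          using y by (intro continuous_on_compose2[OF holomorphic_on_imp_continuous_on[OF hol]]) auto
      qed
      note iq = integrable_cauchy_ext_powr[OF y]
      have ic: "integrable lborel (\<lambda>x. ?F x powr of_real q)"
        by (rule Bochner_Integration.integrable_bound[OF iq]) (auto simp: n)
      have iRe: "integrable lborel (\<lambda>x. Re (?F x) powr q)"
      proof (rule Bochner_Integration.integrable_bound[OF iq])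
        show "AE x in lborel. norm (Re (?F x) powr q) \<le> norm (norm (?F x) powr q)"
        proof (rule AE_I2)
          fix x
          have "0 < Re (?F x)" using Re y by simp
          then have "Re (?F x) powr q \<le> norm (?F x) powr q" using q by (intro powr_mono2 complex_Re_le_cmod) auto
          then show "norm (Re (?F x) powr q) \<le> norm (norm (?F x) powr q)" by simp
        qed
      qed measurable
      have zero: "(\<integral>x. ?F x powr of_real q \<partial>lborel) = 0"
      proof (rule horizontal_line_integral_zero[OF hol y y q(1), where C = "(2 * H) powr q" and L = 8])
        fix z assume z: "y \<le> Im z" "8 \<le> norm z"
        have "norm (cauchy_ext h z) powr q \<le> (2 * H / norm z) powr q"
          unfolding H_def using z y q by (intro powr_mono2 norm_cauchy_ext_decay) auto
        also have "\<dots> = (2 * H) powr q * norm z powr - q" using H by (subst powr_divide) (auto simp: powr_minus divide_inverse)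
        finally show "norm (cauchy_ext h z powr of_real q) \<le> (2 * H) powr q * norm z powr - q" unfolding n .
      qed (use ic in auto)
      have "(\<integral>x. norm (?F x) powr q \<partial>lborel) \<le> (\<integral>x. A * Re (?F x) powr q - B * Re (?F x powr of_real q) \<partial>lborel)"
        using iq iRe integrable_Re[OF ic] AB(3) Re y
        by (intro integral_mono Bochner_Integration.integrable_diff integrable_mult_right) auto
      also have "\<dots> = A * (\<integral>x. Re (?F x) powr q \<partial>lborel) - B * (\<integral>x. Re (?F x powr of_real q) \<partial>lborel)"
        using Bochner_Integration.integral_diff[OF integrable_mult_right[OF iRe] integrable_mult_right[OF integrable_Re[OF ic]]] by simp
      also have "(\<integral>x. Re (?F x powr of_real q) \<partial>lborel) = 0"
        using zero integral_Re[OF ic] by simp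
      finally have le: "(\<integral>x. norm (?F x) powr q \<partial>lborel) \<le> A * (\<integral>x. Re (?F x) powr q \<partial>lborel)" by simp
      have "(\<integral>\<^sup>+x. ennreal (norm (?F x) powr q) \<partial>lborel) = ennreal (\<integral>x. norm (?F x) powr q \<partial>lborel)"
        using iq by (rule nn_integral_eq_integral) simp
      also have "\<dots> \<le> ennreal (A * (\<integral>x. Re (?F x) powr q \<partial>lborel))" using le by (rule ennreal_leI)
      also have "\<dots> = ennreal A * (\<integral>\<^sup>+x. ennreal (Re (?F x) powr q) \<partial>lborel)"
        using AB(1) by (subst nn_integral_eq_integral[OF iRe]) (auto simp: ennreal_mult')
      also have "\<dots> \<le> ennreal A * (\<integral>\<^sup>+t. ennreal (h t powr q) \<partial>lborel)"
        using nn_integral_Re_cauchy_ext_powr[OF y] by (rule mult_left_mono) simp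
      finally show ?thesis .
    qed
  qed
qed

section \<open>Truncated Hilbert transforms\<close>

text \<open>The condition under which all truncated integrals converge absolutely.\<close>

definition tempered :: "(real \<Rightarrow> complex) \<Rightarrow> bool" where
  "tempered f \<longleftrightarrow> f \<in> borel_measurable borel \<and> integrable lborel (\<lambda>t. norm (f t) / (1 + \<bar>t\<bar>))"

text \<open>The truncated Hilbert transform after the substitution \<open>t = x - y\<close>.\<close>

definition trunc_hilbert :: "real \<Rightarrow> (real \<Rightarrow> complex) \<Rightarrow> real \<Rightarrow> complex" where
  "trunc_hilbert e f x = of_real (1 / pi) * (\<integral>t. (if e < \<bar>x - t\<bar> then f t / of_real (x - t) else 0) \<partial>lborel)"

text \<open>Rational truncation levels make this a countable supremum, hence measurable;
  \<open>trunc_hilbert_le_hilbert_max\<close> recovers all positive levels.\<close>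

definition hilbert_max :: "(real \<Rightarrow> complex) \<Rightarrow> real \<Rightarrow> ennreal" where
  "hilbert_max f x = (SUP e\<in>{e\<in>\<rat>. 0 < e}. ennreal (norm (trunc_hilbert e f x)))"

lemma tempered_measurable [measurable_dest]: "tempered f \<Longrightarrow> f \<in> borel_measurable borel"
  by (simp add: tempered_def)

lemma tempered_bound:
  assumes [measurable]: "f \<in> borel_measurable borel"
    and k: "integrable lborel k" "\<And>t. norm (f t) / (1 + \<bar>t\<bar>) \<le> (k t :: real)"
  shows "tempered f"
proof -
  have "integrable lborel (\<lambda>t. norm (f t) / (1 + \<bar>t\<bar>))"
  proof (rule Bochner_Integration.integrable_bound[OF k(1)])
    show "AE t in lborel. norm (norm (f t) / (1 + \<bar>t\<bar>)) \<le> norm (k t)"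
      using k(2) by (intro AE_I2) (simp add: order_trans[OF _ abs_ge_self])
  qed measurable
  then show ?thesis by (simp add: tempered_def)
qed

lemma tempered_dominated:
  assumes "tempered g" "f \<in> borel_measurable borel" "\<And>t. norm (f t) \<le> norm (g t)"
  shows "tempered f"
  by (rule tempered_bound[OF assms(2), of "\<lambda>t. norm (g t) / (1 + \<bar>t\<bar>)"])
    (use assms(1,3) in \<open>auto simp: tempered_def divide_right_mono\<close>)

lemma tempered_add:
  assumes "tempered f" "tempered g"
  shows "tempered (\<lambda>t. f t + g t)"
proof (rule tempered_bound)
  note [measurable] = assms
  show "(\<lambda>t. f t + g t) \<in> borel_measurable borel" by measurable
  show "integrable lborel (\<lambda>t. norm (f t) / (1 + \<bar>t\<bar>) + norm (g t) / (1 + \<bar>t\<bar>))"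
    using assms by (simp add: tempered_def)
  show "norm (f t + g t) / (1 + \<bar>t\<bar>) \<le> norm (f t) / (1 + \<bar>t\<bar>) + norm (g t) / (1 + \<bar>t\<bar>)" for t
    by (simp add: add_divide_distrib[symmetric] divide_right_mono norm_triangle_ineq)
qed

lemma tempered_cmult:
  assumes "tempered f"
  shows "tempered (\<lambda>t. c * f t)"
proof -
  have "integrable lborel (\<lambda>t. norm c * (norm (f t) / (1 + \<bar>t\<bar>)))"
    using assms by (intro integrable_mult_right) (simp add: tempered_def)
  moreover have "(\<lambda>t. c * f t) \<in> borel_measurable borel"
    using tempered_measurable[OF assms] by simp
  ultimately show ?thesis by (simp add: tempered_def norm_mult)
qed

lemma tempered_diff:
  assumes "tempered f" "tempered g"
  shows "tempered (\<lambda>t. f t - g t)"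
  using tempered_add[OF assms(1) tempered_cmult[OF assms(2), of "-1"]] by simp

lemma tempered_integrable:
  assumes "f \<in> borel_measurable borel" "integrable lborel f"
  shows "tempered f"
proof (rule tempered_bound[OF assms(1)])
  show "integrable lborel (\<lambda>t. norm (f t))" using assms by simp
  show "norm (f t) / (1 + \<bar>t\<bar>) \<le> norm (f t)" for t
    using mult_left_mono[of 1 "1 + \<bar>t\<bar>" "norm (f t)"] by (simp add: divide_le_eq)
qed

text \<open>Where the kernel is not cut off, \<open>1 \<le> \<bar>x - t\<bar> / e\<close>, so
  \<open>1 + \<bar>t\<bar>\<close> is at most a multiple of \<open>\<bar>x - t\<bar>\<close>. This
  is why the weight \<open>1 / (1 + \<bar>t\<bar>)\<close> in \<open>tempered\<close> controls every
  truncation at every point.\<close>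

lemma hilbert_kernel_le:
  assumes "e < \<bar>x - t\<bar>" "0 < (e::real)"
  shows "1 / \<bar>x - t\<bar> \<le> ((1 + \<bar>x\<bar>) / e + 1) / (1 + \<bar>t\<bar>)"
proof -
  have "1 + \<bar>t\<bar> \<le> (1 + \<bar>x\<bar>) * 1 + \<bar>x - t\<bar>" using abs_triangle_ineq4[of x "x - t"] by simp
  also have "(1 + \<bar>x\<bar>) * 1 \<le> (1 + \<bar>x\<bar>) * (\<bar>x - t\<bar> / e)" using assms by (intro mult_left_mono) auto
  finally have "1 + \<bar>t\<bar> \<le> ((1 + \<bar>x\<bar>) / e + 1) * \<bar>x - t\<bar>" by (simp add: algebra_simps)
  moreover have "0 < 1 + \<bar>t\<bar>" "0 < \<bar>x - t\<bar>" using assms by linarith+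
  ultimately show ?thesis by (simp add: divide_le_eq pos_le_divide_eq mult.commute)
qed

lemma tempered_integrable_kernel:
  assumes f: "tempered f" and e: "0 < e"
  shows "integrable lborel (\<lambda>t. if e < \<bar>x - t\<bar> then f t / of_real (x - t) else 0)"
proof (rule Bochner_Integration.integrable_bound)
  have [measurable]: "f \<in> borel_measurable borel" using f by (rule tempered_measurable)
  let ?C = "(1 + \<bar>x\<bar>) / e + 1"
  show "integrable lborel (\<lambda>t. ?C * (norm (f t) / (1 + \<bar>t\<bar>)))"
    using f by (intro integrable_mult_right) (simp add: tempered_def)
  show "(\<lambda>t. if e < \<bar>x - t\<bar> then f t / of_real (x - t) else 0) \<in> borel_measurable lborel" by measurable
  show "AE t in lborel. norm (if e < \<bar>x - t\<bar> then f t / of_real (x - t) else 0) \<le> norm (?C * (norm (f t) / (1 + \<bar>t\<bar>)))"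
  proof (rule AE_I2)
    fix t
    have C: "0 \<le> ?C" using e by simp
    show "norm (if e < \<bar>x - t\<bar> then f t / of_real (x - t) else 0) \<le> norm (?C * (norm (f t) / (1 + \<bar>t\<bar>)))"
    proof (cases "e < \<bar>x - t\<bar>")
      case True
      have "norm (f t) * (1 / \<bar>x - t\<bar>) \<le> norm (f t) * (?C / (1 + \<bar>t\<bar>))"
        by (intro mult_left_mono hilbert_kernel_le True e) auto
      then show ?thesis using True C by (simp add: norm_divide abs_mult mult.commute flip: of_real_diff)
    qed simp
  qed
qed

lemma trunc_hilbert_measurable [measurable]:
  assumes [measurable]: "f \<in> borel_measurable borel"
  shows "trunc_hilbert e f \<in> borel_measurable borel"
proof -
  have "(\<lambda>x. \<integral>t. (if e < \<bar>x - t\<bar> then f t / of_real (x - t) else 0) \<partial>lborel) \<in> borel_measurable borel"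
    by (rule lborel.borel_measurable_lebesgue_integral) measurable
  then show ?thesis unfolding trunc_hilbert_def by measurable
qed

lemma hilbert_max_measurable [measurable]:
  assumes [measurable]: "f \<in> borel_measurable borel"
  shows "hilbert_max f \<in> borel_measurable borel"
proof -
  have "countable {e\<in>\<rat>. 0 < (e::real)}"
    by (rule countable_subset[OF _ countable_rat]) auto
  then show ?thesis unfolding hilbert_max_def by (intro borel_measurable_SUP) auto
qed

lemma trunc_hilbert_cmult: "trunc_hilbert e (\<lambda>t. c * f t) x = c * trunc_hilbert e f x"
proof -
  have "(\<lambda>t. if e < \<bar>x - t\<bar> then c * f t / of_real (x - t) else 0) = (\<lambda>t. c * (if e < \<bar>x - t\<bar> then f t / of_real (x - t) else 0))"
    by auto
  then show ?thesis unfolding trunc_hilbert_def by (simp add: mult.left_commute)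
qed

lemma trunc_hilbert_add:
  assumes "tempered f" "tempered g" "0 < e"
  shows "trunc_hilbert e (\<lambda>t. f t + g t) x = trunc_hilbert e f x + trunc_hilbert e g x"
proof -
  have "(\<lambda>t. if e < \<bar>x - t\<bar> then (f t + g t) / of_real (x - t) else 0) =
    (\<lambda>t. (if e < \<bar>x - t\<bar> then f t / of_real (x - t) else 0) + (if e < \<bar>x - t\<bar> then g t / of_real (x - t) else 0))"
    by (auto simp: add_divide_distrib)
  then show ?thesis unfolding trunc_hilbert_def
    using Bochner_Integration.integral_add[OF tempered_integrable_kernel[OF assms(1,3), of x] tempered_integrable_kernel[OF assms(2,3), of x]]
    by (simp add: distrib_left)
qed

lemma trunc_hilbert_diff:
  assumes "tempered f" "tempered g" "0 < e"
  shows "trunc_hilbert e (\<lambda>t. f t - g t) x = trunc_hilbert e f x - trunc_hilbert e g x"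
  using trunc_hilbert_add[OF assms(1) tempered_cmult[OF assms(2), of "-1"] assms(3), of x] trunc_hilbert_cmult[of e "-1" g x] by simp

text \<open>Rational levels tending to \<open>e\<close> from above recover the truncation at
  \<open>e\<close> by dominated convergence. Approaching from above fits the strict inequality in
  the truncation: points with \<open>\<bar>x - t\<bar> = e\<close> are cut off at every stage, and
  the integrand at level \<open>e\<close> dominates.\<close>

lemma trunc_hilbert_le_hilbert_max:
  assumes f: "tempered f" and e: "0 < e"
  shows "ennreal (norm (trunc_hilbert e f x)) \<le> hilbert_max f x"
proof -
  have [measurable]: "f \<in> borel_measurable borel" using f by (rule tempered_measurable)
  have "\<exists>r\<in>\<rat>. e < r \<and> r < e + 1 / real (Suc n)" for n by (intro Rats_dense_in_real) auto
  then obtain r where r: "\<And>n. r n \<in> \<rat>" "\<And>n. e < r n" "\<And>n. r n < e + 1 / real (Suc n)" by metis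
  have lim: "(\<lambda>n. trunc_hilbert (r n) f x) \<longlonglongrightarrow> trunc_hilbert e f x"
    unfolding trunc_hilbert_def
  proof (intro tendsto_mult_left integral_dominated_convergence[where w = "\<lambda>t. norm (if e < \<bar>x - t\<bar> then f t / of_real (x - t) else 0)"])
    show "integrable lborel (\<lambda>t. norm (if e < \<bar>x - t\<bar> then f t / of_real (x - t) else 0))"
      by (rule integrable_norm[OF tempered_integrable_kernel[OF f e]])
    show "AE t in lborel. norm (if r n < \<bar>x - t\<bar> then f t / of_real (x - t) else 0) \<le> norm (if e < \<bar>x - t\<bar> then f t / of_real (x - t) else 0)" for n
      using r(2)[of n] by (intro AE_I2) auto
    show "AE t in lborel. (\<lambda>n. if r n < \<bar>x - t\<bar> then f t / of_real (x - t) else 0) \<longlonglongrightarrow> (if e < \<bar>x - t\<bar> then f t / of_real (x - t) else 0)"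
    proof (rule AE_I2)
      fix t
      have "\<forall>\<^sub>F n in sequentially. (r n < \<bar>x - t\<bar>) = (e < \<bar>x - t\<bar>)"
      proof (cases "e < \<bar>x - t\<bar>")
        case True
        have "(\<lambda>n. e + 1 / real (Suc n)) \<longlonglongrightarrow> e + 0"
          by (intro tendsto_intros) (rule LIMSEQ_Suc[OF lim_1_over_n])
        then have "\<forall>\<^sub>F n in sequentially. e + 1 / real (Suc n) < \<bar>x - t\<bar>"
          using True by (intro order_tendstoD(2)) auto
        then show ?thesis
        proof eventually_elim
          case (elim n)
          then show ?case using r(3)[of n] True by linarith
        qed
      next
        case False
        have "(r n < \<bar>x - t\<bar>) = (e < \<bar>x - t\<bar>)" for n using False r(2)[of n] by linarith
        then show ?thesis by simp
      qed
      then have "\<forall>\<^sub>F n in sequentially. (if r n < \<bar>x - t\<bar> then f t / of_real (x - t) else 0) = (if e < \<bar>x - t\<bar> then f t / of_real (x - t) else 0)"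
        by eventually_elim simp
      then show "(\<lambda>n. if r n < \<bar>x - t\<bar> then f t / of_real (x - t) else 0) \<longlonglongrightarrow> (if e < \<bar>x - t\<bar> then f t / of_real (x - t) else 0)"
        by (rule tendsto_eventually)
    qed
  qed measurable
  then have "(\<lambda>n. ennreal (norm (trunc_hilbert (r n) f x))) \<longlonglongrightarrow> ennreal (norm (trunc_hilbert e f x))"
    by (intro tendsto_intros)
  moreover have "ennreal (norm (trunc_hilbert (r n) f x)) \<le> hilbert_max f x" for n
    unfolding hilbert_max_def using r(1)[of n] r(2)[of n] e by (intro SUP_upper) auto
  ultimately show ?thesis by (meson LIMSEQ_le_const2)
qed

lemma hilbert_max_add:
  assumes "tempered f" "tempered g"
  shows "hilbert_max (\<lambda>t. f t + g t) x \<le> hilbert_max f x + hilbert_max g x"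
  unfolding hilbert_max_def[of "\<lambda>t. f t + g t"]
proof (rule SUP_least)
  fix e :: real assume "e \<in> {e\<in>\<rat>. 0 < e}"
  then have e: "0 < e" by simp
  have "ennreal (norm (trunc_hilbert e (\<lambda>t. f t + g t) x)) \<le> ennreal (norm (trunc_hilbert e f x) + norm (trunc_hilbert e g x))"
    unfolding trunc_hilbert_add[OF assms e] by (intro ennreal_leI norm_triangle_ineq)
  also have "\<dots> = ennreal (norm (trunc_hilbert e f x)) + ennreal (norm (trunc_hilbert e g x))" by simp
  also have "\<dots> \<le> hilbert_max f x + hilbert_max g x" by (intro add_mono trunc_hilbert_le_hilbert_max assms e)
  finally show "ennreal (norm (trunc_hilbert e (\<lambda>t. f t + g t) x)) \<le> hilbert_max f x + hilbert_max g x" .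
qed

lemma hilbert_max_cmult: "hilbert_max (\<lambda>t. c * f t) x = ennreal (norm c) * hilbert_max f x"
  unfolding hilbert_max_def
  by (subst SUP_mult_left_ennreal) (simp add: trunc_hilbert_cmult norm_mult ennreal_mult')

section \<open>Local estimates for the maximal Hilbert transform\<close>

lemma norm_le_one_add_powr:
  assumes "0 \<le> (a::real)" "1 \<le> q"
  shows "a \<le> 1 + a powr q"
proof (cases "a \<le> 1")
  case False
  then have "a powr 1 \<le> a powr q" using assms by (intro powr_mono) auto
  then show ?thesis using False by simp
qed (auto intro: order_trans)

text \<open>The truncation at \<open>e\<close> is at most
  \<open>pi * norm (cauchy_ext h (Complex x e))\<close>, which the Poisson formula bounds through
  the values of the Cauchy integral on any lower line. The maximal function of those values at
  height \<open>1 / Suc n\<close> serves all rational \<open>e\<close> above that height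
  simultaneously, and its integral is bounded independently of \<open>n\<close>.\<close>

lemma hilbert_max_local_nonneg:
  assumes q: "1 < q" "q < 2"
  obtains C where "0 \<le> C"
    "\<And>h. nonneg_density h q \<Longrightarrow> (\<integral>\<^sup>+x\<in>{-2..2}. hilbert_max (\<lambda>t. of_real (h t)) x \<partial>lborel) \<le> ennreal C * (1 + (\<integral>\<^sup>+t. ennreal (h t powr q) \<partial>lborel))"
proof -
  obtain A where A: "0 \<le> A" "\<And>h y. nonneg_density h q \<Longrightarrow> 0 < y \<Longrightarrow>
      (\<integral>\<^sup>+x. ennreal (norm (cauchy_ext h (Complex x y)) powr q) \<partial>lborel) \<le> ennreal A * (\<integral>\<^sup>+t. ennreal (h t powr q) \<partial>lborel)"
    using cauchy_ext_powr_bound[OF q] by blast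
  obtain D where D: "0 \<le> D" "\<And>g :: real \<Rightarrow> real. g \<in> borel_measurable borel \<Longrightarrow> (\<And>u. 0 \<le> g u) \<Longrightarrow>
      (\<integral>\<^sup>+x\<in>{-2..2}. hl_max (\<lambda>u. ennreal (g u)) x \<partial>lborel) \<le> 4 + ennreal D * (\<integral>\<^sup>+u. ennreal (g u powr q) \<partial>lborel)"
    using hl_max_local_integral[OF q(1)] by blast
  define C where "C = 16 * (4 + D * A)"
  show ?thesis
  proof (rule that)
    show "0 \<le> C" unfolding C_def using A D by simp
    fix h assume "nonneg_density h q"
    then interpret nonneg_density h q .
    let ?I = "\<integral>\<^sup>+t. ennreal (h t powr q) \<partial>lborel"
    define g where "g = (\<lambda>n x. norm (cauchy_ext h (Complex x (1 / real (Suc n)))))"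
    have [measurable]: "g n \<in> borel_measurable borel" for n
      unfolding g_def using cauchy_ext_line_measurable[of "1 / real (Suc n)"] by simp
    have g0: "0 \<le> g n x" for n x by (simp add: g_def)
    have gI: "(\<integral>\<^sup>+x. ennreal (g n x powr q) \<partial>lborel) \<le> ennreal A * ?I" for n
      unfolding g_def by (rule A(2)) (use nonneg_density_axioms in auto)
    let ?M = "\<lambda>n. hl_max (\<lambda>u. ennreal (g n u))"
    \<comment> \<open>A given \<open>e\<close> lies above the line of height
      \<open>1 / Suc n\<close> only for large \<open>n\<close>. The lower limit does not involve
      \<open>e\<close>, so it bounds the supremum over \<open>e\<close>, and Fatou's lemma
      integrates it.\<close>
    have ptw: "hilbert_max (\<lambda>t. of_real (h t)) x \<le> liminf (\<lambda>n. 16 * ?M n x)" for x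
      unfolding hilbert_max_def
    proof (rule SUP_least)
      fix e :: real assume "e \<in> {e\<in>\<rat>. 0 < e}"
      then have e: "0 < e" "e \<in> \<rat>" by auto
      have tr: "trunc_hilbert e (\<lambda>t. of_real (h t)) x = of_real (1 / pi * (\<integral>t. indicator {t. e < \<bar>x - t\<bar>} t * (h t / (x - t)) \<partial>lborel))"
      proof -
        have "(\<integral>t. (if e < \<bar>x - t\<bar> then complex_of_real (h t) / of_real (x - t) else 0) \<partial>lborel) = (\<integral>t. complex_of_real (indicator {t. e < \<bar>x - t\<bar>} t * (h t / (x - t))) \<partial>lborel)"
          by (intro Bochner_Integration.integral_cong) (auto simp: indicator_def)
        also have "\<dots> = of_real (\<integral>t. indicator {t. e < \<bar>x - t\<bar>} t * (h t / (x - t)) \<partial>lborel)"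
          by (rule integral_complex_of_real)
        finally show ?thesis unfolding trunc_hilbert_def by simp
      qed
      have "norm (trunc_hilbert e (\<lambda>t. of_real (h t)) x) \<le> 2 * norm (cauchy_ext h (Complex x e))"
        unfolding tr norm_of_real by (rule truncated_le_cauchy_ext(2)[OF e(1)])
      \<comment> \<open>Raising the factor 2 to pi matches the left-hand side of
        \<open>cauchy_ext_poisson\<close>.\<close>
      also have "\<dots> \<le> pi * norm (cauchy_ext h (Complex x e))"
        using pi_gt3 by (intro mult_right_mono) auto
      finally have le: "ennreal (norm (trunc_hilbert e (\<lambda>t. of_real (h t)) x)) \<le> ennreal (pi * norm (cauchy_ext h (Complex x e)))"
        by (rule ennreal_leI)
      have "\<forall>\<^sub>F n in sequentially. 1 / real (Suc n) < e"
        using LIMSEQ_Suc[OF lim_1_over_n[where 'a = real]] e(1) by (intro order_tendstoD(2)) auto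
      then have "\<forall>\<^sub>F n in sequentially. ennreal (norm (trunc_hilbert e (\<lambda>t. of_real (h t)) x)) \<le> 16 * ?M n x"
      proof eventually_elim
        case (elim n)
        have "ennreal (pi * norm (cauchy_ext h (Complex x ((e - 1 / real (Suc n)) + 1 / real (Suc n)))))
          \<le> (\<integral>\<^sup>+u. ennreal (g n u) * ennreal ((e - 1 / real (Suc n)) / ((x - u)\<^sup>2 + (e - 1 / real (Suc n))\<^sup>2)) \<partial>lborel)"
          unfolding g_def by (rule cauchy_ext_poisson) (use elim in auto)
        also have "\<dots> \<le> 16 * ?M n x"
          by (rule poisson_le_hl_max) (use elim e in \<open>auto intro!: Rats_diff Rats_divide\<close>)
        finally have "ennreal (pi * norm (cauchy_ext h (Complex x e))) \<le> 16 * ?M n x" by simp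
        with le show ?case by (rule order_trans)
      qed
      then show "ennreal (norm (trunc_hilbert e (\<lambda>t. of_real (h t)) x)) \<le> liminf (\<lambda>n. 16 * ?M n x)"
        by (rule Liminf_bounded)
    qed
    have "(\<integral>\<^sup>+x\<in>{-2..2}. hilbert_max (\<lambda>t. of_real (h t)) x \<partial>lborel) \<le> (\<integral>\<^sup>+x. liminf (\<lambda>n. 16 * (?M n x * indicator {-2..2} x)) \<partial>lborel)"
      using ptw by (intro nn_integral_mono) (auto simp: indicator_def)
    also have "\<dots> \<le> liminf (\<lambda>n. \<integral>\<^sup>+x. 16 * (?M n x * indicator {-2..2} x) \<partial>lborel)"
      by (intro nn_integral_liminf) measurable
    also have "\<dots> \<le> liminf (\<lambda>n::nat. 16 * (4 + ennreal D * (ennreal A * ?I)))"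
    proof (intro Liminf_mono always_eventually allI)
      fix n
      have "(\<integral>\<^sup>+x\<in>{-2..2}. ?M n x \<partial>lborel) \<le> 4 + ennreal D * (\<integral>\<^sup>+u. ennreal (g n u powr q) \<partial>lborel)"
        by (rule D(2)) (auto simp: g0)
      also have "\<dots> \<le> 4 + ennreal D * (ennreal A * ?I)" by (intro add_left_mono mult_left_mono gI) simp
      finally have "16 * (\<integral>\<^sup>+x\<in>{-2..2}. ?M n x \<partial>lborel) \<le> 16 * (4 + ennreal D * (ennreal A * ?I))" by (rule mult_left_mono) simp
      then show "(\<integral>\<^sup>+x. 16 * (?M n x * indicator {-2..2} x) \<partial>lborel) \<le> 16 * (4 + ennreal D * (ennreal A * ?I))"
        by (subst nn_integral_cmult) auto
    qed
    also have "\<dots> = 16 * (4 + ennreal D * (ennreal A * ?I))" by (rule Liminf_const) simp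
    also have "\<dots> \<le> 16 * (ennreal (4 + D * A) * (1 + ?I))"
    proof (intro mult_left_mono)
      have "4 + ennreal D * (ennreal A * ?I) = ennreal 4 * 1 + ennreal (D * A) * ?I"
        using A D by (simp add: ennreal_mult mult.assoc)
      also have "\<dots> \<le> ennreal (4 + D * A) * 1 + ennreal (4 + D * A) * ?I"
        using A D by (intro add_mono mult_right_mono ennreal_leI) auto
      finally show "4 + ennreal D * (ennreal A * ?I) \<le> ennreal (4 + D * A) * (1 + ?I)" by (simp add: distrib_left)
    qed simp
    also have "\<dots> = ennreal C * (1 + ?I)"
    proof -
      have "ennreal C = ennreal 16 * ennreal (4 + D * A)"
        unfolding C_def using A D by (intro ennreal_mult) auto
      then show ?thesis by (simp add: mult.assoc)
    qed
    finally show "(\<integral>\<^sup>+x\<in>{-2..2}. hilbert_max (\<lambda>t. of_real (h t)) x \<partial>lborel) \<le> ennreal C * (1 + ?I)" .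
  qed
qed

lemma integrable_of_powr_bounded_support:
  fixes f :: "real \<Rightarrow> 'b::{banach,second_countable_topology}"
  assumes [measurable]: "f \<in> borel_measurable borel" and supp: "\<And>t. 4 < \<bar>t\<bar> \<Longrightarrow> f t = 0"
    and q: "1 < q" and fin: "(\<integral>\<^sup>+t. ennreal (norm (f t) powr q) \<partial>lborel) < \<infinity>"
  shows "integrable lborel f"
proof (rule integrableI_bounded)
  have "(\<integral>\<^sup>+t. ennreal (norm (f t)) \<partial>lborel) \<le> (\<integral>\<^sup>+t. indicator {-4..4} t + ennreal (norm (f t) powr q) \<partial>lborel)"
  proof (rule nn_integral_mono)
    fix t
    show "ennreal (norm (f t)) \<le> indicator {-4..4} t + ennreal (norm (f t) powr q)"
    proof (cases "\<bar>t\<bar> \<le> 4")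
      case True
      have "ennreal (norm (f t)) \<le> ennreal (1 + norm (f t) powr q)"
        using q by (intro ennreal_leI norm_le_one_add_powr) auto
      then show ?thesis using True by (auto simp: indicator_def)
    qed (simp add: supp)
  qed
  also have "\<dots> = 8 + (\<integral>\<^sup>+t. ennreal (norm (f t) powr q) \<partial>lborel)"
    by (subst nn_integral_add) auto
  also have "\<dots> < \<infinity>" using fin by (simp add: ennreal_add_less_top)
  finally show "(\<integral>\<^sup>+t. ennreal (norm (f t)) \<partial>lborel) < \<infinity>" .
qed measurable

text \<open>The positive and negative parts of the real and imaginary parts are four nonnegative
  densities dominated by \<open>norm (f t)\<close>; subadditivity of \<open>hilbert_max\<close>
  costs the factor 4.\<close>

lemma hilbert_max_local:
  assumes q: "1 < q" "q < 2"
  obtains C where "0 \<le> C"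
    "\<And>f. f \<in> borel_measurable borel \<Longrightarrow> (\<And>t. 4 < \<bar>t\<bar> \<Longrightarrow> f t = 0) \<Longrightarrow> (\<integral>\<^sup>+t. ennreal (norm (f t) powr q) \<partial>lborel) < \<infinity> \<Longrightarrow>
      (\<integral>\<^sup>+x\<in>{-2..2}. hilbert_max f x \<partial>lborel) \<le> ennreal C * (1 + (\<integral>\<^sup>+t. ennreal (norm (f t) powr q) \<partial>lborel))"
proof -
  obtain C where C: "0 \<le> C"
    "\<And>h. nonneg_density h q \<Longrightarrow> (\<integral>\<^sup>+x\<in>{-2..2}. hilbert_max (\<lambda>t. of_real (h t)) x \<partial>lborel) \<le> ennreal C * (1 + (\<integral>\<^sup>+t. ennreal (h t powr q) \<partial>lborel))"
    using hilbert_max_local_nonneg[OF q] by blast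
  show ?thesis
  proof (rule that[of "4 * C"])
    show "0 \<le> 4 * C" using C by simp
    fix f :: "real \<Rightarrow> complex"
    assume [measurable]: "f \<in> borel_measurable borel" and supp: "\<And>t. 4 < \<bar>t\<bar> \<Longrightarrow> f t = 0"
      and fin: "(\<integral>\<^sup>+t. ennreal (norm (f t) powr q) \<partial>lborel) < \<infinity>"
    let ?I = "\<integral>\<^sup>+t. ennreal (norm (f t) powr q) \<partial>lborel"
    have intf: "integrable lborel f"
      by (rule integrable_of_powr_bounded_support[OF _ supp q(1) fin]) auto
    have part: "tempered (\<lambda>t. of_real (h t)) \<and> (\<integral>\<^sup>+x\<in>{-2..2}. hilbert_max (\<lambda>t. of_real (h t)) x \<partial>lborel) \<le> ennreal C * (1 + ?I)"
      if h: "\<And>t. 0 \<le> h t" "\<And>t. h t \<le> norm (f t)" and [measurable]: "h \<in> borel_measurable borel" for h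
    proof -
      have inth: "integrable lborel h"
        by (rule Bochner_Integration.integrable_bound[OF intf]) (use h in auto)
      have s: "h t = 0" if "4 < \<bar>t\<bar>" for t using supp[OF that] h[of t] by simp
      interpret nonneg_density h q by standard (use h inth s q in auto)
      have "(\<integral>\<^sup>+x\<in>{-2..2}. hilbert_max (\<lambda>t. of_real (h t)) x \<partial>lborel) \<le> ennreal C * (1 + (\<integral>\<^sup>+t. ennreal (h t powr q) \<partial>lborel))"
        by (rule C(2)) (rule nonneg_density_axioms)
      also have "\<dots> \<le> ennreal C * (1 + ?I)"
        using h q by (intro mult_left_mono add_left_mono nn_integral_mono ennreal_leI powr_mono2) auto
      finally show ?thesis using inth by (auto intro!: tempered_integrable)
    qed
    define h1 where "h1 = (\<lambda>t. max (Re (f t)) 0)"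
    define h2 where "h2 = (\<lambda>t. max (- Re (f t)) 0)"
    define h3 where "h3 = (\<lambda>t. max (Im (f t)) 0)"
    define h4 where "h4 = (\<lambda>t. max (- Im (f t)) 0)"
    note defs = h1_def h2_def h3_def h4_def
    have Re: "\<bar>Re (f t)\<bar> \<le> norm (f t)" and Im: "\<bar>Im (f t)\<bar> \<le> norm (f t)" for t
      by (rule abs_Re_le_cmod, rule abs_Im_le_cmod)
    have [measurable]: "h1 \<in> borel_measurable borel" "h2 \<in> borel_measurable borel" "h3 \<in> borel_measurable borel" "h4 \<in> borel_measurable borel"
      unfolding defs by measurable
    have p1: "tempered (\<lambda>t. of_real (h1 t))" "(\<integral>\<^sup>+x\<in>{-2..2}. hilbert_max (\<lambda>t. of_real (h1 t)) x \<partial>lborel) \<le> ennreal C * (1 + ?I)"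
      using part[of h1] Re unfolding h1_def by (auto simp: abs_le_iff)
    have p2: "tempered (\<lambda>t. of_real (h2 t))" "(\<integral>\<^sup>+x\<in>{-2..2}. hilbert_max (\<lambda>t. of_real (h2 t)) x \<partial>lborel) \<le> ennreal C * (1 + ?I)"
      using part[of h2] Re unfolding h2_def by (auto simp: abs_le_iff)
    have p3: "tempered (\<lambda>t. of_real (h3 t))" "(\<integral>\<^sup>+x\<in>{-2..2}. hilbert_max (\<lambda>t. of_real (h3 t)) x \<partial>lborel) \<le> ennreal C * (1 + ?I)"
      using part[of h3] Im unfolding h3_def by (auto simp: abs_le_iff)
    have p4: "tempered (\<lambda>t. of_real (h4 t))" "(\<integral>\<^sup>+x\<in>{-2..2}. hilbert_max (\<lambda>t. of_real (h4 t)) x \<partial>lborel) \<le> ennreal C * (1 + ?I)"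
      using part[of h4] Im unfolding h4_def by (auto simp: abs_le_iff)
    have feq: "f = (\<lambda>t. (of_real (h1 t) + (-1) * of_real (h2 t)) + (\<i> * of_real (h3 t) + (- \<i>) * of_real (h4 t)))"
      by (auto simp: defs complex_eq_iff max_def)
    have ptw: "hilbert_max f x \<le> (hilbert_max (\<lambda>t. of_real (h1 t)) x + hilbert_max (\<lambda>t. of_real (h2 t)) x)
        + (hilbert_max (\<lambda>t. of_real (h3 t)) x + hilbert_max (\<lambda>t. of_real (h4 t)) x)" for x
    proof -
      have "hilbert_max f x \<le> hilbert_max (\<lambda>t. of_real (h1 t) + (-1) * of_real (h2 t)) x + hilbert_max (\<lambda>t. \<i> * of_real (h3 t) + (- \<i>) * of_real (h4 t)) x"
        by (subst feq) (intro hilbert_max_add tempered_add tempered_cmult p1 p2 p3 p4)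
      also have "\<dots> \<le> (hilbert_max (\<lambda>t. of_real (h1 t)) x + hilbert_max (\<lambda>t. (-1) * of_real (h2 t)) x)
        + (hilbert_max (\<lambda>t. \<i> * of_real (h3 t)) x + hilbert_max (\<lambda>t. (- \<i>) * of_real (h4 t)) x)"
        by (intro add_mono hilbert_max_add tempered_cmult p1 p2 p3 p4)
      finally show ?thesis unfolding hilbert_max_cmult by simp
    qed
    have "(\<integral>\<^sup>+x\<in>{-2..2}. hilbert_max f x \<partial>lborel) \<le> (\<integral>\<^sup>+x. (hilbert_max (\<lambda>t. of_real (h1 t)) x * indicator {-2..2} x + hilbert_max (\<lambda>t. of_real (h2 t)) x * indicator {-2..2} x)
        + (hilbert_max (\<lambda>t. of_real (h3 t)) x * indicator {-2..2} x + hilbert_max (\<lambda>t. of_real (h4 t)) x * indicator {-2..2} x) \<partial>lborel)"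
      using ptw by (intro nn_integral_mono) (auto simp: indicator_def)
    also have "\<dots> = ((\<integral>\<^sup>+x\<in>{-2..2}. hilbert_max (\<lambda>t. of_real (h1 t)) x \<partial>lborel) + (\<integral>\<^sup>+x\<in>{-2..2}. hilbert_max (\<lambda>t. of_real (h2 t)) x \<partial>lborel))
        + ((\<integral>\<^sup>+x\<in>{-2..2}. hilbert_max (\<lambda>t. of_real (h3 t)) x \<partial>lborel) + (\<integral>\<^sup>+x\<in>{-2..2}. hilbert_max (\<lambda>t. of_real (h4 t)) x \<partial>lborel))"
      by (simp add: nn_integral_add)
    also have "\<dots> \<le> (ennreal C * (1 + ?I) + ennreal C * (1 + ?I)) + (ennreal C * (1 + ?I) + ennreal C * (1 + ?I))"
      by (intro add_mono p1 p2 p3 p4)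
    also have "\<dots> = 4 * (ennreal C * (1 + ?I))"
    proof -
      have "(4::ennreal) = (1 + 1) + (1 + 1)" by simp
      then show ?thesis by (simp only: distrib_right mult_1_left)
    qed
    also have "\<dots> = ennreal (4 * C) * (1 + ?I)"
      using C(1) by (simp add: ennreal_mult mult.assoc)
    finally show "(\<integral>\<^sup>+x\<in>{-2..2}. hilbert_max f x \<partial>lborel) \<le> ennreal (4 * C) * (1 + ?I)" .
  qed
qed

section \<open>Existence of the principal value\<close>

definition pv_exists :: "(real \<Rightarrow> complex) \<Rightarrow> real \<Rightarrow> bool" where
  "pv_exists f x \<longleftrightarrow> (\<exists>l. ((\<lambda>e. trunc_hilbert e f x) \<longlongrightarrow> l) (at_right 0))"

lemma eventually_at_right_0: "0 < (d::real) \<Longrightarrow> \<forall>\<^sub>F e in at_right 0. 0 < e \<and> e < d"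
  unfolding eventually_at_right_field by (intro exI[of _ d]) auto

lemma pv_exists_eventually_const:
  assumes "\<forall>\<^sub>F e in at_right 0. trunc_hilbert e g x = c"
  shows "pv_exists g x"
  unfolding pv_exists_def using tendsto_eventually[OF assms] by blast

lemma pv_exists_zero: "pv_exists (\<lambda>t. 0) x"
  by (rule pv_exists_eventually_const[of "\<lambda>t. 0" x 0]) (use trunc_hilbert_cmult[of _ 0 "\<lambda>t. 0" x] in simp)

lemma pv_exists_cmult:
  assumes "pv_exists f x"
  shows "pv_exists (\<lambda>t. c * f t) x"
  using assms unfolding pv_exists_def trunc_hilbert_cmult by (auto intro: tendsto_mult_left)

lemma pv_exists_add:
  assumes "tempered f" "tempered g" "pv_exists f x" "pv_exists g x"
  shows "pv_exists (\<lambda>t. f t + g t) x"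
proof -
  obtain l m where "((\<lambda>e. trunc_hilbert e f x) \<longlongrightarrow> l) (at_right 0)" "((\<lambda>e. trunc_hilbert e g x) \<longlongrightarrow> m) (at_right 0)"
    using assms by (auto simp: pv_exists_def)
  then have lim: "((\<lambda>e. trunc_hilbert e f x + trunc_hilbert e g x) \<longlongrightarrow> l + m) (at_right 0)" by (rule tendsto_add)
  have "\<forall>\<^sub>F e in at_right 0. trunc_hilbert e f x + trunc_hilbert e g x = trunc_hilbert e (\<lambda>t. f t + g t) x"
    using eventually_at_right_0[OF zero_less_one] by eventually_elim (auto simp: trunc_hilbert_add assms)
  from tendsto_cong[OF this] lim show ?thesis unfolding pv_exists_def by blast
qed

text \<open>For small \<open>e\<close> the truncations of \<open>f\<close> stay close to the
  principal value of one approximant \<open>g\<close>, so they satisfy the Cauchy criterion as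
  \<open>e\<close> tends to 0, and completeness provides the limit.\<close>

lemma pv_exists_approx:
  assumes "tempered f"
    and "\<And>\<eta>. 0 < \<eta> \<Longrightarrow> \<exists>g. tempered g \<and> pv_exists g x \<and> hilbert_max (\<lambda>t. f t - g t) x \<le> ennreal \<eta>"
  shows "pv_exists f x"
proof -
  let ?F = "filtermap (\<lambda>e. trunc_hilbert e f x) (at_right (0::real))"
  have "cauchy_filter ?F"
    unfolding cauchy_filter_metric_filtermap
  proof (intro allI impI)
    fix \<eta> :: real assume "0 < \<eta>"
    then obtain g where g: "tempered g" "pv_exists g x" "hilbert_max (\<lambda>t. f t - g t) x \<le> ennreal (\<eta> / 4)"
      using assms(2)[of "\<eta> / 4"] by auto
    obtain l where l: "((\<lambda>e. trunc_hilbert e g x) \<longlongrightarrow> l) (at_right 0)" using g(2) by (auto simp: pv_exists_def)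
    have "\<forall>\<^sub>F e in at_right 0. dist (trunc_hilbert e g x) l < \<eta> / 4"
      using l \<open>0 < \<eta>\<close> by (intro tendstoD) auto
    then have ev: "\<forall>\<^sub>F e in at_right 0. dist (trunc_hilbert e f x) l < \<eta> / 2"
      using eventually_at_right_0[OF zero_less_one]
    proof eventually_elim
      case (elim e)
      have "ennreal (norm (trunc_hilbert e (\<lambda>t. f t - g t) x)) \<le> ennreal (\<eta> / 4)"
        using trunc_hilbert_le_hilbert_max[OF tempered_diff[OF assms(1) g(1)], of e x] elim g(3) by (auto intro: order_trans)
      then have "norm (trunc_hilbert e f x - trunc_hilbert e g x) \<le> \<eta> / 4"
        using trunc_hilbert_diff[OF assms(1) g(1), of e x] elim \<open>0 < \<eta>\<close> by simp
      then have "dist (trunc_hilbert e f x) (trunc_hilbert e g x) \<le> \<eta> / 4" by (simp add: dist_norm)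
      then show ?case using elim dist_triangle[of "trunc_hilbert e f x" l "trunc_hilbert e g x"] by linarith
    qed
    show "\<exists>P. eventually P (at_right 0) \<and> (\<forall>a b. P a \<and> P b \<longrightarrow> dist (trunc_hilbert a f x) (trunc_hilbert b f x) < \<eta>)"
    proof (intro exI conjI allI impI)
      show "eventually (\<lambda>e. dist (trunc_hilbert e f x) l < \<eta> / 2) (at_right 0)" by (rule ev)
      fix a b assume "dist (trunc_hilbert a f x) l < \<eta> / 2 \<and> dist (trunc_hilbert b f x) l < \<eta> / 2"
      then show "dist (trunc_hilbert a f x) (trunc_hilbert b f x) < \<eta>" using dist_triangle2[of "trunc_hilbert a f x" "trunc_hilbert b f x" l] by linarith
    qed
  qed
  then obtain l where "?F \<le> nhds l"
    using cauchy_filter_complete_converges[of ?F UNIV] complete_UNIV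
    by (auto simp: filtermap_bot_iff trivial_limit_at_right_real)
  then show ?thesis unfolding pv_exists_def filterlim_def by blast
qed

text \<open>The truncations are constant for small \<open>e\<close>: if \<open>x\<close> lies
  outside, the singularity never meets the interval, and if it lies inside, the part
  \<open>e < \<bar>x - t\<bar> \<le> d\<close> integrates to 0 by oddness of the kernel. At the
  endpoints of a nondegenerate interval the integral diverges logarithmically.\<close>

lemma pv_exists_interval:
  assumes x: "x \<noteq> a" "x \<noteq> (b::real)"
  shows "pv_exists (indicator {a..b}) x"
proof (cases "x \<in> {a..b}")
  case False
  define d where "d = min \<bar>x - a\<bar> \<bar>x - b\<bar>"
  have d: "0 < d" using x by (auto simp: d_def)
  have "trunc_hilbert e (indicator {a..b}) x = trunc_hilbert (d / 2) (indicator {a..b}) x" if e: "0 < e \<and> e < d" for e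
  proof -
    have "(if e < \<bar>x - t\<bar> then indicator {a..b} t / complex_of_real (x - t) else 0) = (if d / 2 < \<bar>x - t\<bar> then indicator {a..b} t / complex_of_real (x - t) else 0)" for t
    proof (cases "t \<in> {a..b}")
      case True
      then have "d \<le> \<bar>x - t\<bar>" using False unfolding d_def by auto
      then show ?thesis using e d by simp
    qed simp
    then show ?thesis unfolding trunc_hilbert_def by simp
  qed
  with eventually_at_right_0[OF d] have "\<forall>\<^sub>F e in at_right 0. trunc_hilbert e (indicator {a..b}) x = trunc_hilbert (d / 2) (indicator {a..b}) x"
    by (rule eventually_mono)
  then show ?thesis by (rule pv_exists_eventually_const)
next
  case True
  define d where "d = min \<bar>x - a\<bar> \<bar>x - b\<bar>"
  have d: "0 < d" using x by (auto simp: d_def)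
  have sl: "tempered (indicator {a..b})"
  proof (rule tempered_integrable)
    have i: "integrable lborel (indicator {a..b} :: real \<Rightarrow> real)" by (cases "a \<le> b") (auto intro!: integrable_real_indicator)
    show "integrable lborel (indicator {a..b} :: real \<Rightarrow> complex)"
      by (rule Bochner_Integration.integrable_bound[OF i]) (auto simp: indicator_def)
  qed auto
  have "trunc_hilbert e (indicator {a..b}) x = trunc_hilbert d (indicator {a..b}) x" if e: "0 < e \<and> e < d" for e
  proof -
    let ?k = "\<lambda>t. (if e < \<bar>x - t\<bar> \<and> \<bar>x - t\<bar> \<le> d then 1 / complex_of_real (x - t) else 0)"
    have ind: "indicator {a..b} t = (1::complex)" if "\<bar>x - t\<bar> \<le> d" for t
      using that True unfolding d_def indicator_def by auto
    have eq: "(if e < \<bar>x - t\<bar> then indicator {a..b} t / complex_of_real (x - t) else 0) =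
       ?k t + (if d < \<bar>x - t\<bar> then indicator {a..b} t / complex_of_real (x - t) else 0)" for t
      using e ind[of t] by auto
    have "integrable lborel (\<lambda>t. (if e < \<bar>x - t\<bar> then indicator {a..b} t / complex_of_real (x - t) else 0) - (if d < \<bar>x - t\<bar> then indicator {a..b} t / complex_of_real (x - t) else 0))"
      by (intro Bochner_Integration.integrable_diff tempered_integrable_kernel sl) (use e d in auto)
    then have ik: "integrable lborel ?k" unfolding eq by simp
    \<comment> \<open>Reflection in \<open>x\<close>, under which the kernel changes sign.\<close>
    have "(\<integral>t. ?k t \<partial>lborel) = (\<integral>t. ?k (2 * x + (-1) * t) \<partial>lborel)"
      using lborel_integral_real_affine[of "-1" ?k "2 * x"] by simp
    also have "\<dots> = (\<integral>t. - ?k t \<partial>lborel)"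
    proof (intro Bochner_Integration.integral_cong refl)
      fix t
      have a: "x - (2 * x + (-1) * t) = - (x - t)" by simp
      show "?k (2 * x + (-1) * t) = - ?k t" unfolding a abs_minus_cancel of_real_minus by (simp del: of_real_diff)
    qed
    also have "\<dots> = - (\<integral>t. ?k t \<partial>lborel)" by simp
    finally have "(\<integral>t. ?k t \<partial>lborel) = 0" by (simp add: complex_eq_iff)
    then have "(\<integral>t. (if e < \<bar>x - t\<bar> then indicator {a..b} t / complex_of_real (x - t) else 0) \<partial>lborel) =
      (\<integral>t. (if d < \<bar>x - t\<bar> then indicator {a..b} t / complex_of_real (x - t) else 0) \<partial>lborel)"
      unfolding eq using Bochner_Integration.integral_add[OF ik tempered_integrable_kernel[OF sl d, of x]] by simp
    then show ?thesis unfolding trunc_hilbert_def by simp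
  qed
  with eventually_at_right_0[OF d] have "\<forall>\<^sub>F e in at_right 0. trunc_hilbert e (indicator {a..b}) x = trunc_hilbert d (indicator {a..b}) x"
    by (rule eventually_mono)
  then show ?thesis by (rule pv_exists_eventually_const)
qed

text \<open>The local bound for the maximal function is not homogeneous; applied to \<open>real k * g\<close> for large
  \<open>k\<close> it nevertheless shows that \<open>hilbert_max g\<close> is small when \<open>g\<close> is.\<close>

lemma pv_exists_limit:
  fixes f :: "real \<Rightarrow> complex"
  assumes q: "1 < q" "q < 2"
    and [measurable]: "f \<in> borel_measurable borel" "\<And>n. fn n \<in> borel_measurable borel"
    and supp: "\<And>t. 4 < \<bar>t\<bar> \<Longrightarrow> f t = 0"
    and fin: "(\<integral>\<^sup>+t. ennreal (norm (f t) powr q) \<partial>lborel) < \<infinity>"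
    and dom: "\<And>n t. norm (fn n t) \<le> 2 * norm (f t)"
    and lim: "\<And>t. (\<lambda>n. fn n t) \<longlonglongrightarrow> f t"
    and pv: "\<And>n. AE x in lborel. \<bar>x\<bar> \<le> 2 \<longrightarrow> pv_exists (fn n) x"
  shows "AE x in lborel. \<bar>x\<bar> \<le> 2 \<longrightarrow> pv_exists f x"
proof -
  obtain C where C: "0 \<le> C"
    "\<And>f. f \<in> borel_measurable borel \<Longrightarrow> (\<And>t. 4 < \<bar>t\<bar> \<Longrightarrow> f t = 0) \<Longrightarrow> (\<integral>\<^sup>+t. ennreal (norm (f t) powr q) \<partial>lborel) < \<infinity> \<Longrightarrow>
      (\<integral>\<^sup>+x\<in>{-2..2}. hilbert_max f x \<partial>lborel) \<le> ennreal C * (1 + (\<integral>\<^sup>+t. ennreal (norm (f t) powr q) \<partial>lborel))"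
    using hilbert_max_local[OF q] by blast
  define g where "g = (\<lambda>n t. f t - fn n t)"
  have [measurable]: "g n \<in> borel_measurable borel" for n unfolding g_def by measurable
  have suppn: "fn n t = 0" if "4 < \<bar>t\<bar>" for n t using dom[of n t] supp[OF that] by simp
  have gle: "norm (g n t) \<le> 3 * norm (f t)" for n t
    unfolding g_def using norm_triangle_ineq4[of "f t" "fn n t"] dom[of n t] by linarith
  have intf: "integrable lborel f" by (rule integrable_of_powr_bounded_support[OF _ supp q(1) fin]) auto
  have slf: "tempered f" using intf by (intro tempered_integrable) auto
  have slfn: "tempered (fn n)" for n
    by (rule tempered_dominated[OF tempered_cmult[OF slf, of 2]]) (use dom in \<open>auto simp: norm_mult\<close>)
  have "(\<lambda>n. \<integral>\<^sup>+t. ennreal (norm (g n t) powr q) \<partial>lborel) \<longlonglongrightarrow> nn_integral lborel (\<lambda>t::real. 0)"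
  proof (rule nn_integral_dominated_convergence[where u' = "\<lambda>_. 0" and w = "\<lambda>t. ennreal (3 powr q) * ennreal (norm (f t) powr q)"])
    show "AE t in lborel. ennreal (norm (g n t) powr q) \<le> ennreal (3 powr q) * ennreal (norm (f t) powr q)" for n
    proof (rule AE_I2)
      fix t
      have "norm (g n t) powr q \<le> (3 * norm (f t)) powr q" using gle q by (intro powr_mono2) auto
      also have "\<dots> = 3 powr q * norm (f t) powr q" by (rule powr_mult)
      finally show "ennreal (norm (g n t) powr q) \<le> ennreal (3 powr q) * ennreal (norm (f t) powr q)"
        by (simp add: ennreal_mult[symmetric] ennreal_leI)
    qed
    show "(\<integral>\<^sup>+t. ennreal (3 powr q) * ennreal (norm (f t) powr q) \<partial>lborel) < \<infinity>"
      using fin by (subst nn_integral_cmult) (auto simp: ennreal_mult_less_top)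
    show "AE t in lborel. (\<lambda>n. ennreal (norm (g n t) powr q)) \<longlonglongrightarrow> 0"
    proof (rule AE_I2)
      fix t
      have "(\<lambda>n. norm (f t - fn n t)) \<longlonglongrightarrow> norm (f t - f t)" by (intro tendsto_intros lim)
      then have "(\<lambda>n. norm (g n t) powr q) \<longlonglongrightarrow> 0 powr q"
        using q unfolding g_def by (intro tendsto_powr') auto
      then have "(\<lambda>n. ennreal (norm (g n t) powr q)) \<longlonglongrightarrow> ennreal 0"
        using q by (intro tendsto_ennrealI) simp
      then show "(\<lambda>n. ennreal (norm (g n t) powr q)) \<longlonglongrightarrow> 0" by simp
    qed
  qed measurable
  then have g0: "(\<lambda>n. \<integral>\<^sup>+t. ennreal (norm (g n t) powr q) \<partial>lborel) \<longlonglongrightarrow> 0" by simp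
  have "\<exists>n. ennreal (real k powr q) * (\<integral>\<^sup>+t. ennreal (norm (g n t) powr q) \<partial>lborel) < 1" for k
  proof -
    have "(\<lambda>n. ennreal (real k powr q) * (\<integral>\<^sup>+t. ennreal (norm (g n t) powr q) \<partial>lborel)) \<longlonglongrightarrow> ennreal (real k powr q) * 0"
      by (rule ennreal_tendsto_cmult[OF _ g0]) simp
    then have "\<forall>\<^sub>F n in sequentially. ennreal (real k powr q) * (\<integral>\<^sup>+t. ennreal (norm (g n t) powr q) \<partial>lborel) < 1"
      by (intro order_tendstoD(2)) auto
    then show ?thesis by (auto simp: eventually_sequentially)
  qed
  then obtain N where N: "\<And>k. ennreal (real k powr q) * (\<integral>\<^sup>+t. ennreal (norm (g (N k) t) powr q) \<partial>lborel) < 1"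
    by metis
  have bnd: "ennreal (real k) * (\<integral>\<^sup>+x\<in>{-2..2}. hilbert_max (g (N k)) x \<partial>lborel) \<le> ennreal (2 * C)" for k
  proof -
    have e: "(\<integral>\<^sup>+t. ennreal (norm (of_real (real k) * g (N k) t) powr q) \<partial>lborel) = ennreal (real k powr q) * (\<integral>\<^sup>+t. ennreal (norm (g (N k) t) powr q) \<partial>lborel)"
      by (subst nn_integral_cmult[symmetric]) (auto simp: norm_mult powr_mult ennreal_mult)
    have "ennreal (real k) * (\<integral>\<^sup>+x\<in>{-2..2}. hilbert_max (g (N k)) x \<partial>lborel) = (\<integral>\<^sup>+x\<in>{-2..2}. hilbert_max (\<lambda>t. of_real (real k) * g (N k) t) x \<partial>lborel)"
      unfolding hilbert_max_cmult by (subst nn_integral_cmult[symmetric]) (auto simp: mult.assoc)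
    also have "\<dots> \<le> ennreal C * (1 + (\<integral>\<^sup>+t. ennreal (norm (of_real (real k) * g (N k) t) powr q) \<partial>lborel))"
    proof (rule C(2))
      show "of_real (real k) * g (N k) t = 0" if "4 < \<bar>t\<bar>" for t using supp[OF that] suppn[OF that] by (simp add: g_def)
      show "(\<integral>\<^sup>+t. ennreal (norm (of_real (real k) * g (N k) t) powr q) \<partial>lborel) < \<infinity>"
        unfolding e using N[of k] by (rule order_less_trans) simp
    qed measurable
    also have "\<dots> \<le> ennreal C * (1 + 1)" unfolding e using N[of k] by (intro mult_left_mono add_left_mono) auto
    also have "\<dots> = ennreal (2 * C)" using C(1) by (simp add: ennreal_mult mult.commute)
    finally show ?thesis .
  qed
  \<comment> \<open>The integral of this infimum over \<open>{-2..2}\<close> is at most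
    \<open>2 * C / k\<close> for every positive \<open>k\<close>, hence 0. Where \<open>m\<close>
    vanishes there are approximants with arbitrarily small maximal function of the error, as
    \<open>pv_exists_approx\<close> asks; convergence along the sequence is avoided.\<close>
  define m where "m = (\<lambda>x. INF k. hilbert_max (g (N k)) x)"
  have [measurable]: "m \<in> borel_measurable borel" unfolding m_def by measurable
  have "ennreal (real k) * (\<integral>\<^sup>+x\<in>{-2..2}. m x \<partial>lborel) \<le> ennreal (2 * C)" for k
  proof -
    have "(\<integral>\<^sup>+x\<in>{-2..2}. m x \<partial>lborel) \<le> (\<integral>\<^sup>+x\<in>{-2..2}. hilbert_max (g (N k)) x \<partial>lborel)"
      unfolding m_def by (intro nn_integral_mono mult_right_mono INF_lower) auto
    then show ?thesis using bnd[of k] by (meson mult_left_mono order_trans zero_le)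
  qed
  note mb = this
  have "(\<integral>\<^sup>+x\<in>{-2..2}. m x \<partial>lborel) = 0"
  proof (cases "\<integral>\<^sup>+x\<in>{-2..2}. m x \<partial>lborel")
    case (real r)
    have "real k * r \<le> 2 * C" for k
      using mb[of k] real C by (simp add: ennreal_mult[symmetric])
    then have "r \<le> 0"
      by (metis linorder_not_le reals_Archimedean3)
    then show ?thesis using real by simp
  next
    case top
    then show ?thesis using mb[of 1] by (simp add: top_unique)
  qed
  then have "AE x in lborel. m x * indicator {-2..2} x = 0"
    by (subst (asm) nn_integral_0_iff_AE) auto
  moreover have "AE x in lborel. \<forall>n. \<bar>x\<bar> \<le> 2 \<longrightarrow> pv_exists (fn n) x"
    unfolding AE_all_countable using pv by auto
  ultimately show ?thesis
  proof eventually_elim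
    case (elim x)
    show ?case
    proof
      assume x: "\<bar>x\<bar> \<le> 2"
      then have m0: "m x = 0" using elim by (auto simp: indicator_def)
      show "pv_exists f x"
      proof (rule pv_exists_approx[OF slf])
        fix \<eta> :: real assume "0 < \<eta>"
        then have "m x < ennreal \<eta>" using m0 by simp
        then obtain k where "hilbert_max (g (N k)) x < ennreal \<eta>" unfolding m_def by (auto simp: INF_less_iff)
        then show "\<exists>g. tempered g \<and> pv_exists g x \<and> hilbert_max (\<lambda>t. f t - g t) x \<le> ennreal \<eta>"
          using slfn elim x unfolding g_def by (intro exI[of _ "fn (N k)"]) auto
      qed
    qed
  qed
qed


section \<open>Borel sets and functions of bounded support\<close>

lemma nn_integral_indicator_powr_finite:
  assumes "A \<in> sets borel" "A \<subseteq> {-4..4::real}"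
  shows "(\<integral>\<^sup>+t. ennreal (norm (indicator A t :: complex) powr q) \<partial>lborel) < \<infinity>"
proof -
  have "(\<integral>\<^sup>+t. ennreal (norm (indicator A t :: complex) powr q) \<partial>lborel) \<le> (\<integral>\<^sup>+t. indicator {-4..4::real} t \<partial>lborel)"
    using assms by (intro nn_integral_mono) (auto simp: indicator_def)
  also have "\<dots> < \<infinity>" by simp
  finally show ?thesis .
qed

lemma tempered_indicator:
  assumes [measurable]: "A \<in> sets borel" and "A \<subseteq> {-4..4}"
  shows "tempered (indicator A)"
proof (rule tempered_integrable)
  have "indicator A t = (0::complex)" if "4 < \<bar>t\<bar>" for t
    using assms(2) that by (force simp: indicator_def)
  then show "integrable lborel (indicator A :: real \<Rightarrow> complex)"
    by (intro integrable_of_powr_bounded_support[of _ "3/2", OF _ _ _ nn_integral_indicator_powr_finite[OF assms]]) auto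
qed measurable

text \<open>Dynkin's lemma on the half lines \<open>{..a}\<close>, each of which meets
  \<open>{-4..4}\<close> in an interval. A countable disjoint union is the limit of its finite
  unions, to which \<open>pv_exists_limit\<close> applies; 3/2 is an arbitrary exponent between 1
  and 2, as indicators are bounded.\<close>

lemma pv_exists_indicator:
  assumes "A \<in> sets borel"
  shows "AE x in lborel. \<bar>x\<bar> \<le> 2 \<longrightarrow> pv_exists (indicator (A \<inter> {-4..4})) x"
proof -
  have "Int_stable (range (\<lambda>a::real. {..a}))"
    by (auto simp: Int_stable_def)
  moreover have "range (\<lambda>a::real. {..a}) \<subseteq> Pow UNIV" by simp
  moreover have "A \<in> sigma_sets UNIV (range (\<lambda>a::real. {..a}))"
    using assms unfolding borel_eq_atMost by simp
  ultimately show ?thesis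
  proof (induction rule: sigma_sets_induct_disjoint)
    fix A :: "real set" assume "A \<in> range (\<lambda>a. {..a})"
    then obtain a where a: "A = {..a}" by auto
    have eq: "A \<inter> {-4..4} = {-4..min a 4}" unfolding a by auto
    have "AE x in lborel. x \<noteq> (-4::real)" "AE x in lborel. x \<noteq> min a 4" by (rule AE_lborel_singleton)+
    then show "AE x in lborel. \<bar>x\<bar> \<le> 2 \<longrightarrow> pv_exists (indicator (A \<inter> {-4..4})) x"
      unfolding eq by eventually_elim (auto intro: pv_exists_interval)
  next
    show "AE x in lborel. \<bar>x\<bar> \<le> 2 \<longrightarrow> pv_exists (indicator ({} \<inter> {-4..4})) x"
    proof -
      have "indicator ({} \<inter> {-4..4}) = (\<lambda>t::real. 0::complex)" by (rule ext) simp
      then show ?thesis by (simp only: pv_exists_zero) simp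
    qed
  next
    fix A :: "real set"
    assume "A \<in> sigma_sets UNIV (range (\<lambda>a. {..a}))" and IH: "AE x in lborel. \<bar>x\<bar> \<le> 2 \<longrightarrow> pv_exists (indicator (A \<inter> {-4..4})) x"
    then have A [measurable]: "A \<in> sets borel" unfolding borel_eq_atMost by simp
    have s1: "tempered (indicator {-4..4})" by (rule tempered_indicator) auto
    have s2: "tempered (\<lambda>t. (-1) * indicator (A \<inter> {-4..4}) t)" by (intro tempered_cmult tempered_indicator) auto
    have eq: "indicator ((UNIV - A) \<inter> {-4..4}) = (\<lambda>t. indicator {-4..4} t + (-1) * (indicator (A \<inter> {-4..4}) t :: complex))"
      by (auto simp: indicator_def)
    have "AE x in lborel. x \<noteq> (-4::real)" "AE x in lborel. x \<noteq> (4::real)" by (rule AE_lborel_singleton)+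
    then show "AE x in lborel. \<bar>x\<bar> \<le> 2 \<longrightarrow> pv_exists (indicator ((UNIV - A) \<inter> {-4..4})) x"
      unfolding eq using IH
    proof eventually_elim
      case (elim x)
      then show ?case by (intro impI pv_exists_add s1 s2 pv_exists_cmult pv_exists_interval) auto
    qed
  next
    fix A :: "nat \<Rightarrow> real set"
    assume disj: "disjoint_family A" and A: "range A \<subseteq> sigma_sets UNIV (range (\<lambda>a. {..a}))"
      and IH: "\<And>i. AE x in lborel. \<bar>x\<bar> \<le> 2 \<longrightarrow> pv_exists (indicator (A i \<inter> {-4..4})) x"
    have [measurable]: "A i \<in> sets borel" for i using A unfolding borel_eq_atMost by auto
    have pu: "AE x in lborel. \<bar>x\<bar> \<le> 2 \<longrightarrow> pv_exists (indicator ((\<Union>i<n. A i) \<inter> {-4..4})) x" for n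
    proof (induction n)
      case 0
      have "indicator ((\<Union>i<0. A i) \<inter> {-4..4}) = (\<lambda>t::real. 0::complex)" by (rule ext) simp
      then show ?case by (simp only: pv_exists_zero) simp
    next
      case (Suc n)
      have eq: "indicator ((\<Union>i<Suc n. A i) \<inter> {-4..4}) = (\<lambda>t. indicator ((\<Union>i<n. A i) \<inter> {-4..4}) t + (indicator (A n \<inter> {-4..4}) t :: complex))"
      proof
        fix t
        have "t \<notin> A n" if "t \<in> A i" "i < n" for i
          using disj that unfolding disjoint_family_on_def by (metis IntI UNIV_I empty_iff less_irrefl)
        then show "indicator ((\<Union>i<Suc n. A i) \<inter> {-4..4}) t = indicator ((\<Union>i<n. A i) \<inter> {-4..4}) t + (indicator (A n \<inter> {-4..4}) t :: complex)"
          by (auto simp: indicator_def less_Suc_eq)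
      qed
      have s1: "tempered (indicator ((\<Union>i<n. A i) \<inter> {-4..4}))" by (rule tempered_indicator) auto
      have s2: "tempered (indicator (A n \<inter> {-4..4}))" by (rule tempered_indicator) auto
      show ?case unfolding eq using Suc IH[of n]
        by eventually_elim (auto intro!: pv_exists_add s1 s2)
    qed
    show "AE x in lborel. \<bar>x\<bar> \<le> 2 \<longrightarrow> pv_exists (indicator (\<Union> (range A) \<inter> {-4..4})) x"
    proof (rule pv_exists_limit[where q = "3/2" and fn = "\<lambda>n. indicator ((\<Union>i<n. A i) \<inter> {-4..4})"])
      show "(\<integral>\<^sup>+t. ennreal (norm (indicator (\<Union> (range A) \<inter> {-4..4}) t :: complex) powr (3/2)) \<partial>lborel) < \<infinity>"
        by (rule nn_integral_indicator_powr_finite) auto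
      show "(\<lambda>n. indicator ((\<Union>i<n. A i) \<inter> {-4..4}) t :: complex) \<longlonglongrightarrow> indicator (\<Union> (range A) \<inter> {-4..4}) t" for t
      proof (cases "t \<in> \<Union> (range A)")
        case True
        then obtain i where i: "t \<in> A i" by auto
        have "\<forall>\<^sub>F n in sequentially. indicator ((\<Union>i<n. A i) \<inter> {-4..4}) t = (indicator (\<Union> (range A) \<inter> {-4..4}) t :: complex)"
          using eventually_gt_at_top[of i] by eventually_elim (use i in \<open>auto simp: indicator_def\<close>)
        then show ?thesis by (rule tendsto_eventually)
      qed (auto simp: indicator_def)
      show "norm (indicator ((\<Union>i<n. A i) \<inter> {-4..4}) t :: complex) \<le> 2 * norm (indicator (\<Union> (range A) \<inter> {-4..4}) t :: complex)" for n t
        by (auto simp: indicator_def)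
    qed (use pu in \<open>auto simp: indicator_def\<close>)
  qed
qed

text \<open>Simple functions converge to \<open>f\<close> with
  \<open>norm (s i x) \<le> 2 * norm (f x)\<close>, the source of the factor 2 in
  \<open>pv_exists_limit\<close>. They are finite combinations of indicators of level sets, which
  may be cut off to \<open>{-4..4}\<close> because nonzero values occur only there.\<close>

lemma pv_exists_local:
  fixes f :: "real \<Rightarrow> complex"
  assumes q: "1 < q" "q < 2"
    and [measurable]: "f \<in> borel_measurable borel"
    and supp: "\<And>t. 4 < \<bar>t\<bar> \<Longrightarrow> f t = 0"
    and fin: "(\<integral>\<^sup>+t. ennreal (norm (f t) powr q) \<partial>lborel) < \<infinity>"
  shows "AE x in lborel. \<bar>x\<bar> \<le> 2 \<longrightarrow> pv_exists f x"
proof -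
  have "f \<in> borel_measurable lborel" by simp
  from borel_measurable_implies_sequence_metric[OF this, of 0]
  obtain s where s: "\<And>i. simple_function lborel (s i)" "\<And>x. (\<lambda>i. s i x) \<longlonglongrightarrow> f x"
    "\<And>i x. norm (s i x) \<le> 2 * norm (f x)"
    by (auto simp: dist_norm)
  have sm: "s i \<in> borel_measurable borel" for i
    using borel_measurable_simple_function[OF s(1)[of i]] by simp
  show ?thesis
  proof (rule pv_exists_limit[OF q _ sm supp fin s(3) s(2)])
    fix n
    have fr: "finite (range (s n))" using s(1)[of n] by (simp add: simple_function_def)
    have vm: "s n -` {y} \<in> sets borel" for y using measurable_sets[OF sm[of n], of "{y}"] by simp
    have ssupp: "s n t = 0" if "4 < \<bar>t\<bar>" for t using s(3)[of n t] supp[OF that] by simp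
    have eq: "s n = (\<lambda>t. \<Sum>y\<in>range (s n). y * indicator (s n -` {y} \<inter> {-4..4}) t)"
    proof
      fix t
      have "(\<Sum>y\<in>range (s n). y * indicator (s n -` {y} \<inter> {-4..4}) t) = (\<Sum>y\<in>range (s n). if y = s n t then y else 0)"
      proof (intro sum.cong refl)
        fix y
        have "t \<in> {-4..4} \<or> s n t = 0" using ssupp[of t] by force
        then show "y * indicator (s n -` {y} \<inter> {-4..4}) t = (if y = s n t then y else 0)"
          by (auto simp: indicator_def)
      qed
      also have "\<dots> = s n t" using fr by (subst sum.delta) auto
      finally show "s n t = (\<Sum>y\<in>range (s n). y * indicator (s n -` {y} \<inter> {-4..4}) t)" by simp
    qed
    have "tempered (\<lambda>t. \<Sum>y\<in>Y. y * indicator (s n -` {y} \<inter> {-4..4}) t) \<and>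
      (AE x in lborel. \<bar>x\<bar> \<le> 2 \<longrightarrow> pv_exists (\<lambda>t. \<Sum>y\<in>Y. y * indicator (s n -` {y} \<inter> {-4..4}) t) x)" if "finite Y" for Y
      using that
    proof (induction Y rule: finite_induct)
      case empty
      show ?case by (simp add: tempered_def pv_exists_zero)
    next
      case (insert y Y)
      have s1: "tempered (\<lambda>t. y * indicator (s n -` {y} \<inter> {-4..4}) t)"
        using vm by (intro tempered_cmult tempered_indicator) auto
      have pv1: "AE x in lborel. \<bar>x\<bar> \<le> 2 \<longrightarrow> pv_exists (\<lambda>t. y * indicator (s n -` {y} \<inter> {-4..4}) t) x"
        using pv_exists_indicator[OF vm[of y]] by eventually_elim (auto intro: pv_exists_cmult)
      have sl: "tempered (\<lambda>t. y * indicator (s n -` {y} \<inter> {-4..4}) t + (\<Sum>y\<in>Y. y * indicator (s n -` {y} \<inter> {-4..4}) t))"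
        using insert s1 by (intro tempered_add) auto
      have "AE x in lborel. \<bar>x\<bar> \<le> 2 \<longrightarrow> pv_exists (\<lambda>t. \<Sum>y\<in>Y. y * indicator (s n -` {y} \<inter> {-4..4}) t) x"
        using insert by simp
      then have "AE x in lborel. \<bar>x\<bar> \<le> 2 \<longrightarrow> pv_exists (\<lambda>t. y * indicator (s n -` {y} \<inter> {-4..4}) t + (\<Sum>y\<in>Y. y * indicator (s n -` {y} \<inter> {-4..4}) t)) x"
        using pv1
      proof eventually_elim
        case (elim x)
        then show ?case using pv_exists_add[OF s1] insert.IH by blast
      qed
      then show ?case using sl unfolding sum.insert[OF insert(1,2)] by blast
    qed
    then show "AE x in lborel. \<bar>x\<bar> \<le> 2 \<longrightarrow> pv_exists (s n) x"
      using fr by (subst eq) blast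
  qed simp
qed

section \<open>Power weights\<close>

text \<open>The p-th power of the weighted norm, taken against \<open>lborel\<close> and with values
  in \<open>ennreal\<close>, so that membership in the space becomes finiteness.\<close>

definition weighted_integral :: "real \<Rightarrow> real \<Rightarrow> (real \<Rightarrow> complex) \<Rightarrow> ennreal" where
  "weighted_integral p \<alpha> h = (\<integral>\<^sup>+u. ennreal (norm (h u) powr p * \<bar>u\<bar> powr \<alpha>) \<partial>lborel)"

text \<open>Both restrictions on the weight enter here: after raising to the conjugate exponent,
  integrability at 0 amounts to \<open>\<alpha> < p - 1\<close> and integrability at infinity to
  \<open>-1 < \<alpha>\<close>.\<close>

lemma nn_integral_conjugate_weight_finite:
  assumes p: "1 < p" and \<alpha>: "-1 < \<alpha>" "\<alpha> < p - 1"
  shows "(\<integral>\<^sup>+u. ennreal ((\<bar>u\<bar> powr (- \<alpha> / p) / (1 + \<bar>u\<bar>)) powr (p / (p - 1))) \<partial>lborel) < \<infinity>"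
proof -
  define r where "r = p / (p - 1)"
  have r: "0 < r" unfolding r_def using p by simp
  have e1: "- \<alpha> / p * r = - \<alpha> / (p - 1)" unfolding r_def using p by simp
  have "(\<integral>\<^sup>+u. ennreal ((\<bar>u\<bar> powr (- \<alpha> / p) / (1 + \<bar>u\<bar>)) powr r) \<partial>lborel)
    \<le> (\<integral>\<^sup>+u. ennreal (\<bar>u\<bar> powr (- \<alpha> / (p - 1)) * indicator {..1} \<bar>u\<bar>) + ennreal (\<bar>u\<bar> powr (- \<alpha> / (p - 1) - r) * indicator {1..} \<bar>u\<bar>) \<partial>lborel)"
  proof (rule nn_integral_mono)
    fix u :: real
    have a: "(\<bar>u\<bar> powr (- \<alpha> / p)) powr r = \<bar>u\<bar> powr (- \<alpha> / (p - 1))" by (simp only: powr_powr e1)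
    show "ennreal ((\<bar>u\<bar> powr (- \<alpha> / p) / (1 + \<bar>u\<bar>)) powr r) \<le>
      ennreal (\<bar>u\<bar> powr (- \<alpha> / (p - 1)) * indicator {..1} \<bar>u\<bar>) + ennreal (\<bar>u\<bar> powr (- \<alpha> / (p - 1) - r) * indicator {1..} \<bar>u\<bar>)"
    proof (cases "\<bar>u\<bar> \<le> 1")
      case True
      have "(\<bar>u\<bar> powr (- \<alpha> / p) / (1 + \<bar>u\<bar>)) powr r \<le> (\<bar>u\<bar> powr (- \<alpha> / p)) powr r"
        using r by (intro powr_mono2) (auto simp: divide_le_eq mult_left_mono intro: order_trans[OF _ mult_left_mono[of 1]])
      then show ?thesis unfolding a using True by (intro add_increasing2) (auto intro: ennreal_leI)
    next
      case False
      have "(\<bar>u\<bar> powr (- \<alpha> / p) / (1 + \<bar>u\<bar>)) powr r \<le> (\<bar>u\<bar> powr (- \<alpha> / p) / \<bar>u\<bar>) powr r"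
        using r False by (intro powr_mono2 divide_left_mono mult_pos_pos) auto
      also have "\<dots> = \<bar>u\<bar> powr (- \<alpha> / (p - 1) - r)"
        using False a by (subst powr_divide) (auto simp: powr_diff)
      finally show ?thesis using False by (intro add_increasing) (auto intro: ennreal_leI)
    qed
  qed
  also have "\<dots> = (\<integral>\<^sup>+u. ennreal (\<bar>u\<bar> powr (- \<alpha> / (p - 1)) * indicator {..1} \<bar>u\<bar>) \<partial>lborel) + (\<integral>\<^sup>+u. ennreal (\<bar>u\<bar> powr (- \<alpha> / (p - 1) - r) * indicator {1..} \<bar>u\<bar>) \<partial>lborel)"
    by (rule nn_integral_add) auto
  also have "\<dots> < \<infinity>"
  proof -
    have "-1 < - \<alpha> / (p - 1)" using p \<alpha> by (simp add: field_simps)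
    moreover have "- \<alpha> / (p - 1) - r < -1"
    proof -
      have "- \<alpha> / (p - 1) - r = (- \<alpha> - p) / (p - 1)" unfolding r_def by (simp add: diff_divide_distrib)
      also have "\<dots> < -1" using p \<alpha> by (simp add: field_simps)
      finally show ?thesis .
    qed
    ultimately show ?thesis
      using nn_integral_powr_head_finite[of 1 "- \<alpha> / (p - 1)"] nn_integral_powr_tail_finite[of 1 "- \<alpha> / (p - 1) - r"]
      by (simp add: ennreal_add_less_top)
  qed
  finally show ?thesis unfolding r_def .
qed

text \<open>Hoelder's inequality in the additive form given by Young's:
  \<open>\<bar>u\<bar> powr (\<alpha> / p)\<close> goes to \<open>h\<close> and its inverse to the
  conjugate factor. The lack of homogeneity is harmless, since the bound serves either for mere
  finiteness or after a normalization of scale.\<close>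

lemma weighted_tempered:
  assumes p: "1 < p" and \<alpha>: "-1 < \<alpha>" "\<alpha> < p - 1"
  obtains C where "0 \<le> C"
    "\<And>h. h \<in> borel_measurable borel \<Longrightarrow> (\<integral>\<^sup>+u. ennreal (norm (h u) / (1 + \<bar>u\<bar>)) \<partial>lborel) \<le> weighted_integral p \<alpha> h + ennreal C"
proof -
  let ?k = "\<lambda>u. \<bar>u\<bar> powr (- \<alpha> / p) / (1 + \<bar>u\<bar>)"
  have "(\<integral>\<^sup>+u. ennreal (?k u powr (p / (p - 1))) \<partial>lborel) < \<infinity>"
    by (rule nn_integral_conjugate_weight_finite[OF p \<alpha>])
  then obtain C where C: "0 \<le> C" "(\<integral>\<^sup>+u. ennreal (?k u powr (p / (p - 1))) \<partial>lborel) = ennreal C"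
    by (cases "\<integral>\<^sup>+u. ennreal (?k u powr (p / (p - 1))) \<partial>lborel") auto
  show ?thesis
  proof (rule that[OF C(1)])
    fix h :: "real \<Rightarrow> complex" assume [measurable]: "h \<in> borel_measurable borel"
    have "(\<integral>\<^sup>+u. ennreal (norm (h u) / (1 + \<bar>u\<bar>)) \<partial>lborel) \<le> (\<integral>\<^sup>+u. ennreal (norm (h u) powr p * \<bar>u\<bar> powr \<alpha>) + ennreal (?k u powr (p / (p - 1))) \<partial>lborel)"
    proof (rule nn_integral_mono_AE)
      have "AE u in lborel. u \<noteq> (0::real)" by (rule AE_lborel_singleton)
      then show "AE u in lborel. ennreal (norm (h u) / (1 + \<bar>u\<bar>)) \<le> ennreal (norm (h u) powr p * \<bar>u\<bar> powr \<alpha>) + ennreal (?k u powr (p / (p - 1)))"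
      proof eventually_elim
        case (elim u)
        let ?a = "norm (h u) * \<bar>u\<bar> powr (\<alpha> / p)"
        have "\<bar>u\<bar> powr (\<alpha> / p) * \<bar>u\<bar> powr (- \<alpha> / p) = 1"
          using elim by (simp add: powr_add[symmetric])
        then have "norm (h u) / (1 + \<bar>u\<bar>) = ?a * ?k u" by (simp add: mult.assoc)
        also have "\<dots> \<le> ?a powr p / p + ?k u powr (p / (p - 1)) / (p / (p - 1))"
          by (rule Youngs_inequality) (use p in \<open>auto simp: field_simps\<close>)
        also have "\<dots> \<le> ?a powr p / 1 + ?k u powr (p / (p - 1)) / 1"
          using p by (intro add_mono divide_left_mono) auto
        also have "?a powr p = norm (h u) powr p * \<bar>u\<bar> powr \<alpha>"
          using p by (subst powr_mult) (auto simp: powr_powr)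
        finally show ?case by (simp add: ennreal_plus[symmetric] ennreal_leI del: ennreal_plus)
      qed
    qed
    also have "\<dots> = weighted_integral p \<alpha> h + ennreal C"
      unfolding weighted_integral_def C(2)[symmetric] by (rule nn_integral_add) auto
    finally show "(\<integral>\<^sup>+u. ennreal (norm (h u) / (1 + \<bar>u\<bar>)) \<partial>lborel) \<le> weighted_integral p \<alpha> h + ennreal C" .
  qed
qed

lemma weighted_integral_imp_tempered:
  assumes p: "1 < p" and \<alpha>: "-1 < \<alpha>" "\<alpha> < p - 1"
    and h: "h \<in> borel_measurable borel" and fin: "weighted_integral p \<alpha> h < \<infinity>"
  shows "tempered h"
proof -
  note [measurable] = h
  obtain C where C: "0 \<le> C"
    "\<And>h. h \<in> borel_measurable borel \<Longrightarrow> (\<integral>\<^sup>+u. ennreal (norm (h u) / (1 + \<bar>u\<bar>)) \<partial>lborel) \<le> weighted_integral p \<alpha> h + ennreal C"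
    using weighted_tempered[OF p \<alpha>] by blast
  have "(\<integral>\<^sup>+u. ennreal (norm (h u) / (1 + \<bar>u\<bar>)) \<partial>lborel) < \<infinity>"
    using C(2)[OF h] fin by (auto intro!: le_less_trans[OF C(2)[OF h]] simp: ennreal_add_less_top)
  then show ?thesis unfolding tempered_def using h by (auto intro!: integrableI_nonneg)
qed

text \<open>On the annulus the weight is at least the smaller of its endpoint values, and
  \<open>norm (h u) powr q \<le> 1 + norm (h u) powr p\<close>. The 8 is the length of
  \<open>{-4..4}\<close>.\<close>

lemma weighted_integral_annulus:
  assumes q: "1 < q" "q \<le> p"
  obtains C where "0 \<le> C"
    "\<And>h. h \<in> borel_measurable borel \<Longrightarrow>
      (\<integral>\<^sup>+u. ennreal (norm (h u * indicator {1/2..4} \<bar>u\<bar>) powr q) \<partial>lborel) \<le> ennreal C * (1 + weighted_integral p \<alpha> h)"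
proof -
  define c where "c = min ((1/2) powr \<alpha>) (4 powr \<alpha>)"
  have c: "0 < c" by (simp add: c_def)
  have wc: "c \<le> \<bar>u\<bar> powr \<alpha>" if "\<bar>u\<bar> \<in> {1/2..4}" for u :: real
  proof (cases "0 \<le> \<alpha>")
    case True
    then have "(1/2) powr \<alpha> \<le> \<bar>u\<bar> powr \<alpha>" using that by (intro powr_mono2) auto
    then show ?thesis by (simp add: c_def)
  next
    case False
    then have "4 powr \<alpha> \<le> \<bar>u\<bar> powr \<alpha>" using that by (intro powr_mono2') auto
    then show ?thesis by (simp add: c_def)
  qed
  show ?thesis
  proof (rule that[of "8 + 1 / c"])
    show "0 \<le> 8 + 1 / c" using c by simp
    fix h :: "real \<Rightarrow> complex" assume [measurable]: "h \<in> borel_measurable borel"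
    have "(\<integral>\<^sup>+u. ennreal (norm (h u * indicator {1/2..4} \<bar>u\<bar>) powr q) \<partial>lborel)
      \<le> (\<integral>\<^sup>+u. indicator {-4..4} u + ennreal (1 / c) * ennreal (norm (h u) powr p * \<bar>u\<bar> powr \<alpha>) \<partial>lborel)"
    proof (rule nn_integral_mono)
      fix u :: real
      show "ennreal (norm (h u * indicator {1/2..4} \<bar>u\<bar>) powr q) \<le> indicator {-4..4} u + ennreal (1 / c) * ennreal (norm (h u) powr p * \<bar>u\<bar> powr \<alpha>)"
      proof (cases "\<bar>u\<bar> \<in> {1/2..4}")
        case True
        have "norm (h u) powr q \<le> 1 + norm (h u) powr p"
        proof (cases "norm (h u) \<le> 1")
          case True
          then have "norm (h u) powr q \<le> 1 powr q" using q by (intro powr_mono2) auto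
          then show ?thesis by (simp add: add_increasing2)
        next
          case False
          then have "norm (h u) powr q \<le> norm (h u) powr p" using q by (intro powr_mono) auto
          then show ?thesis by simp
        qed
        also have "\<dots> \<le> 1 + (1 / c) * (norm (h u) powr p * \<bar>u\<bar> powr \<alpha>)"
          using mult_left_mono[OF wc[OF True], of "norm (h u) powr p"] c by (simp add: field_simps)
        finally have "ennreal (norm (h u) powr q) \<le> ennreal 1 + ennreal (1 / c) * ennreal (norm (h u) powr p * \<bar>u\<bar> powr \<alpha>)"
          using c by (simp add: ennreal_mult[symmetric] ennreal_plus[symmetric] ennreal_leI del: ennreal_plus ennreal_1)
        then show ?thesis using True by (auto simp: indicator_def abs_le_iff)
      qed (use q in auto)
    qed
    also have "\<dots> = 8 * 1 + ennreal (1 / c) * weighted_integral p \<alpha> h"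
      unfolding weighted_integral_def by (subst nn_integral_add) (auto simp: nn_integral_cmult)
    also have "\<dots> \<le> ennreal (8 + 1 / c) * 1 + ennreal (8 + 1 / c) * weighted_integral p \<alpha> h"
      using c by (intro add_mono mult_right_mono ennreal_leI) (auto simp flip: ennreal_numeral intro: ennreal_leI)
    finally show "(\<integral>\<^sup>+u. ennreal (norm (h u * indicator {1/2..4} \<bar>u\<bar>) powr q) \<partial>lborel) \<le> ennreal (8 + 1 / c) * (1 + weighted_integral p \<alpha> h)"
      by (simp only: distrib_left)
  qed
qed

text \<open>Near the diagonal the weight is comparable to a constant, and away from it the kernel is
  comparable to \<open>1 / (1 + \<bar>u\<bar>)\<close>, so the unweighted estimates apply on one annulus.\<close>

lemma hilbert_max_annulus:
  assumes p: "1 < p" and \<alpha>: "-1 < \<alpha>" "\<alpha> < p - 1"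
  shows "\<exists>C\<ge>0. \<forall>h\<in>borel_measurable borel. weighted_integral p \<alpha> h < \<infinity> \<longrightarrow>
      (\<integral>\<^sup>+x. hilbert_max h x * indicator {1..2} \<bar>x\<bar> \<partial>lborel) \<le> ennreal C * (1 + weighted_integral p \<alpha> h) \<and>
      (AE x in lborel. \<bar>x\<bar> \<in> {1..2} \<longrightarrow> pv_exists h x)"
proof -
  \<comment> \<open>The local estimates need an exponent strictly between 1 and 2; it must not
    exceed \<open>p\<close> to be controlled by the weighted p-th power.\<close>
  define q where "q = min p (3/2)"
  have q: "1 < q" "q < 2" "q \<le> p" using p by (auto simp: q_def)
  obtain C0 where C0: "0 \<le> C0"
    "\<And>h. h \<in> borel_measurable borel \<Longrightarrow> (\<integral>\<^sup>+u. ennreal (norm (h u) / (1 + \<bar>u\<bar>)) \<partial>lborel) \<le> weighted_integral p \<alpha> h + ennreal C0"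
    using weighted_tempered[OF p \<alpha>] by blast
  obtain C1 where C1: "0 \<le> C1"
    "\<And>h. h \<in> borel_measurable borel \<Longrightarrow>
      (\<integral>\<^sup>+u. ennreal (norm (h u * indicator {1/2..4} \<bar>u\<bar>) powr q) \<partial>lborel) \<le> ennreal C1 * (1 + weighted_integral p \<alpha> h)"
    using weighted_integral_annulus[OF q(1,3)] by blast
  obtain C2 where C2: "0 \<le> C2"
    "\<And>f. f \<in> borel_measurable borel \<Longrightarrow> (\<And>t. 4 < \<bar>t\<bar> \<Longrightarrow> f t = 0) \<Longrightarrow> (\<integral>\<^sup>+t. ennreal (norm (f t) powr q) \<partial>lborel) < \<infinity> \<Longrightarrow>
      (\<integral>\<^sup>+x\<in>{-2..2}. hilbert_max f x \<partial>lborel) \<le> ennreal C2 * (1 + (\<integral>\<^sup>+t. ennreal (norm (f t) powr q) \<partial>lborel))"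
    using hilbert_max_local[OF q(1,2)] by blast
  have main: "(\<integral>\<^sup>+x. hilbert_max h x * indicator {1..2} \<bar>x\<bar> \<partial>lborel) \<le> ennreal (C2 * (1 + C1) + 4 * (1 + C0)) * (1 + weighted_integral p \<alpha> h)
      \<and> (AE x in lborel. \<bar>x\<bar> \<in> {1..2} \<longrightarrow> pv_exists h x)"
    if h [measurable]: "h \<in> borel_measurable borel" and fin: "weighted_integral p \<alpha> h < \<infinity>" for h
  proof -
    let ?W = "weighted_integral p \<alpha> h"
    define h1 where "h1 = (\<lambda>u. h u * indicator {1/2..4} \<bar>u\<bar>)"
    define h2 where "h2 = (\<lambda>u. h u - h1 u)"
    have [measurable]: "h1 \<in> borel_measurable borel" "h2 \<in> borel_measurable borel"
      unfolding h1_def h2_def by measurable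
    have sl: "tempered h" by (rule weighted_integral_imp_tempered[OF p \<alpha> h fin])
    have sl1: "tempered h1" by (rule tempered_dominated[OF sl]) (auto simp: h1_def indicator_def)
    have sl2: "tempered h2" unfolding h2_def by (rule tempered_diff[OF sl sl1])
    have heq: "h = (\<lambda>u. h1 u + h2 u)" by (simp add: h2_def)
    have fin1: "(\<integral>\<^sup>+t. ennreal (norm (h1 t) powr q) \<partial>lborel) \<le> ennreal C1 * (1 + ?W)"
      unfolding h1_def by (rule C1(2)) simp
    also have fin1': "\<dots> < \<infinity>" using fin by (simp add: ennreal_mult_less_top ennreal_add_less_top)
    finally have fin1'': "(\<integral>\<^sup>+t. ennreal (norm (h1 t) powr q) \<partial>lborel) < \<infinity>" .
    have supp1: "h1 t = 0" if "4 < \<bar>t\<bar>" for t using that by (simp add: h1_def)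
    \<comment> \<open>The support of \<open>h2\<close> keeps a distance of at least 1/2 from the
      annulus of \<open>x\<close>. The factor 3 is small enough to be absorbed later by the
      \<open>1 / pi\<close> of the transform.\<close>
    have supp2: "1 + \<bar>u\<bar> \<le> 3 * \<bar>x - u\<bar> \<and> 1 / 4 < \<bar>x - u\<bar>" if "h2 u \<noteq> 0" "\<bar>x\<bar> \<in> {1..2}" for u x
    proof -
      have "\<bar>u\<bar> < 1/2 \<or> 4 < \<bar>u\<bar>" using that by (auto simp: h2_def h1_def indicator_def split: if_splits)
      moreover have "\<bar>x\<bar> - \<bar>u\<bar> \<le> \<bar>x - u\<bar>" "\<bar>u\<bar> - \<bar>x\<bar> \<le> \<bar>x - u\<bar>" by linarith+
      ultimately show ?thesis using that(2) by auto
    qed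
    let ?J = "\<integral>u. norm (h u) / (1 + \<bar>u\<bar>) \<partial>lborel"
    have far: "norm (trunc_hilbert e h2 x) \<le> ?J" if e: "0 < e" and x: "\<bar>x\<bar> \<in> {1..2}" for e x
    proof -
      have "norm (\<integral>t. (if e < \<bar>x - t\<bar> then h2 t / of_real (x - t) else 0) \<partial>lborel) \<le> (\<integral>t. 3 * (norm (h t) / (1 + \<bar>t\<bar>)) \<partial>lborel)"
      proof (rule Bochner_Integration.integral_norm_bound_integral)
        show "integrable lborel (\<lambda>t. if e < \<bar>x - t\<bar> then h2 t / of_real (x - t) else 0)"
          by (rule tempered_integrable_kernel[OF sl2 e])
        show "integrable lborel (\<lambda>t. 3 * (norm (h t) / (1 + \<bar>t\<bar>)))"
          using sl by (intro integrable_mult_right) (simp add: tempered_def)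
        fix t
        show "norm (if e < \<bar>x - t\<bar> then h2 t / of_real (x - t) else 0) \<le> 3 * (norm (h t) / (1 + \<bar>t\<bar>))"
        proof (cases "h2 t = 0")
          case False
          have le: "norm (h2 t) \<le> norm (h t)" by (auto simp: h2_def h1_def indicator_def)
          have "norm (h2 t) / \<bar>x - t\<bar> \<le> norm (h t) / ((1 + \<bar>t\<bar>) / 3)"
            using supp2[OF False x] le by (intro frac_le) auto
          then show ?thesis by (simp add: norm_divide mult.commute flip: of_real_diff)
        qed simp
      qed
      also have "\<dots> = 3 * ?J" by (simp only: integral_mult_right_zero)
      finally have "1 / pi * norm (\<integral>t. (if e < \<bar>x - t\<bar> then h2 t / of_real (x - t) else 0) \<partial>lborel) \<le> 1 / pi * (3 * ?J)"
        by (rule mult_left_mono) simp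
      also have "\<dots> = 3 / pi * ?J" by simp
      also have "\<dots> \<le> 1 * ?J" using pi_gt3 by (intro mult_right_mono) auto
      finally show ?thesis by (simp add: trunc_hilbert_def norm_mult norm_divide)
    qed
    have J: "ennreal ?J \<le> ?W + ennreal C0"
    proof -
      have "ennreal ?J = (\<integral>\<^sup>+u. ennreal (norm (h u) / (1 + \<bar>u\<bar>)) \<partial>lborel)"
        using sl by (intro nn_integral_eq_integral[symmetric]) (auto simp: tempered_def)
      then show ?thesis using C0(2)[OF h] by simp
    qed
    have "(\<integral>\<^sup>+x. hilbert_max h x * indicator {1..2} \<bar>x\<bar> \<partial>lborel) \<le> (\<integral>\<^sup>+x. hilbert_max h1 x * indicator {-2..2} x + ennreal ?J * indicator {-2..2} x \<partial>lborel)"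
    proof (rule nn_integral_mono)
      fix x
      show "hilbert_max h x * indicator {1..2} \<bar>x\<bar> \<le> hilbert_max h1 x * indicator {-2..2} x + ennreal ?J * indicator {-2..2} x"
      proof (cases "\<bar>x\<bar> \<in> {1..2}")
        case True
        have "hilbert_max h x \<le> hilbert_max h1 x + hilbert_max h2 x"
          by (subst heq) (rule hilbert_max_add[OF sl1 sl2])
        also have "hilbert_max h2 x \<le> ennreal ?J"
          unfolding hilbert_max_def by (rule SUP_least) (use far True in \<open>auto intro!: ennreal_leI\<close>)
        finally have "hilbert_max h x \<le> hilbert_max h1 x + ennreal ?J" by (simp add: add_left_mono)
        then show ?thesis using True by (auto simp: indicator_def abs_le_iff)
      qed simp
    qed
    also have "\<dots> = (\<integral>\<^sup>+x\<in>{-2..2}. hilbert_max h1 x \<partial>lborel) + ennreal ?J * 4"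
      by (subst nn_integral_add) (auto simp: nn_integral_cmult_indicator)
    also have "\<dots> \<le> ennreal C2 * (1 + ennreal C1 * (1 + ?W)) + (?W + ennreal C0) * 4"
    proof (intro add_mono mult_right_mono J)
      have "(\<integral>\<^sup>+x\<in>{-2..2}. hilbert_max h1 x \<partial>lborel) \<le> ennreal C2 * (1 + (\<integral>\<^sup>+t. ennreal (norm (h1 t) powr q) \<partial>lborel))"
        by (rule C2(2)) (use supp1 fin1'' in auto)
      also have "\<dots> \<le> ennreal C2 * (1 + ennreal C1 * (1 + ?W))" by (intro mult_left_mono add_left_mono fin1) auto
      finally show "(\<integral>\<^sup>+x\<in>{-2..2}. hilbert_max h1 x \<partial>lborel) \<le> ennreal C2 * (1 + ennreal C1 * (1 + ?W))" .
    qed auto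
    also have "\<dots> \<le> ennreal C2 * ((1 + ?W) + ennreal C1 * (1 + ?W)) + ((1 + ?W) + ennreal C0 * (1 + ?W)) * 4"
    proof (intro add_mono mult_left_mono mult_right_mono)
      show "1 \<le> 1 + ?W" by simp
      show "?W \<le> 1 + ?W" by (rule add_increasing) auto
      have "ennreal C0 * 1 \<le> ennreal C0 * (1 + ?W)" by (intro mult_left_mono) auto
      then show "ennreal C0 \<le> ennreal C0 * (1 + ?W)" by simp
    qed auto
    also have "\<dots> = ennreal (C2 * (1 + C1) + 4 * (1 + C0)) * (1 + ?W)"
    proof -
      have "ennreal (C2 * (1 + C1) + 4 * (1 + C0)) = ennreal C2 * (1 + ennreal C1) + 4 * (1 + ennreal C0)"
        using C0 C1 C2 by (simp add: ennreal_mult)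
      then show ?thesis by (simp add: distrib_left distrib_right mult_ac)
    qed
    finally have b: "(\<integral>\<^sup>+x. hilbert_max h x * indicator {1..2} \<bar>x\<bar> \<partial>lborel) \<le> ennreal (C2 * (1 + C1) + 4 * (1 + C0)) * (1 + ?W)" .
    have pv2: "pv_exists h2 x" if x: "\<bar>x\<bar> \<in> {1..2}" for x
    proof (rule pv_exists_eventually_const)
      have "trunc_hilbert e h2 x = trunc_hilbert (1/4) h2 x" if "0 < e \<and> e < 1/4" for e
      proof -
        have "(if e < \<bar>x - t\<bar> then h2 t / of_real (x - t) else 0) = (if 1/4 < \<bar>x - t\<bar> then h2 t / of_real (x - t) else 0)" for t
          using supp2[of t x] x that by (cases "h2 t = 0") auto
        then show ?thesis unfolding trunc_hilbert_def by simp
      qed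
      then show "\<forall>\<^sub>F e in at_right 0. trunc_hilbert e h2 x = trunc_hilbert (1/4) h2 x"
        using eventually_at_right_0[of "1/4"] by (auto elim: eventually_mono)
    qed
    have "AE x in lborel. \<bar>x\<bar> \<le> 2 \<longrightarrow> pv_exists h1 x"
      by (rule pv_exists_local[OF q(1,2) _ supp1 fin1'']) auto
    then have "AE x in lborel. \<bar>x\<bar> \<in> {1..2} \<longrightarrow> pv_exists h x"
    proof eventually_elim
      case (elim x)
      then show ?case by (subst heq) (auto intro!: pv_exists_add sl1 sl2 pv2)
    qed
    with b show ?thesis by blast
  qed
  show ?thesis
    by (rule exI[of _ "C2 * (1 + C1) + 4 * (1 + C0)"]) (use main C0(1) C1(1) C2(1) in simp)
qed

section \<open>Dilations\<close>

lemma AE_lborel_affine: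
  assumes "AE x in lborel. P x" "(c::real) \<noteq> 0"
  shows "AE x in lborel. P (t + c * x)"
proof -
  obtain N where N: "N \<in> null_sets lborel" "{x \<in> space lborel. \<not> P x} \<subseteq> N"
    using assms(1) by (auto elim!: AE_E simp: null_sets_def)
  have "AE x in lborel. x \<notin> N" using N(1) by (rule AE_not_in)
  then have "AE x in lborel. t + c * x \<notin> N"
    using N(1) assms(2) by (intro AE_borel_affine) (auto simp: null_sets_def)
  then show ?thesis using N(2) by (auto elim!: eventually_mono)
qed

text \<open>The exceptional \<open>t\<close> form the image of a null set under
  \<open>u \<mapsto> x / u\<close>, which is differentiable away from 0 and so maps null sets to
  null sets. That fact concerns Lebesgue null sets; the completion leads back to
  \<open>lborel\<close>.\<close>

lemma AE_lborel_inversion: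
  assumes "AE x in lborel. P x" "x \<noteq> (0::real)"
  shows "AE t in lborel. 0 < t \<longrightarrow> P (x / t)"
proof -
  obtain N where N: "N \<in> null_sets lborel" "{x \<in> space lborel. \<not> P x} \<subseteq> N"
    using assms(1) by (auto elim!: AE_E simp: null_sets_def)
  have "negligible N"
    unfolding negligible_iff_null_sets using N(1) by (rule null_sets_completionI)
  then have "negligible (N - {0})" by (rule negligible_subset) auto
  then have "negligible ((\<lambda>u. x / u) ` (N - {0}))"
    by (intro negligible_differentiable_image_negligible)
      (auto intro!: differentiable_divide simp: differentiable_on_def)
  then have "(\<lambda>u. x / u) ` (N - {0}) \<in> null_sets lebesgue" by (simp add: negligible_iff_null_sets)
  then have "AE t in lebesgue. 0 < t \<longrightarrow> P (x / t)"
  proof (rule AE_I')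
    show "{t \<in> space lebesgue. \<not> (0 < t \<longrightarrow> P (x / t))} \<subseteq> (\<lambda>u. x / u) ` (N - {0})"
    proof (rule subsetI)
      fix t assume "t \<in> {t \<in> space lebesgue. \<not> (0 < t \<longrightarrow> P (x / t))}"
      then have t: "0 < t" "\<not> P (x / t)" by auto
      then have "x / t \<in> N - {0}" using N(2) assms(2) by auto
      moreover have "t = x / (x / t)" using t assms(2) by simp
      ultimately show "t \<in> (\<lambda>u. x / u) ` (N - {0})" by blast
    qed
  qed
  then show ?thesis by (simp add: AE_completion_iff)
qed

text \<open>The kernel is homogeneous of degree -1, so it cancels the Jacobian and only the
  truncation level is rescaled.\<close>

lemma trunc_hilbert_dilation:
  assumes r: "0 < r"
  shows "trunc_hilbert e (\<lambda>u. f (r * u)) x = trunc_hilbert (r * e) f (r * x)"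
proof -
  have "(\<integral>t. (if r * e < \<bar>r * x - t\<bar> then f t / of_real (r * x - t) else 0) \<partial>lborel) =
    r *\<^sub>R (\<integral>u. (if r * e < \<bar>r * x - (0 + r * u)\<bar> then f (0 + r * u) / of_real (r * x - (0 + r * u)) else 0) \<partial>lborel)"
    using lborel_integral_real_affine[of r "\<lambda>t. if r * e < \<bar>r * x - t\<bar> then f t / of_real (r * x - t) else 0" 0] r by simp
  also have "\<dots> = (\<integral>u. r *\<^sub>R (if r * e < \<bar>r * x - (0 + r * u)\<bar> then f (0 + r * u) / of_real (r * x - (0 + r * u)) else 0) \<partial>lborel)"
    by simp
  also have "\<dots> = (\<integral>u. (if e < \<bar>x - u\<bar> then f (r * u) / of_real (x - u) else 0) \<partial>lborel)"
  proof (intro Bochner_Integration.integral_cong refl)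
    fix u
    have a: "r * x - (0 + r * u) = r * (x - u)" by (simp add: algebra_simps)
    have b: "(r * e < \<bar>r * (x - u)\<bar>) = (e < \<bar>x - u\<bar>)" using r by (simp add: abs_mult)
    show "r *\<^sub>R (if r * e < \<bar>r * x - (0 + r * u)\<bar> then f (0 + r * u) / of_real (r * x - (0 + r * u)) else 0) =
      (if e < \<bar>x - u\<bar> then f (r * u) / of_real (x - u) else 0)"
      unfolding a b using r by (simp add: scaleR_conv_of_real del: of_real_diff)
  qed
  finally show ?thesis by (simp add: trunc_hilbert_def)
qed

lemma pv_exists_dilation:
  assumes r: "0 < r" and pv: "pv_exists (\<lambda>u. f (r * u)) x"
  shows "pv_exists f (r * x)"
proof -
  obtain l where l: "((\<lambda>e. trunc_hilbert e (\<lambda>u. f (r * u)) x) \<longlongrightarrow> l) (at_right 0)" using pv by (auto simp: pv_exists_def)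
  have "filterlim (\<lambda>e. e / r) (at_right 0) (at_right (0::real))"
    unfolding filterlim_at
  proof
    show "((\<lambda>e. e / r) \<longlongrightarrow> 0) (at_right 0)" using tendsto_divide[OF tendsto_ident_at tendsto_const, of r 0 "{0<..}"] r by simp
    show "\<forall>\<^sub>F e in at_right 0. e / r \<in> {0<..} \<and> e / r \<noteq> 0"
      using eventually_at_right_0[OF zero_less_one] by eventually_elim (use r in auto)
  qed
  from filterlim_compose[OF l this] show ?thesis
    unfolding trunc_hilbert_dilation[OF r] pv_exists_def using r by auto
qed

text \<open>The level \<open>e / r\<close> may be irrational, so the suprema cannot be matched term
  by term; \<open>trunc_hilbert_le_hilbert_max\<close> bridges the gap and requires a tempered
  dilate.\<close>

lemma hilbert_max_dilation:
  assumes r: "0 < r" and sl: "tempered (\<lambda>u. f (r * u))"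
  shows "hilbert_max f (r * x) \<le> hilbert_max (\<lambda>u. f (r * u)) x"
  unfolding hilbert_max_def[of f]
proof (rule SUP_least)
  fix e :: real assume "e \<in> {e \<in> \<rat>. 0 < e}"
  then have e: "0 < e / r" using r by simp
  show "ennreal (norm (trunc_hilbert e f (r * x))) \<le> hilbert_max (\<lambda>u. f (r * u)) x"
    using trunc_hilbert_le_hilbert_max[OF sl e, of x] r unfolding trunc_hilbert_dilation[OF r] by simp
qed

lemma weighted_integral_dilation:
  assumes r: "0 < r" and [measurable]: "f \<in> borel_measurable borel"
  shows "weighted_integral p \<alpha> (\<lambda>u. f (r * u)) = ennreal (r powr (- (1 + \<alpha>))) * weighted_integral p \<alpha> f"
proof -
  let ?I = "\<integral>\<^sup>+u. ennreal (norm (f (r * u)) powr p * \<bar>r * u\<bar> powr \<alpha>) \<partial>lborel"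
  have "weighted_integral p \<alpha> f = ennreal r * ?I"
    unfolding weighted_integral_def using nn_integral_real_affine[of "\<lambda>u. ennreal (norm (f u) powr p * \<bar>u\<bar> powr \<alpha>)" r 0] r by simp
  then have "ennreal (r powr (- (1 + \<alpha>))) * weighted_integral p \<alpha> f = (ennreal (r powr (- (1 + \<alpha>))) * ennreal r) * ?I"
    by (simp add: mult.assoc)
  also have "ennreal (r powr (- (1 + \<alpha>))) * ennreal r = ennreal (r powr - \<alpha>)"
  proof -
    have "r powr (- (1 + \<alpha>)) * r = r powr (- (1 + \<alpha>)) * r powr 1" using r by simp
    also have "\<dots> = r powr - \<alpha>" by (simp only: powr_add[symmetric]) simp
    finally show ?thesis by (simp add: ennreal_mult'[symmetric])
  qed
  also have "ennreal (r powr - \<alpha>) * ?I = (\<integral>\<^sup>+u. ennreal (r powr - \<alpha>) * ennreal (norm (f (r * u)) powr p * \<bar>r * u\<bar> powr \<alpha>) \<partial>lborel)"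
    by (rule nn_integral_cmult[symmetric]) measurable
  also have "\<dots> = weighted_integral p \<alpha> (\<lambda>u. f (r * u))"
    unfolding weighted_integral_def
  proof (intro nn_integral_cong)
    fix u
    have "r powr - \<alpha> * (norm (f (r * u)) powr p * \<bar>r * u\<bar> powr \<alpha>) = (r powr - \<alpha> * r powr \<alpha>) * (norm (f (r * u)) powr p * \<bar>u\<bar> powr \<alpha>)"
      using r by (simp add: abs_mult powr_mult)
    also have "r powr - \<alpha> * r powr \<alpha> = 1" using r by (simp flip: powr_add)
    finally show "ennreal (r powr - \<alpha>) * ennreal (norm (f (r * u)) powr p * \<bar>r * u\<bar> powr \<alpha>) = ennreal (norm (f (r * u)) powr p * \<bar>u\<bar> powr \<alpha>)"
      by (simp add: ennreal_mult'[symmetric])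
  qed
  finally show ?thesis by simp
qed

lemma weighted_integral_cmult:
  assumes [measurable]: "f \<in> borel_measurable borel"
  shows "weighted_integral p \<alpha> (\<lambda>u. c * f u) = ennreal (norm c powr p) * weighted_integral p \<alpha> f"
  unfolding weighted_integral_def
  by (subst nn_integral_cmult[symmetric]) (auto simp: norm_mult powr_mult ennreal_mult'[symmetric] mult.assoc)

section \<open>Annuli of every scale\<close>

lemma nonzero_in_dyadic_annulus:
  assumes "x \<noteq> (0::real)"
  shows "\<exists>k::int. \<bar>x\<bar> \<in> {2 powr k .. 2 * 2 powr k}"
proof (intro exI)
  let ?k = "\<lfloor>log 2 \<bar>x\<bar>\<rfloor>"
  have "2 powr ?k \<le> 2 powr (log 2 \<bar>x\<bar>)" by (intro powr_mono) auto
  moreover have "2 powr (log 2 \<bar>x\<bar>) \<le> 2 powr (1 + ?k)" by (intro powr_mono) (auto, linarith)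
  ultimately show "\<bar>x\<bar> \<in> {2 powr ?k .. 2 * 2 powr ?k}" using assms by (simp add: powr_add)
qed

text \<open>With \<open>\<beta> * p = 1 + \<alpha>\<close>, the dilate
  \<open>r powr \<beta> * f (r * u)\<close> has the same weighted integral as \<open>f\<close>, so
  the estimate on the annulus from 1 to 2 applies to it with a constant independent of
  \<open>r\<close>. The factor \<open>r\<close> is the Jacobian, and \<open>2 powr \<beta>\<close>
  is the variation of \<open>\<bar>x\<bar> powr \<beta>\<close> over one annulus.\<close>

lemma hilbert_max_scaled_annulus:
  assumes p: "1 < p" and \<alpha>: "-1 < \<alpha>" "\<alpha> < p - 1"
    and f: "f \<in> borel_measurable borel" and fin: "weighted_integral p \<alpha> f < \<infinity>"
  obtains K where "0 \<le> K"
    "\<And>r. 0 < r \<Longrightarrow> (\<integral>\<^sup>+x. ennreal (\<bar>x\<bar> powr ((1 + \<alpha>) / p)) * hilbert_max f x * indicator {r..2 * r} \<bar>x\<bar> \<partial>lborel) \<le> ennreal (K * r)"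
proof -
  note [measurable] = f
  define \<beta> where "\<beta> = (1 + \<alpha>) / p"
  have \<beta>: "0 < \<beta>" unfolding \<beta>_def using p \<alpha> by simp
  obtain C where C: "0 \<le> C"
    "\<And>h. h \<in> borel_measurable borel \<Longrightarrow> weighted_integral p \<alpha> h < \<infinity> \<Longrightarrow>
      (\<integral>\<^sup>+x. hilbert_max h x * indicator {1..2} \<bar>x\<bar> \<partial>lborel) \<le> ennreal C * (1 + weighted_integral p \<alpha> h)"
    using hilbert_max_annulus[OF p \<alpha>] by (elim exE conjE) simp
  obtain W where W: "0 \<le> W" "weighted_integral p \<alpha> f = ennreal W" using fin by (cases "weighted_integral p \<alpha> f") auto
  show ?thesis
  proof (rule that)
    show "0 \<le> 2 powr \<beta> * (C * (1 + W))" using C W by simp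
    fix r :: real assume r: "0 < r"
    define g where "g = (\<lambda>u. of_real (r powr \<beta>) * f (r * u))"
    have [measurable]: "(\<lambda>u. f (r * u)) \<in> borel_measurable borel" by measurable
    have [measurable]: "g \<in> borel_measurable borel" unfolding g_def by measurable
    have rp: "(r powr \<beta>) powr p * r powr (- (1 + \<alpha>)) = 1"
      using p r by (simp add: powr_powr powr_add[symmetric] \<beta>_def)
    have Wg: "weighted_integral p \<alpha> g = ennreal W"
    proof -
      have "weighted_integral p \<alpha> g = ennreal ((r powr \<beta>) powr p) * (ennreal (r powr (- (1 + \<alpha>))) * ennreal W)"
        unfolding g_def using r by (subst weighted_integral_cmult) (auto simp: weighted_integral_dilation W)
      also have "\<dots> = ennreal ((r powr \<beta>) powr p * r powr (- (1 + \<alpha>))) * ennreal W"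
        by (subst ennreal_mult) (auto simp: mult.assoc)
      finally show ?thesis unfolding rp by simp
    qed
    have wf: "weighted_integral p \<alpha> (\<lambda>u. f (r * u)) < \<infinity>" unfolding weighted_integral_dilation[OF r f] using W by (simp add: ennreal_mult_less_top)
    have sl: "tempered (\<lambda>u. f (r * u))" by (rule weighted_integral_imp_tempered[OF p \<alpha> _ wf]) measurable
    have "(\<integral>\<^sup>+x. ennreal (\<bar>x\<bar> powr \<beta>) * hilbert_max f x * indicator {r..2 * r} \<bar>x\<bar> \<partial>lborel)
      = ennreal r * (\<integral>\<^sup>+x. ennreal (\<bar>r * x\<bar> powr \<beta>) * hilbert_max f (r * x) * indicator {r..2 * r} \<bar>r * x\<bar> \<partial>lborel)"
      using nn_integral_real_affine[of "\<lambda>x. ennreal (\<bar>x\<bar> powr \<beta>) * hilbert_max f x * indicator {r..2 * r} \<bar>x\<bar>" r 0] r by simp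
    also have "\<dots> \<le> ennreal r * (\<integral>\<^sup>+x. ennreal (2 powr \<beta>) * (hilbert_max g x * indicator {1..2} \<bar>x\<bar>) \<partial>lborel)"
    proof (intro mult_left_mono nn_integral_mono)
      fix x
      show "ennreal (\<bar>r * x\<bar> powr \<beta>) * hilbert_max f (r * x) * indicator {r..2 * r} \<bar>r * x\<bar> \<le> ennreal (2 powr \<beta>) * (hilbert_max g x * indicator {1..2} \<bar>x\<bar>)"
      proof (cases "\<bar>x\<bar> \<in> {1..2}")
        case True
        have "\<bar>r * x\<bar> powr \<beta> \<le> (2 * r) powr \<beta>"
          using True r \<beta> by (intro powr_mono2) (auto simp: abs_mult)
        then have "ennreal (\<bar>r * x\<bar> powr \<beta>) \<le> ennreal (2 powr \<beta>) * ennreal (r powr \<beta>)"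
          using r by (simp add: powr_mult ennreal_mult[symmetric] ennreal_leI)
        moreover have "hilbert_max f (r * x) \<le> hilbert_max (\<lambda>u. f (r * u)) x" by (rule hilbert_max_dilation[OF r sl])
        ultimately have "ennreal (\<bar>r * x\<bar> powr \<beta>) * hilbert_max f (r * x) \<le> ennreal (2 powr \<beta>) * ennreal (r powr \<beta>) * hilbert_max (\<lambda>u. f (r * u)) x"
          by (intro mult_mono) auto
        also have "\<dots> = ennreal (2 powr \<beta>) * hilbert_max g x"
          unfolding g_def hilbert_max_cmult by (simp add: mult.assoc)
        finally show ?thesis using True r by (simp add: abs_mult)
      next
        case False
        then have "\<bar>r * x\<bar> \<notin> {r..2 * r}" using r by (auto simp: abs_mult)
        then show ?thesis by simp
      qed
    qed auto
    also have "\<dots> = ennreal r * (ennreal (2 powr \<beta>) * (\<integral>\<^sup>+x. hilbert_max g x * indicator {1..2} \<bar>x\<bar> \<partial>lborel))"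
      by (subst nn_integral_cmult) auto
    also have "\<dots> \<le> ennreal r * (ennreal (2 powr \<beta>) * (ennreal C * (1 + ennreal W)))"
      by (intro mult_left_mono order_trans[OF C(2)]) (auto simp: Wg)
    also have "\<dots> = ennreal (2 powr \<beta> * (C * (1 + W)) * r)"
    proof -
      have "1 + ennreal W = ennreal (1 + W)" using W by simp
      then have "ennreal r * (ennreal (2 powr \<beta>) * (ennreal C * (1 + ennreal W))) = ennreal (r * (2 powr \<beta> * (C * (1 + W))))"
        using C(1) W(1) r by (simp only: ennreal_mult[symmetric] mult_nonneg_nonneg add_nonneg_nonneg zero_le_one powr_ge_zero less_imp_le)
      then show ?thesis by (simp only: mult.commute[of r])
    qed
    finally show "(\<integral>\<^sup>+x. ennreal (\<bar>x\<bar> powr ((1 + \<alpha>) / p)) * hilbert_max f x * indicator {r..2 * r} \<bar>x\<bar> \<partial>lborel) \<le> ennreal (2 powr \<beta> * (C * (1 + W)) * r)"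
      unfolding \<beta>_def .
  qed
qed

text \<open>Countably many dyadic annuli cover the complement of 0, and on each of them the claim is
  the one on \<open>1 \<le> \<bar>x\<bar> \<le> 2\<close> for a dilate of \<open>f\<close>.\<close>

lemma pv_exists_weighted:
  assumes p: "1 < p" and \<alpha>: "-1 < \<alpha>" "\<alpha> < p - 1"
    and f: "f \<in> borel_measurable borel" and fin: "weighted_integral p \<alpha> f < \<infinity>"
  shows "AE x in lborel. pv_exists f x"
proof -
  note [measurable] = f
  have pv: "\<And>h. h \<in> borel_measurable borel \<Longrightarrow> weighted_integral p \<alpha> h < \<infinity> \<Longrightarrow> AE x in lborel. \<bar>x\<bar> \<in> {1..2} \<longrightarrow> pv_exists h x"
    using hilbert_max_annulus[OF p \<alpha>] by (elim exE conjE) simp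
  have "AE x in lborel. \<bar>x\<bar> \<in> {r..2 * r} \<longrightarrow> pv_exists f x" if r: "0 < r" for r :: real
  proof -
    have "AE x in lborel. \<bar>x\<bar> \<in> {1..2} \<longrightarrow> pv_exists (\<lambda>u. f (r * u)) x"
      by (rule pv) (use fin in \<open>auto simp: weighted_integral_dilation[OF r f] ennreal_mult_less_top\<close>)
    from AE_lborel_affine[OF this, of "1 / r" 0]
    have "AE x in lborel. \<bar>x / r\<bar> \<in> {1..2} \<longrightarrow> pv_exists (\<lambda>u. f (r * u)) (x / r)" using r by simp
    then show ?thesis
    proof eventually_elim
      case (elim x)
      then show ?case using pv_exists_dilation[OF r, of f "x / r"] r by (auto simp: field_simps)
    qed
  qed
  then have "AE x in lborel. \<forall>k::int. \<bar>x\<bar> \<in> {2 powr k..2 * 2 powr k} \<longrightarrow> pv_exists f x"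
    unfolding AE_all_countable by auto
  moreover have "AE x in lborel. x \<noteq> (0::real)" by (rule AE_lborel_singleton)
  ultimately show ?thesis
  proof eventually_elim
    case (elim x)
    then show ?case using nonzero_in_dyadic_annulus by blast
  qed
qed

text \<open>After Fubini and the substitution \<open>x = t * u\<close>, the annulus of scale \<open>r\<close> becomes the one of scale
  \<open>r / t\<close>, to which the hypothesis on \<open>G\<close> applies.\<close>

lemma AE_hausdorff_finite:
  assumes [measurable]: "G \<in> borel_measurable borel" "\<phi> \<in> borel_measurable (borel :: real measure)"
    and \<phi>0: "\<And>t. t \<le> 0 \<Longrightarrow> \<phi> t = (0::real)" and \<phi>n: "\<And>t. 0 \<le> \<phi> t"
    and fin: "(\<integral>\<^sup>+t. ennreal (t powr (\<beta> - 1) * \<phi> t) \<partial>lborel) < \<infinity>"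
    and K: "0 \<le> K" "\<And>r. 0 < r \<Longrightarrow> (\<integral>\<^sup>+x. ennreal (\<bar>x\<bar> powr \<beta>) * G x * indicator {r..2 * r} \<bar>x\<bar> \<partial>lborel) \<le> ennreal (K * r)"
  shows "AE x in lborel. (\<integral>\<^sup>+t. G (x / t) * ennreal (\<phi> t / t) \<partial>lborel) < \<infinity>"
proof -
  let ?T = "\<lambda>x. \<integral>\<^sup>+t. G (x / t) * ennreal (\<phi> t / t) \<partial>lborel"
  have [measurable]: "?T \<in> borel_measurable borel" by measurable
  have "AE x in lborel. \<bar>x\<bar> \<in> {r..2 * r} \<longrightarrow> ?T x < \<infinity>" if r: "0 < r" for r :: real
  proof -
    let ?w = "\<lambda>x. ennreal (\<bar>x\<bar> powr \<beta>) * indicator {r..2 * r} \<bar>x\<bar>"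
    have "(\<integral>\<^sup>+x. ?w x * ?T x \<partial>lborel) = (\<integral>\<^sup>+x. \<integral>\<^sup>+t. ?w x * (G (x / t) * ennreal (\<phi> t / t)) \<partial>lborel \<partial>lborel)"
      by (intro nn_integral_cong nn_integral_cmult[symmetric]) measurable
    also have "\<dots> = (\<integral>\<^sup>+t. \<integral>\<^sup>+x. ?w x * (G (x / t) * ennreal (\<phi> t / t)) \<partial>lborel \<partial>lborel)"
      by (rule lborel_pair.Fubini'[symmetric]) measurable
    also have "\<dots> \<le> (\<integral>\<^sup>+t. ennreal (K * r) * ennreal (t powr (\<beta> - 1) * \<phi> t) \<partial>lborel)"
    proof (rule nn_integral_mono)
      fix t :: real
      show "(\<integral>\<^sup>+x. ?w x * (G (x / t) * ennreal (\<phi> t / t)) \<partial>lborel) \<le> ennreal (K * r) * ennreal (t powr (\<beta> - 1) * \<phi> t)"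
      proof (cases "t \<le> 0")
        case False
        then have t: "0 < t" by simp
        have "(\<integral>\<^sup>+x. ?w x * (G (x / t) * ennreal (\<phi> t / t)) \<partial>lborel) = ennreal (\<phi> t / t) * (\<integral>\<^sup>+x. ?w x * G (x / t) \<partial>lborel)"
          by (subst nn_integral_cmult[symmetric]) (auto simp: mult_ac)
        also have "(\<integral>\<^sup>+x. ?w x * G (x / t) \<partial>lborel) = ennreal t * (\<integral>\<^sup>+u. ?w (t * u) * G u \<partial>lborel)"
          using nn_integral_real_affine[of "\<lambda>x. ?w x * G (x / t)" t 0] t by simp
        also have "(\<integral>\<^sup>+u. ?w (t * u) * G u \<partial>lborel) = (\<integral>\<^sup>+u. ennreal (t powr \<beta>) * (ennreal (\<bar>u\<bar> powr \<beta>) * G u * indicator {r / t..2 * (r / t)} \<bar>u\<bar>) \<partial>lborel)"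
        proof (intro nn_integral_cong)
          fix u
          have "(\<bar>t * u\<bar> \<in> {r..2 * r}) = (\<bar>u\<bar> \<in> {r / t..2 * (r / t)})"
            using t by (auto simp: abs_mult field_simps)
          then have i: "indicator {r..2 * r} \<bar>t * u\<bar> = (indicator {r / t..2 * (r / t)} \<bar>u\<bar> :: ennreal)"
            by (simp add: indicator_def)
          have "ennreal (\<bar>t * u\<bar> powr \<beta>) = ennreal (t powr \<beta>) * ennreal (\<bar>u\<bar> powr \<beta>)"
            using t by (simp add: abs_mult powr_mult ennreal_mult)
          then show "?w (t * u) * G u = ennreal (t powr \<beta>) * (ennreal (\<bar>u\<bar> powr \<beta>) * G u * indicator {r / t..2 * (r / t)} \<bar>u\<bar>)"
            unfolding i by (simp only: mult_ac)
        qed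
        also have "\<dots> = ennreal (t powr \<beta>) * (\<integral>\<^sup>+u. ennreal (\<bar>u\<bar> powr \<beta>) * G u * indicator {r / t..2 * (r / t)} \<bar>u\<bar> \<partial>lborel)"
          by (rule nn_integral_cmult) measurable
        \<comment> \<open>The hypothesis at scale \<open>r / t\<close> contributes
          \<open>K * (r / t)\<close>, and the powers of \<open>t\<close> collapse to
          \<open>t powr (\<beta> - 1)\<close>, which is integrable against
          \<open>\<phi>\<close>.\<close>
        also have "ennreal (\<phi> t / t) * (ennreal t * \<dots>) \<le> ennreal (\<phi> t / t) * (ennreal t * (ennreal (t powr \<beta>) * ennreal (K * (r / t))))"
          using r t by (intro mult_left_mono K) auto
        also have "\<dots> = ennreal (\<phi> t / t * (t * (t powr \<beta> * (K * (r / t)))))"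
          using r t K(1) \<phi>n[of t]
          by (simp only: ennreal_mult[symmetric] mult_nonneg_nonneg divide_nonneg_nonneg powr_ge_zero less_imp_le)
        also have "\<phi> t / t * (t * (t powr \<beta> * (K * (r / t)))) = (K * r) * (t powr (\<beta> - 1) * \<phi> t)"
          using t by (simp add: powr_diff)
        also have "ennreal ((K * r) * (t powr (\<beta> - 1) * \<phi> t)) = ennreal (K * r) * ennreal (t powr (\<beta> - 1) * \<phi> t)"
          using r K \<phi>n[of t] by (intro ennreal_mult) auto
        finally show ?thesis .
      qed (simp add: \<phi>0)
    qed
    also have "\<dots> = ennreal (K * r) * (\<integral>\<^sup>+t. ennreal (t powr (\<beta> - 1) * \<phi> t) \<partial>lborel)"
      by (rule nn_integral_cmult) measurable
    also have "\<dots> < \<infinity>" using fin by (simp add: ennreal_mult_less_top)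
    finally have "(\<integral>\<^sup>+x. ?w x * ?T x \<partial>lborel) \<noteq> \<infinity>" by simp
    then have "AE x in lborel. ?w x * ?T x \<noteq> \<infinity>" by (intro nn_integral_PInf_AE) auto
    then show ?thesis
    proof eventually_elim
      case (elim x)
      show ?case
      proof
        assume x: "\<bar>x\<bar> \<in> {r..2 * r}"
        then have "0 < \<bar>x\<bar> powr \<beta>" using r by auto
        then show "?T x < \<infinity>" using elim x by (auto simp: ennreal_mult_eq_top_iff less_top)
      qed
    qed
  qed
  then have "AE x in lborel. \<forall>k::int. \<bar>x\<bar> \<in> {2 powr k..2 * 2 powr k} \<longrightarrow> ?T x < \<infinity>"
    unfolding AE_all_countable by auto
  moreover have "AE x in lborel. x \<noteq> (0::real)" by (rule AE_lborel_singleton)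
  ultimately show ?thesis
  proof eventually_elim
    case (elim x)
    then show ?case using nonzero_in_dyadic_annulus by blast
  qed
qed

section \<open>Hausdorff operators\<close>

text \<open>The kernel is a Borel function extended by 0 to the nonpositive reals, so that all
  integrals run over the whole line against \<open>lborel\<close>.\<close>

locale hausdorff_kernel =
  fixes p \<alpha> :: real and \<phi> :: "real \<Rightarrow> complex"
  assumes p: "1 < p" and \<alpha>: "-1 < \<alpha>"
    and \<phi>_meas [measurable]: "\<phi> \<in> borel_measurable borel"
    and \<phi>_zero: "\<And>t. t \<le> 0 \<Longrightarrow> \<phi> t = 0"
    and \<phi>_fin: "(\<integral>\<^sup>+t. ennreal (t powr ((1 + \<alpha>) / p - 1) * norm (\<phi> t)) \<partial>lborel) < \<infinity>"
begin

definition \<beta> where "\<beta> = (1 + \<alpha>) / p"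

definition weight where "weight t = t powr (\<beta> - 1) * norm (\<phi> t)"

definition A where "A = (\<integral>t. weight t \<partial>lborel)"

definition hausdorff :: "(real \<Rightarrow> complex) \<Rightarrow> real \<Rightarrow> complex" where
  "hausdorff f x = (\<integral>t. f (x / t) * (\<phi> t / of_real t) \<partial>lborel)"

definition hausdorff_abs :: "(real \<Rightarrow> complex) \<Rightarrow> real \<Rightarrow> ennreal" where
  "hausdorff_abs f x = (\<integral>\<^sup>+t. ennreal (norm (f (x / t)) * (norm (\<phi> t) / t)) \<partial>lborel)"

lemma \<beta>_pos: "0 < \<beta>" and \<beta>_p: "\<beta> * p = 1 + \<alpha>"
  unfolding \<beta>_def using p \<alpha> by auto

lemma weight_measurable [measurable]: "weight \<in> borel_measurable borel"
  unfolding weight_def by measurable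

lemma weight_nonneg: "0 \<le> weight t"
  by (simp add: weight_def)

lemma weight_integrable: "integrable lborel weight"
  using \<phi>_fin weight_nonneg unfolding weight_def \<beta>_def by (intro integrableI_nonneg) auto

lemma A_nonneg: "0 \<le> A"
  unfolding A_def using weight_nonneg by simp

lemma nn_integral_weight: "(\<integral>\<^sup>+t. ennreal (weight t) \<partial>lborel) = ennreal A"
  unfolding A_def using weight_integrable weight_nonneg by (intro nn_integral_eq_integral) auto

lemma hausdorff_abs_measurable [measurable]:
  assumes [measurable]: "f \<in> borel_measurable borel"
  shows "hausdorff_abs f \<in> borel_measurable borel"
proof -
  have "(\<lambda>x. \<integral>\<^sup>+t. ennreal (norm (f (x / t)) * (norm (\<phi> t) / t)) \<partial>lborel) \<in> borel_measurable borel"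
    by (rule lborel.borel_measurable_nn_integral) measurable
  then show ?thesis unfolding hausdorff_abs_def .
qed

lemma hausdorff_measurable [measurable]:
  assumes [measurable]: "f \<in> borel_measurable borel"
  shows "hausdorff f \<in> borel_measurable borel"
proof -
  have "(\<lambda>x. \<integral>t. f (x / t) * (\<phi> t / of_real t) \<partial>lborel) \<in> borel_measurable borel"
    by (rule lborel.borel_measurable_lebesgue_integral) measurable
  then show ?thesis unfolding hausdorff_def .
qed

lemma norm_kernel: "norm (f (x / t) * (\<phi> t / of_real t)) = norm (f (x / t)) * (norm (\<phi> t) / t)"
  by (cases "t \<le> 0") (auto simp: \<phi>_zero norm_mult norm_divide)

lemma hausdorff_integrable_iff:
  assumes [measurable]: "f \<in> borel_measurable borel"
  shows "integrable lborel (\<lambda>t. f (x / t) * (\<phi> t / of_real t)) \<longleftrightarrow> hausdorff_abs f x < \<infinity>"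
  unfolding integrable_iff_bounded norm_kernel hausdorff_abs_def by simp

text \<open>Where the integral does not converge absolutely both sides are 0, the Bochner integral
  by convention and \<open>enn2real\<close> by its value at infinity, so the bound holds at every
  point.\<close>

lemma norm_hausdorff_le:
  assumes "f \<in> borel_measurable borel"
  shows "norm (hausdorff f x) \<le> enn2real (hausdorff_abs f x)"
proof (cases "hausdorff_abs f x < \<infinity>")
  case True
  then have i: "integrable lborel (\<lambda>t. f (x / t) * (\<phi> t / of_real t))"
    using hausdorff_integrable_iff[OF assms] by simp
  have "ennreal (norm (hausdorff f x)) \<le> hausdorff_abs f x"
    using integral_norm_bound_ennreal[OF i] unfolding hausdorff_def norm_kernel hausdorff_abs_def .
  then have "enn2real (ennreal (norm (hausdorff f x))) \<le> enn2real (hausdorff_abs f x)"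
    using True by (intro enn2real_mono) auto
  then show ?thesis by simp
next
  case False
  then have "\<not> integrable lborel (\<lambda>t. f (x / t) * (\<phi> t / of_real t))"
    using hausdorff_integrable_iff[OF assms] by simp
  then have "hausdorff f x = 0" unfolding hausdorff_def by (rule not_integrable_integral_eq)
  then show ?thesis by simp
qed

section \<open>The upper bound by Minkowski's integral inequality\<close>

definition moment :: "(real \<Rightarrow> complex) \<Rightarrow> real \<Rightarrow> ennreal" where
  "moment f x = (\<integral>\<^sup>+t. ennreal ((norm (f (x / t)) * t powr - \<beta>) powr p * weight t) \<partial>lborel)"

lemma moment_measurable [measurable]:
  assumes [measurable]: "f \<in> borel_measurable borel"
  shows "moment f \<in> borel_measurable borel"
proof -
  have "(\<lambda>x. \<integral>\<^sup>+t. ennreal ((norm (f (x / t)) * t powr - \<beta>) powr p * weight t) \<partial>lborel) \<in> borel_measurable borel"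
    by (rule lborel.borel_measurable_nn_integral) measurable
  then show ?thesis unfolding moment_def .
qed

text \<open>The factor \<open>t powr - \<beta>\<close> in \<open>moment\<close> is the normalization
  for which every dilate \<open>x \<mapsto> t powr - \<beta> * f (x / t)\<close> with
  \<open>t > 0\<close> has the weighted norm of \<open>f\<close>. After Tonelli only the total mass
  \<open>A\<close> of the weight remains.\<close>

lemma nn_integral_moment:
  assumes f [measurable]: "f \<in> borel_measurable borel"
  shows "(\<integral>\<^sup>+x. ennreal (\<bar>x\<bar> powr \<alpha>) * moment f x \<partial>lborel) = ennreal A * weighted_integral p \<alpha> f"
proof -
  have "(\<integral>\<^sup>+x. ennreal (\<bar>x\<bar> powr \<alpha>) * moment f x \<partial>lborel)
    = (\<integral>\<^sup>+x. \<integral>\<^sup>+t. ennreal (\<bar>x\<bar> powr \<alpha>) * ennreal ((norm (f (x / t)) * t powr - \<beta>) powr p * weight t) \<partial>lborel \<partial>lborel)"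
    unfolding moment_def by (intro nn_integral_cong nn_integral_cmult[symmetric]) measurable
  also have "\<dots> = (\<integral>\<^sup>+t. \<integral>\<^sup>+x. ennreal (\<bar>x\<bar> powr \<alpha>) * ennreal ((norm (f (x / t)) * t powr - \<beta>) powr p * weight t) \<partial>lborel \<partial>lborel)"
    by (rule lborel_pair.Fubini'[symmetric]) measurable
  also have "\<dots> = (\<integral>\<^sup>+t. ennreal (weight t) * weighted_integral p \<alpha> f \<partial>lborel)"
  proof (intro nn_integral_cong)
    fix t :: real
    show "(\<integral>\<^sup>+x. ennreal (\<bar>x\<bar> powr \<alpha>) * ennreal ((norm (f (x / t)) * t powr - \<beta>) powr p * weight t) \<partial>lborel) = ennreal (weight t) * weighted_integral p \<alpha> f"
    proof (cases "t \<le> 0")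
      case True
      then show ?thesis by (simp add: weight_def \<phi>_zero)
    next
      case False
      then have t: "0 < t" by simp
      have e: "ennreal (\<bar>x\<bar> powr \<alpha>) * ennreal ((norm (f (x / t)) * t powr - \<beta>) powr p * weight t)
        = ennreal (weight t * t powr (- (1 + \<alpha>))) * ennreal (norm (f (1 / t * x)) powr p * \<bar>x\<bar> powr \<alpha>)" for x
      proof -
        have "(norm (f (x / t)) * t powr - \<beta>) powr p = norm (f (x / t)) powr p * t powr (- (1 + \<alpha>))"
          using \<beta>_p by (subst powr_mult) (auto simp: powr_powr)
        then show ?thesis using weight_nonneg[of t] by (simp add: ennreal_mult[symmetric] mult_ac)
      qed
      have "(\<integral>\<^sup>+x. ennreal (weight t * t powr (- (1 + \<alpha>))) * ennreal (norm (f (1 / t * x)) powr p * \<bar>x\<bar> powr \<alpha>) \<partial>lborel)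
        = ennreal (weight t * t powr (- (1 + \<alpha>))) * weighted_integral p \<alpha> (\<lambda>x. f (1 / t * x))"
        unfolding weighted_integral_def by (rule nn_integral_cmult) measurable
      also have "weighted_integral p \<alpha> (\<lambda>x. f (1 / t * x)) = ennreal ((1 / t) powr (- (1 + \<alpha>))) * weighted_integral p \<alpha> f"
        using t by (intro weighted_integral_dilation) auto
      also have "ennreal (weight t * t powr (- (1 + \<alpha>))) * \<dots> = ennreal (weight t * t powr (- (1 + \<alpha>)) * (1 / t) powr (- (1 + \<alpha>))) * weighted_integral p \<alpha> f"
        using weight_nonneg[of t] by (simp add: ennreal_mult mult.assoc)
      also have "weight t * t powr (- (1 + \<alpha>)) * (1 / t) powr (- (1 + \<alpha>)) = weight t"
        using t by (simp add: mult.assoc powr_mult[symmetric])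
      finally show ?thesis unfolding e .
    qed
  qed
  also have "\<dots> = ennreal A * weighted_integral p \<alpha> f"
    by (subst nn_integral_multc) (auto simp: nn_integral_weight)
  finally show ?thesis .
qed

text \<open>Jensen's inequality against \<open>weight\<close>, because
  \<open>t powr - \<beta> * weight t = norm (\<phi> t) / t\<close> for positive
  \<open>t\<close>.\<close>

lemma hausdorff_abs_powr_le:
  assumes f [measurable]: "f \<in> borel_measurable borel" and "moment f x < \<infinity>"
  shows "hausdorff_abs f x < \<infinity>" "ennreal (enn2real (hausdorff_abs f x) powr p) \<le> ennreal (A powr (p - 1)) * moment f x"
proof -
  from assms(2) obtain k where k: "0 \<le> k" "moment f x = ennreal k" by (cases "moment f x") auto
  obtain I where I: "0 \<le> I" "(\<integral>\<^sup>+t. ennreal (norm (f (x / t)) * t powr - \<beta> * weight t) \<partial>lborel) = ennreal I" "I powr p \<le> A powr (p - 1) * k"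
  proof (rule nn_integral_jensen_powr[where u = "\<lambda>t. norm (f (x / t)) * t powr - \<beta>" and w = weight and M = lborel and p = p and W = A and K = k])
    show "(\<integral>\<^sup>+t. ennreal ((norm (f (x / t)) * t powr - \<beta>) powr p * weight t) \<partial>lborel) = ennreal k"
      using k unfolding moment_def by simp
    show "(\<integral>\<^sup>+t. ennreal (weight t) \<partial>lborel) \<le> ennreal A" by (simp add: nn_integral_weight)
  qed (use p weight_nonneg A_nonneg k in auto)
  have "(\<integral>\<^sup>+t. ennreal (norm (f (x / t)) * t powr - \<beta> * weight t) \<partial>lborel) = hausdorff_abs f x"
    unfolding hausdorff_abs_def
  proof (intro nn_integral_cong)
    fix t :: real
    show "ennreal (norm (f (x / t)) * t powr - \<beta> * weight t) = ennreal (norm (f (x / t)) * (norm (\<phi> t) / t))"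
    proof (cases "t \<le> 0")
      case False
      have "t powr - \<beta> * t powr (\<beta> - 1) = 1 / t"
        using False by (simp only: powr_add[symmetric]) (simp add: powr_minus_divide)
      then have "norm (f (x / t)) * (t powr - \<beta> * t powr (\<beta> - 1)) * norm (\<phi> t) = norm (f (x / t)) * (norm (\<phi> t) / t)"
        by simp
      then show ?thesis by (simp only: weight_def mult.assoc)
    qed (simp add: weight_def \<phi>_zero)
  qed
  then have h: "hausdorff_abs f x = ennreal I" using I(2) by simp
  have "ennreal (I powr p) \<le> ennreal (A powr (p - 1) * k)" using I(3) by (rule ennreal_leI)
  then show "ennreal (enn2real (hausdorff_abs f x) powr p) \<le> ennreal (A powr (p - 1)) * moment f x"
    using h I(1) k by (simp add: ennreal_mult)
  show "hausdorff_abs f x < \<infinity>" using h by simp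
qed

lemma AE_hausdorff_abs_finite:
  assumes f [measurable]: "f \<in> borel_measurable borel" and fin: "weighted_integral p \<alpha> f < \<infinity>"
  shows "AE x in lborel. hausdorff_abs f x < \<infinity>"
proof -
  have "(\<integral>\<^sup>+x. ennreal (\<bar>x\<bar> powr \<alpha>) * moment f x \<partial>lborel) \<noteq> \<infinity>"
    unfolding nn_integral_moment[OF f] using fin by (auto simp: ennreal_mult_eq_top_iff)
  then have "AE x in lborel. ennreal (\<bar>x\<bar> powr \<alpha>) * moment f x \<noteq> \<infinity>" by (intro nn_integral_PInf_AE) auto
  moreover have "AE x in lborel. x \<noteq> (0::real)" by (rule AE_lborel_singleton)
  ultimately show ?thesis
  proof eventually_elim
    case (elim x)
    then have "moment f x < \<infinity>" by (auto simp: ennreal_mult_eq_top_iff less_top)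
    then show ?case by (rule hausdorff_abs_powr_le(1)[OF f])
  qed
qed

lemma nn_integral_hausdorff_abs_powr:
  assumes f [measurable]: "f \<in> borel_measurable borel"
  shows "(\<integral>\<^sup>+x. ennreal (enn2real (hausdorff_abs f x) powr p * \<bar>x\<bar> powr \<alpha>) \<partial>lborel) \<le> ennreal (A powr p) * weighted_integral p \<alpha> f"
\<comment> \<open>For \<open>A = 0\<close> the pointwise bound could break down at points of
  infinite moment, where its right-hand side is 0 times infinity, that is 0. In that case the kernel
  vanishes almost everywhere.\<close>
proof (cases "A = 0")
  case True
  have "(\<integral>\<^sup>+t. ennreal (weight t) \<partial>lborel) = 0" using nn_integral_weight True by simp
  then have "AE t in lborel. ennreal (weight t) = 0" by (subst (asm) nn_integral_0_iff_AE) auto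
  then have "AE t in lborel. \<phi> t = 0"
  proof eventually_elim
    case (elim t)
    then show ?case using weight_nonneg[of t] \<phi>_zero[of t] by (cases "t \<le> 0") (auto simp: weight_def)
  qed
  then have "hausdorff_abs f x = 0" for x
    unfolding hausdorff_abs_def by (subst nn_integral_0_iff_AE) auto
  then show ?thesis by (simp add: p)
next
  case False
  then have A: "0 < A" using A_nonneg by simp
  have "(\<integral>\<^sup>+x. ennreal (enn2real (hausdorff_abs f x) powr p * \<bar>x\<bar> powr \<alpha>) \<partial>lborel) \<le> (\<integral>\<^sup>+x. ennreal (A powr (p - 1)) * (ennreal (\<bar>x\<bar> powr \<alpha>) * moment f x) \<partial>lborel)"
  proof (rule nn_integral_mono_AE)
    have "AE x in lborel. x \<noteq> (0::real)" by (rule AE_lborel_singleton)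
    then show "AE x in lborel. ennreal (enn2real (hausdorff_abs f x) powr p * \<bar>x\<bar> powr \<alpha>) \<le> ennreal (A powr (p - 1)) * (ennreal (\<bar>x\<bar> powr \<alpha>) * moment f x)"
    proof eventually_elim
      case (elim x)
      show ?case
      proof (cases "moment f x < \<infinity>")
        case True
        have "ennreal (enn2real (hausdorff_abs f x) powr p * \<bar>x\<bar> powr \<alpha>) = ennreal (enn2real (hausdorff_abs f x) powr p) * ennreal (\<bar>x\<bar> powr \<alpha>)"
          by (simp add: ennreal_mult)
        also have "\<dots> \<le> ennreal (A powr (p - 1)) * moment f x * ennreal (\<bar>x\<bar> powr \<alpha>)"
          using hausdorff_abs_powr_le(2)[OF f True] by (intro mult_right_mono) auto
        finally show ?thesis by (simp add: mult_ac)
      next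
        case False
        then have "moment f x = \<infinity>" by (cases "moment f x") auto
        then show ?thesis using A elim by (simp add: ennreal_mult_top)
      qed
    qed
  qed
  also have "\<dots> = ennreal (A powr (p - 1)) * (ennreal A * weighted_integral p \<alpha> f)"
    unfolding nn_integral_moment[OF f, symmetric] by (rule nn_integral_cmult) measurable
  also have "\<dots> = ennreal (A powr (p - 1) * A) * weighted_integral p \<alpha> f"
    using A by (simp add: ennreal_mult mult.assoc)
  also have "A powr (p - 1) * A = A powr p"
    using A by (simp add: powr_diff)
  finally show ?thesis .
qed

lemma weighted_integral_hausdorff_le:
  assumes f [measurable]: "f \<in> borel_measurable borel"
  shows "weighted_integral p \<alpha> (hausdorff f) \<le> ennreal (A powr p) * weighted_integral p \<alpha> f"
proof -
  have "weighted_integral p \<alpha> (hausdorff f) \<le> (\<integral>\<^sup>+x. ennreal (enn2real (hausdorff_abs f x) powr p * \<bar>x\<bar> powr \<alpha>) \<partial>lborel)"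
    unfolding weighted_integral_def using norm_hausdorff_le[OF f] p
    by (intro nn_integral_mono ennreal_leI mult_right_mono powr_mono2) auto
  also note nn_integral_hausdorff_abs_powr[OF f]
  finally show ?thesis .
qed

end

section \<open>The lower bound\<close>

lemma nn_integral_inverse_annulus:
  assumes "0 < (a::real)" "a \<le> b"
  shows "(\<integral>\<^sup>+x. ennreal (indicator {a..b} \<bar>x\<bar> / \<bar>x\<bar>) \<partial>lborel) = ennreal (2 * (ln b - ln a))"
proof -
  have "(\<integral>\<^sup>+x. ennreal (1 / x) * indicator {a..b} x \<partial>lborel) = ennreal (ln b - ln a)"
    by (rule nn_integral_FTC_Icc) (use assms in \<open>auto intro!: derivative_eq_intros simp: field_simps\<close>)
  moreover have "(\<integral>\<^sup>+x. ennreal (indicator {a..b} \<bar>x\<bar> / \<bar>x\<bar>) \<partial>lborel) = 2 * (\<integral>\<^sup>+x. ennreal (indicator {a..b} x / x) * indicator {0..} x \<partial>lborel)"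
    by (rule nn_integral_even) measurable
  moreover have "(\<integral>\<^sup>+x. ennreal (indicator {a..b} x / x) * indicator {0..} x \<partial>lborel) = (\<integral>\<^sup>+x. ennreal (1 / x) * indicator {a..b} x \<partial>lborel)"
    using assms by (intro nn_integral_cong) (auto simp: indicator_def)
  moreover have "2 * ennreal (ln b - ln a) = ennreal (2 * (ln b - ln a))"
    using assms by (subst ennreal_mult) auto
  ultimately show ?thesis by simp
qed

context hausdorff_kernel
begin

text \<open>Suppose the integral \<open>I\<close> exceeds \<open>C\<close> in modulus. The test
  function has weighted integral \<open>2 * L\<close> with \<open>L = ln R\<close>, and on
  \<open>N \<le> \<bar>x\<bar> \<le> R / N\<close> its image is at least
  \<open>m * \<bar>x\<bar> powr - \<beta>\<close> with some \<open>m > C\<close>. The assumed bound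
  then gives \<open>m powr p * (L - 2 * ln N) \<le> C powr p * L\<close>, which fails for large
  \<open>L\<close>.\<close>

lemma hausdorff_lower_bound:
  assumes C: "0 \<le> C"
    and bound: "\<And>f. f \<in> borel_measurable borel \<Longrightarrow> weighted_integral p \<alpha> f < \<infinity> \<Longrightarrow> weighted_integral p \<alpha> (hausdorff f) \<le> ennreal (C powr p) * weighted_integral p \<alpha> f"
  shows "norm (\<integral>t. of_real (t powr (\<beta> - 1)) * \<phi> t \<partial>lborel) \<le> C"
proof (rule ccontr)
  let ?g = "\<lambda>t. of_real (t powr (\<beta> - 1)) * \<phi> t"
  define I where "I = (\<integral>t. ?g t \<partial>lborel)"
  have ng: "norm (?g t) = weight t" for t by (simp add: weight_def norm_mult)
  have ig: "integrable lborel ?g"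
    by (rule Bochner_Integration.integrable_bound[OF weight_integrable]) (use ng weight_nonneg in auto)
  assume "\<not> norm (\<integral>t. ?g t \<partial>lborel) \<le> C"
  then have gap: "0 < norm I - C" by (simp add: I_def)
  \<comment> \<open>The mass of the weight outside \<open>{1 / N..N}\<close> tends to 0 as
    \<open>N\<close> grows, so some \<open>N\<close> makes it smaller than the excess of
    \<open>norm I\<close> over \<open>C\<close>.\<close>
  have "(\<lambda>n. \<integral>t. weight t * (1 - indicator {1 / real (Suc n)..real (Suc n)} t) \<partial>lborel) \<longlonglongrightarrow> (\<integral>t. (0::real) \<partial>(lborel :: real measure))"
  proof (rule integral_dominated_convergence[where w = weight])
    show "AE t in lborel. (\<lambda>n. weight t * (1 - indicator {1 / real (Suc n)..real (Suc n)} t)) \<longlonglongrightarrow> 0"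
    proof (rule AE_I2)
      fix t :: real
      show "(\<lambda>n. weight t * (1 - indicator {1 / real (Suc n)..real (Suc n)} t)) \<longlonglongrightarrow> 0"
      proof (cases "t \<le> 0")
        case False
        have "\<forall>\<^sub>F n in sequentially. 1 / real (Suc n) < t"
          using LIMSEQ_Suc[OF lim_1_over_n[where 'a = real]] False by (intro order_tendstoD(2)) auto
        then have "\<forall>\<^sub>F n in sequentially. weight t * (1 - indicator {1 / real (Suc n)..real (Suc n)} t) = 0"
          using eventually_ge_at_top[of "nat \<lceil>t\<rceil>"]
        proof eventually_elim
          case (elim n)
          then have "t \<le> real (Suc n)" by linarith
          then show ?case using elim by simp
        qed
        then show ?thesis by (rule tendsto_eventually)
      qed (simp add: weight_def \<phi>_zero)
    qed
    show "AE t in lborel. norm (weight t * (1 - indicator {1 / real (Suc n)..real (Suc n)} t)) \<le> weight t" for n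
      using weight_nonneg by (intro AE_I2) (auto simp: indicator_def)
  qed (use weight_integrable in auto)
  then have "\<forall>\<^sub>F n in sequentially. (\<integral>t. weight t * (1 - indicator {1 / real (Suc n)..real (Suc n)} t) \<partial>lborel) < norm I - C"
    using gap by (intro order_tendstoD(2)) auto
  then obtain n where n: "(\<integral>t. weight t * (1 - indicator {1 / real (Suc n)..real (Suc n)} t) \<partial>lborel) < norm I - C"
    by (auto simp: eventually_sequentially)
  define N where "N = real (Suc n)"
  define \<eta> where "\<eta> = (\<integral>t. weight t * (1 - indicator {1 / N..N} t) \<partial>lborel)"
  have N: "1 \<le> N" by (simp add: N_def)
  define m where "m = norm I - \<eta>"
  have m: "C < m" using n by (simp add: m_def \<eta>_def N_def)
  have Cm: "C powr p < m powr p" using C m p by (intro powr_less_mono2) auto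
  have key: "m powr p * (L - 2 * ln N) \<le> C powr p * L" if L: "2 * ln N \<le> L" "0 \<le> L" for L
  proof -
    define R where "R = exp L"
    have R: "1 \<le> R" "ln R = L" "N * N \<le> R"
    proof -
      have "ln (N * N) \<le> L" using L N by (simp add: ln_mult)
      then have "exp (ln (N * N)) \<le> exp L" by simp
      moreover have "0 < N * N" using N by (intro mult_pos_pos) auto
      ultimately show "N * N \<le> R" unfolding R_def by simp
    qed (use L in \<open>auto simp: R_def\<close>)
    define f where "f = (\<lambda>x::real. complex_of_real (\<bar>x\<bar> powr - \<beta> * indicator {1..R} \<bar>x\<bar>))"
    have [measurable]: "f \<in> borel_measurable borel" unfolding f_def by measurable
    \<comment> \<open>Since \<open>\<beta> * p = 1 + \<alpha>\<close>, the weighted p-th power of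
      \<open>\<bar>x\<bar> powr - \<beta>\<close> is exactly \<open>1 / \<bar>x\<bar>\<close>; this
      is where the logarithms come from.\<close>
    have wt: "(\<bar>x\<bar> powr - \<beta> * c) powr p * \<bar>x\<bar> powr \<alpha> = c powr p / \<bar>x\<bar>" if "x \<noteq> 0" "0 \<le> c" for x c :: real
    proof -
      have "(\<bar>x\<bar> powr - \<beta> * c) powr p * \<bar>x\<bar> powr \<alpha> = c powr p * (\<bar>x\<bar> powr (- \<beta> * p) * \<bar>x\<bar> powr \<alpha>)"
        using that by (simp add: powr_mult powr_powr)
      also have "\<bar>x\<bar> powr (- \<beta> * p) * \<bar>x\<bar> powr \<alpha> = \<bar>x\<bar> powr (-1)"
        unfolding powr_add[symmetric] using \<beta>_p by simp
      finally show ?thesis using that by (simp add: powr_minus_divide)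
    qed
    have wf: "weighted_integral p \<alpha> f = ennreal (2 * L)"
    proof -
      have "weighted_integral p \<alpha> f = (\<integral>\<^sup>+x. ennreal (indicator {1..R} \<bar>x\<bar> / \<bar>x\<bar>) \<partial>lborel)"
        unfolding weighted_integral_def
      proof (intro nn_integral_cong)
        fix x :: real
        show "ennreal (norm (f x) powr p * \<bar>x\<bar> powr \<alpha>) = ennreal (indicator {1..R} \<bar>x\<bar> / \<bar>x\<bar>)"
          using wt[of x 1] p by (cases "\<bar>x\<bar> \<in> {1..R}") (auto simp: f_def)
      qed
      then show ?thesis using nn_integral_inverse_annulus[of 1 R] R by simp
    qed
    have hx: "\<bar>x\<bar> powr - \<beta> * m \<le> norm (hausdorff f x)" if x: "\<bar>x\<bar> \<in> {N..R / N}" for x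
    proof -
      have x0: "0 < \<bar>x\<bar>" using x N by auto
      \<comment> \<open>The support of \<open>f\<close> restricts \<open>t\<close> to this interval,
        which contains \<open>{1 / N..N}\<close> for the \<open>x\<close> under
        consideration.\<close>
      let ?i = "\<lambda>t. indicator {\<bar>x\<bar> / R..\<bar>x\<bar>} t :: real"
      have "hausdorff f x = (\<integral>t. of_real (\<bar>x\<bar> powr - \<beta>) * (of_real (?i t) * ?g t) \<partial>lborel)"
        unfolding hausdorff_def
      proof (intro Bochner_Integration.integral_cong refl)
        fix t :: real
        show "f (x / t) * (\<phi> t / of_real t) = of_real (\<bar>x\<bar> powr - \<beta>) * (of_real (?i t) * ?g t)"
        proof (cases "t \<le> 0")
          case False
          have "(\<bar>x / t\<bar> \<in> {1..R}) = (t \<in> {\<bar>x\<bar> / R..\<bar>x\<bar>})"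
            using False R by (auto simp: abs_mult field_simps)
          then have i: "indicator {1..R} \<bar>x / t\<bar> = ?i t" by (simp add: indicator_def)
          have pw: "\<bar>x / t\<bar> powr - \<beta> / t = \<bar>x\<bar> powr - \<beta> * t powr (\<beta> - 1)"
            using False by (simp add: abs_divide powr_divide powr_minus powr_diff field_simps)
          have "f (x / t) * (\<phi> t / of_real t) = of_real (\<bar>x / t\<bar> powr - \<beta> / t * ?i t) * \<phi> t"
            unfolding f_def i by simp
          then show ?thesis unfolding pw by (simp add: mult_ac)
        qed (simp add: \<phi>_zero)
      qed
      also have "\<dots> = of_real (\<bar>x\<bar> powr - \<beta>) * (\<integral>t. of_real (?i t) * ?g t \<partial>lborel)"
        by (rule integral_mult_right_zero)
      finally have h: "norm (hausdorff f x) = \<bar>x\<bar> powr - \<beta> * norm (\<integral>t. of_real (?i t) * ?g t \<partial>lborel)"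
        by (simp add: norm_mult)
      have ii: "integrable lborel (\<lambda>t. of_real (?i t) * ?g t)"
        by (rule Bochner_Integration.integrable_bound[OF ig]) (auto simp: indicator_def)
      have "norm (I - (\<integral>t. of_real (?i t) * ?g t \<partial>lborel)) = norm (\<integral>t. ?g t - of_real (?i t) * ?g t \<partial>lborel)"
        unfolding I_def by (simp only: Bochner_Integration.integral_diff[OF ig ii])
      also have "\<dots> \<le> \<eta>"
        unfolding \<eta>_def
      proof (rule Bochner_Integration.integral_norm_bound_integral)
        fix t
        have "norm (?g t - of_real (?i t) * ?g t) = (1 - ?i t) * weight t"
          using ng[of t] by (auto simp: indicator_def)
        also have "\<dots> \<le> (1 - indicator {1 / N..N} t) * weight t"
        proof (intro mult_right_mono weight_nonneg)
          have "\<bar>x\<bar> / R \<le> 1 / N" "N \<le> \<bar>x\<bar>" using x N R by (auto simp: field_simps)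
          then show "1 - ?i t \<le> 1 - indicator {1 / N..N} t" by (auto simp: indicator_def)
        qed
        finally show "norm (?g t - of_real (?i t) * ?g t) \<le> weight t * (1 - indicator {1 / N..N} t)" by (simp add: mult.commute)
      next
        show "integrable lborel (\<lambda>t. ?g t - of_real (?i t) * ?g t)" by (rule Bochner_Integration.integrable_diff[OF ig ii])
        show "integrable lborel (\<lambda>t. weight t * (1 - indicator {1 / N..N} t))"
          by (rule Bochner_Integration.integrable_bound[OF weight_integrable]) (auto simp: indicator_def)
      qed
      finally have "m \<le> norm (\<integral>t. of_real (?i t) * ?g t \<partial>lborel)"
        using norm_triangle_ineq2[of I "\<integral>t. of_real (?i t) * ?g t \<partial>lborel"] by (simp add: m_def)
      then show ?thesis unfolding h by (rule mult_left_mono) simp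
    qed
    have "ennreal (m powr p) * ennreal (2 * (ln (R / N) - ln N)) = (\<integral>\<^sup>+x. ennreal (m powr p) * ennreal (indicator {N..R / N} \<bar>x\<bar> / \<bar>x\<bar>) \<partial>lborel)"
      using N R by (subst nn_integral_cmult) (auto simp: nn_integral_inverse_annulus field_simps)
    also have "\<dots> \<le> weighted_integral p \<alpha> (hausdorff f)"
      unfolding weighted_integral_def
    proof (rule nn_integral_mono)
      fix x :: real
      show "ennreal (m powr p) * ennreal (indicator {N..R / N} \<bar>x\<bar> / \<bar>x\<bar>) \<le> ennreal (norm (hausdorff f x) powr p * \<bar>x\<bar> powr \<alpha>)"
      proof (cases "\<bar>x\<bar> \<in> {N..R / N}")
        case True
        then have x0: "x \<noteq> 0" using N by auto
        have m0: "0 \<le> m" using m C by simp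
        have "m powr p / \<bar>x\<bar> = (\<bar>x\<bar> powr - \<beta> * m) powr p * \<bar>x\<bar> powr \<alpha>" using wt[OF x0 m0] by simp
        also have "\<dots> \<le> norm (hausdorff f x) powr p * \<bar>x\<bar> powr \<alpha>"
          using hx[OF True] m0 p by (intro mult_right_mono powr_mono2) auto
        finally show ?thesis using True by (simp add: ennreal_mult[symmetric] ennreal_leI)
      qed simp
    qed
    also have "\<dots> \<le> ennreal (C powr p) * ennreal (2 * L)"
      unfolding wf[symmetric] by (rule bound) (auto simp: wf)
    finally have "ennreal (m powr p * (2 * (ln (R / N) - ln N))) \<le> ennreal (C powr p * (2 * L))"
      using N R L by (simp add: ennreal_mult[symmetric] ln_div)
    then have "m powr p * (2 * (ln (R / N) - ln N)) \<le> C powr p * (2 * L)"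
      using L by (subst (asm) ennreal_le_iff) auto
    moreover have "ln (R / N) - ln N = L - 2 * ln N" using N R by (simp add: ln_div)
    ultimately show ?thesis unfolding mult.left_commute[of _ 2] by simp
  qed
  \<comment> \<open>Solved so that \<open>(m powr p - C powr p) * L\<close> exceeds
    \<open>2 * m powr p * ln N\<close> by at least 1, while \<open>L \<ge> 2 * ln N\<close>.\<close>
  define L where "L = (2 * m powr p * ln N + 1) / (m powr p - C powr p) + 2 * ln N"
  have lnN: "0 \<le> ln N" using N by simp
  have d: "0 < m powr p - C powr p" using Cm by simp
  have pos: "0 \<le> (2 * m powr p * ln N + 1) / (m powr p - C powr p)" using d lnN by (intro divide_nonneg_nonneg add_nonneg_nonneg mult_nonneg_nonneg) auto
  have "m powr p * (L - 2 * ln N) \<le> C powr p * L" by (rule key) (use pos lnN in \<open>auto simp: L_def\<close>)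
  then have "(m powr p - C powr p) * L \<le> 2 * m powr p * ln N" by (simp add: algebra_simps)
  moreover have "(m powr p - C powr p) * L = (2 * m powr p * ln N + 1) + (m powr p - C powr p) * (2 * ln N)"
  proof -
    have "D * (X / D + Y) = X + D * Y" if "D \<noteq> 0" for D X Y :: real using that by (simp add: distrib_left)
    then show ?thesis unfolding L_def using d by simp
  qed
  moreover have "0 \<le> (m powr p - C powr p) * (2 * ln N)" using d lnN by simp
  ultimately show False by linarith
qed

end

text \<open>A Borel measurable representative of the Hilbert transform; it is meaningful only where the
  principal value exists.\<close>

definition hilbert_pv :: "(real \<Rightarrow> complex) \<Rightarrow> real \<Rightarrow> complex" where
  "hilbert_pv f x = lim (\<lambda>n. trunc_hilbert (1 / real (Suc n)) f x)"

lemma hilbert_pv_measurable [measurable]: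
  assumes [measurable]: "f \<in> borel_measurable borel"
  shows "hilbert_pv f \<in> borel_measurable borel"
  unfolding hilbert_pv_def by (rule borel_measurable_lim_metric) measurable

lemma inverse_Suc_at_right_0: "filterlim (\<lambda>n. 1 / real (Suc n)) (at_right 0) sequentially"
  unfolding filterlim_at using LIMSEQ_Suc[OF lim_1_over_n[where 'a = real]] by simp

lemma hilbert_pv_eqI:
  assumes "((\<lambda>e. trunc_hilbert e f x) \<longlongrightarrow> l) (at_right 0)"
  shows "hilbert_pv f x = l"
  unfolding hilbert_pv_def by (rule limI) (rule filterlim_compose[OF assms inverse_Suc_at_right_0])

lemma pv_exists_tendsto: "pv_exists f x \<Longrightarrow> ((\<lambda>e. trunc_hilbert e f x) \<longlongrightarrow> hilbert_pv f x) (at_right 0)"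
  unfolding pv_exists_def using hilbert_pv_eqI by blast

section \<open>Commutation with the Hilbert transform\<close>

context hausdorff_kernel
begin

text \<open>The absolute version comes first: it satisfies the same weighted bound, it dominates
  \<open>hausdorff f\<close>, and its being tempered is the integrability that Fubini's theorem
  needs below.\<close>

lemma hausdorff_tempered:
  assumes \<alpha>p: "\<alpha> < p - 1"
    and f [measurable]: "f \<in> borel_measurable borel" and fin: "weighted_integral p \<alpha> f < \<infinity>"
  shows "tempered (\<lambda>x. of_real (enn2real (hausdorff_abs f x)))" "tempered (hausdorff f)"
proof -
  have "weighted_integral p \<alpha> (\<lambda>x. of_real (enn2real (hausdorff_abs f x))) = (\<integral>\<^sup>+x. ennreal (enn2real (hausdorff_abs f x) powr p * \<bar>x\<bar> powr \<alpha>) \<partial>lborel)"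
    unfolding weighted_integral_def by simp
  also have "\<dots> \<le> ennreal (A powr p) * weighted_integral p \<alpha> f" by (rule nn_integral_hausdorff_abs_powr[OF f])
  also have "\<dots> < \<infinity>" using fin by (simp add: ennreal_mult_less_top)
  finally show s: "tempered (\<lambda>x. of_real (enn2real (hausdorff_abs f x)))"
    by (intro weighted_integral_imp_tempered[OF p \<alpha> \<alpha>p]) auto
  show "tempered (hausdorff f)" by (rule tempered_dominated[OF s]) (auto simp: norm_hausdorff_le)
qed

lemma trunc_hilbert_hausdorff:
  assumes \<alpha>p: "\<alpha> < p - 1"
    and f [measurable]: "f \<in> borel_measurable borel" and fin: "weighted_integral p \<alpha> f < \<infinity>" and e: "0 < e"
  shows "trunc_hilbert e (hausdorff f) x = (\<integral>t. trunc_hilbert (e / t) f (x / t) * (\<phi> t / of_real t) \<partial>lborel)"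
proof -
  let ?c = "\<lambda>s. if e < \<bar>x - s\<bar> then 1 / complex_of_real (x - s) else 0"
  let ?k = "\<lambda>s t. ?c s * (f (s / t) * (\<phi> t / of_real t))"
  have [measurable]: "case_prod ?k \<in> borel_measurable (lborel \<Otimes>\<^sub>M lborel)" by measurable
  have inner: "(\<integral>\<^sup>+t. ennreal (norm (?k s t)) \<partial>lborel) = ennreal (norm (?c s)) * hausdorff_abs f s" for s
  proof -
    have "(\<integral>\<^sup>+t. ennreal (norm (?k s t)) \<partial>lborel) = (\<integral>\<^sup>+t. ennreal (norm (?c s)) * ennreal (norm (f (s / t)) * (norm (\<phi> t) / t)) \<partial>lborel)"
      by (intro nn_integral_cong) (simp only: norm_mult[of "?c s"] norm_kernel ennreal_mult' norm_ge_zero)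
    also have "\<dots> = ennreal (norm (?c s)) * hausdorff_abs f s"
      unfolding hausdorff_abs_def by (rule nn_integral_cmult) measurable
    finally show ?thesis .
  qed
  \<comment> \<open>Absolute convergence of the double integral: integrating in \<open>t\<close>
    first leaves the truncated kernel against \<open>hausdorff_abs f\<close>, which is
    tempered.\<close>
  have "(\<integral>\<^sup>+s. \<integral>\<^sup>+t. ennreal (norm (?k s t)) \<partial>lborel \<partial>lborel) < \<infinity>"
  proof -
    have i: "integrable lborel (\<lambda>s. if e < \<bar>x - s\<bar> then of_real (enn2real (hausdorff_abs f s)) / complex_of_real (x - s) else 0)"
      by (rule tempered_integrable_kernel[OF hausdorff_tempered(1)[OF \<alpha>p f fin] e])
    have "(\<integral>\<^sup>+s. \<integral>\<^sup>+t. ennreal (norm (?k s t)) \<partial>lborel \<partial>lborel) = (\<integral>\<^sup>+s. ennreal (norm (?c s)) * hausdorff_abs f s \<partial>lborel)"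
      unfolding inner ..
    also have "\<dots> = (\<integral>\<^sup>+s. ennreal (norm (if e < \<bar>x - s\<bar> then of_real (enn2real (hausdorff_abs f s)) / complex_of_real (x - s) else 0)) \<partial>lborel)"
    proof (rule nn_integral_cong_AE)
      show "AE s in lborel. ennreal (norm (?c s)) * hausdorff_abs f s = ennreal (norm (if e < \<bar>x - s\<bar> then of_real (enn2real (hausdorff_abs f s)) / complex_of_real (x - s) else 0))"
        using AE_hausdorff_abs_finite[OF f fin]
      proof eventually_elim
        case (elim s)
        have h: "hausdorff_abs f s = ennreal (enn2real (hausdorff_abs f s))" using elim by simp
        show ?case by (subst h) (simp add: norm_divide ennreal_mult[symmetric] del: of_real_diff)
      qed
    qed
    also have "\<dots> < \<infinity>" using i unfolding integrable_iff_bounded by blast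
    finally show ?thesis .
  qed
  then have ik: "integrable (lborel \<Otimes>\<^sub>M lborel) (case_prod ?k)"
    by (intro integrableI_bounded) (auto simp: lborel.nn_integral_fst[symmetric])
  have "(\<integral>s. (if e < \<bar>x - s\<bar> then hausdorff f s / complex_of_real (x - s) else 0) \<partial>lborel) = (\<integral>s. \<integral>t. ?k s t \<partial>lborel \<partial>lborel)"
  proof (intro Bochner_Integration.integral_cong refl)
    fix s
    have "(\<integral>t. ?k s t \<partial>lborel) = ?c s * hausdorff f s" unfolding hausdorff_def by (rule integral_mult_right_zero)
    then show "(if e < \<bar>x - s\<bar> then hausdorff f s / complex_of_real (x - s) else 0) = (\<integral>t. ?k s t \<partial>lborel)" by simp
  qed
  also have "\<dots> = (\<integral>t. \<integral>s. ?k s t \<partial>lborel \<partial>lborel)"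
    by (rule lborel_pair.Fubini_integral[OF ik, symmetric])
  also have "\<dots> = (\<integral>t. of_real pi * (trunc_hilbert (e / t) f (x / t) * (\<phi> t / of_real t)) \<partial>lborel)"
  proof (intro Bochner_Integration.integral_cong refl)
    fix t :: real
    show "(\<integral>s. ?k s t \<partial>lborel) = of_real pi * (trunc_hilbert (e / t) f (x / t) * (\<phi> t / of_real t))"
    proof (cases "t \<le> 0")
      case False
      then have t: "0 < 1 / t" by simp
      have "(\<integral>s. ?k s t \<partial>lborel) = (\<integral>s. (if e < \<bar>x - s\<bar> then f (1 / t * s) / of_real (x - s) else 0) * (\<phi> t / of_real t) \<partial>lborel)"
        by (intro Bochner_Integration.integral_cong refl) simp
      also have "\<dots> = (\<integral>s. (if e < \<bar>x - s\<bar> then f (1 / t * s) / of_real (x - s) else 0) \<partial>lborel) * (\<phi> t / of_real t)"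
        by (rule integral_mult_left_zero)
      also have "(\<integral>s. (if e < \<bar>x - s\<bar> then f (1 / t * s) / of_real (x - s) else 0) \<partial>lborel) = of_real pi * trunc_hilbert e (\<lambda>s. f (1 / t * s)) x"
        unfolding trunc_hilbert_def by simp
      also have "trunc_hilbert e (\<lambda>s. f (1 / t * s)) x = trunc_hilbert (e / t) f (x / t)"
        using trunc_hilbert_dilation[OF t, of e f x] by simp
      finally show ?thesis by (simp add: mult.assoc)
    qed (simp add: \<phi>_zero)
  qed
  also have "\<dots> = of_real pi * (\<integral>t. trunc_hilbert (e / t) f (x / t) * (\<phi> t / of_real t) \<partial>lborel)"
    by (rule integral_mult_right_zero)
  finally show ?thesis unfolding trunc_hilbert_def[of e "hausdorff f"] by simp
qed

lemma hausdorff_hilbert_commute: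
  assumes \<alpha>p: "\<alpha> < p - 1"
    and f [measurable]: "f \<in> borel_measurable borel" and fin: "weighted_integral p \<alpha> f < \<infinity>"
  shows "AE x in lborel. integrable lborel (\<lambda>t. hilbert_pv f (x / t) * (\<phi> t / of_real t)) \<and>
    ((\<lambda>e. trunc_hilbert e (hausdorff f) x) \<longlongrightarrow> hausdorff (hilbert_pv f) x) (at_right 0)"
proof -
  have sl: "tempered f" by (rule weighted_integral_imp_tempered[OF p \<alpha> \<alpha>p f fin])
  obtain K where K: "0 \<le> K"
    "\<And>r. 0 < r \<Longrightarrow> (\<integral>\<^sup>+x. ennreal (\<bar>x\<bar> powr \<beta>) * hilbert_max f x * indicator {r..2 * r} \<bar>x\<bar> \<partial>lborel) \<le> ennreal (K * r)"
    using hilbert_max_scaled_annulus[OF p \<alpha> \<alpha>p f fin] unfolding \<beta>_def by auto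
  have "AE x in lborel. (\<integral>\<^sup>+t. hilbert_max f (x / t) * ennreal (norm (\<phi> t) / t) \<partial>lborel) < \<infinity>"
    by (rule AE_hausdorff_finite[where \<beta> = \<beta> and K = K])
      (use K \<phi>_zero \<phi>_fin in \<open>auto simp: \<beta>_def\<close>)
  moreover have "AE x in lborel. x \<noteq> (0::real)" by (rule AE_lborel_singleton)
  ultimately show ?thesis
  proof eventually_elim
    case (elim x)
    let ?k = "\<lambda>t. \<phi> t / complex_of_real t"
    let ?w = "\<lambda>t. enn2real (hilbert_max f (x / t)) * norm (?k t)"
    have w: "(\<integral>\<^sup>+t. hilbert_max f (x / t) * ennreal (norm (?k t)) \<partial>lborel) < \<infinity>"
    proof -
      have "(\<integral>\<^sup>+t. hilbert_max f (x / t) * ennreal (norm (?k t)) \<partial>lborel) = (\<integral>\<^sup>+t. hilbert_max f (x / t) * ennreal (norm (\<phi> t) / t) \<partial>lborel)"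
      proof (intro nn_integral_cong)
        fix t
        have "norm (?k t) = norm (\<phi> t) / t" by (cases "t \<le> 0") (auto simp: \<phi>_zero norm_divide)
        then show "hilbert_max f (x / t) * ennreal (norm (?k t)) = hilbert_max f (x / t) * ennreal (norm (\<phi> t) / t)" by simp
      qed
      then show ?thesis using elim by simp
    qed
    then have "AE t in lborel. hilbert_max f (x / t) * ennreal (norm (?k t)) \<noteq> \<infinity>"
      by (intro nn_integral_PInf_AE) auto
    \<comment> \<open>Passing to real values loses nothing: finiteness of the product forces a
      finite maximal function or a vanishing kernel.\<close>
    then have hw: "AE t in lborel. hilbert_max f (x / t) * ennreal (norm (?k t)) = ennreal (?w t)"
    proof eventually_elim
      case (elim t)
      show ?case
      proof (cases "hilbert_max f (x / t)")
        case (real r)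
        then show ?thesis by (simp add: ennreal_mult)
      next
        case top
        then have "norm (?k t) = 0" using elim by (auto simp: ennreal_top_mult split: if_splits)
        then show ?thesis by (simp only: ennreal_0 mult_zero_right)
      qed
    qed
    have iw: "integrable lborel ?w"
    proof (rule integrableI_nonneg)
      have "(\<integral>\<^sup>+t. ennreal (?w t) \<partial>lborel) = (\<integral>\<^sup>+t. hilbert_max f (x / t) * ennreal (norm (?k t)) \<partial>lborel)"
        by (rule nn_integral_cong_AE) (use hw in \<open>auto elim!: eventually_mono\<close>)
      then show "(\<integral>\<^sup>+t. ennreal (?w t) \<partial>lborel) < \<infinity>" using w by simp
    qed auto
    \<comment> \<open>The quantifier over \<open>e\<close> stands inside, so one null set serves
      every sequence of truncation levels.\<close>
    have bound: "AE t in lborel. \<forall>e>0. norm (trunc_hilbert (e / t) f (x / t) * ?k t) \<le> ?w t"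
      using hw
    proof eventually_elim
      case (elim t)
      show ?case
      proof (intro allI impI)
        fix e :: real assume e: "0 < e"
        show "norm (trunc_hilbert (e / t) f (x / t) * ?k t) \<le> ?w t"
        proof (cases "t \<le> 0")
          case False
          then have "ennreal (norm (trunc_hilbert (e / t) f (x / t))) \<le> hilbert_max f (x / t)"
            using e by (intro trunc_hilbert_le_hilbert_max sl) auto
          then have "ennreal (norm (trunc_hilbert (e / t) f (x / t))) * ennreal (norm (?k t)) \<le> hilbert_max f (x / t) * ennreal (norm (?k t))"
            by (rule mult_right_mono) simp
          then have "ennreal (norm (trunc_hilbert (e / t) f (x / t) * ?k t)) \<le> ennreal (?w t)"
            unfolding elim by (simp only: norm_mult ennreal_mult norm_ge_zero)
          then show ?thesis by (subst (asm) ennreal_le_iff) auto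
        qed (simp add: \<phi>_zero)
      qed
    qed
    \<comment> \<open>As \<open>x\<close> is not 0, almost every positive \<open>t\<close> sends
      \<open>x / t\<close> outside the null set where the principal value fails to exist.\<close>
    have pv: "AE t in lborel. 0 < t \<longrightarrow> pv_exists f (x / t)"
      using pv_exists_weighted[OF p \<alpha> \<alpha>p f fin] elim by (intro AE_lborel_inversion) auto
    have conv: "integrable lborel (\<lambda>t. hilbert_pv f (x / t) * ?k t) \<and>
      (\<lambda>n. \<integral>t. trunc_hilbert (S n / t) f (x / t) * ?k t \<partial>lborel) \<longlonglongrightarrow> (\<integral>t. hilbert_pv f (x / t) * ?k t \<partial>lborel)"
      if S: "\<And>n. 0 < S n" "S \<longlonglongrightarrow> 0" for S
    proof -
      have m1: "(\<lambda>t. hilbert_pv f (x / t) * ?k t) \<in> borel_measurable lborel" by measurable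
      have m2: "(\<lambda>t. trunc_hilbert (S n / t) f (x / t) * ?k t) \<in> borel_measurable lborel" for n
      proof -
        have "(\<lambda>t. \<integral>v. (if S n / t < \<bar>x / t - v\<bar> then f v / of_real (x / t - v) else 0) \<partial>lborel) \<in> borel_measurable lborel"
          by (rule lborel.borel_measurable_lebesgue_integral) measurable
        then show ?thesis unfolding trunc_hilbert_def by measurable
      qed
      have lim: "AE t in lborel. (\<lambda>n. trunc_hilbert (S n / t) f (x / t) * ?k t) \<longlonglongrightarrow> hilbert_pv f (x / t) * ?k t"
        using pv
      proof eventually_elim
        case (elim t)
        show ?case
        proof (cases "t \<le> 0")
          case False
          have "(\<lambda>n. S n / t) \<longlonglongrightarrow> 0 / t" using False by (intro tendsto_divide S(2) tendsto_const) auto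
          then have "filterlim (\<lambda>n. S n / t) (at_right 0) sequentially"
            unfolding filterlim_at using False S(1) by (auto simp: less_imp_neq[symmetric])
          from filterlim_compose[OF pv_exists_tendsto this] elim False
          have "(\<lambda>n. trunc_hilbert (S n / t) f (x / t)) \<longlonglongrightarrow> hilbert_pv f (x / t)" by simp
          then show ?thesis by (rule tendsto_mult_right)
        qed (simp add: \<phi>_zero)
      qed
      have bd: "AE t in lborel. norm (trunc_hilbert (S n / t) f (x / t) * ?k t) \<le> ?w t" for n
        using bound by eventually_elim (use S(1) in blast)
      show ?thesis
        using integrable_dominated_convergence[OF m1 m2 iw lim bd] integral_dominated_convergence[OF m1 m2 iw lim bd] by blast
    qed
    have "integrable lborel (\<lambda>t. hilbert_pv f (x / t) * ?k t)"
      using conv[of "\<lambda>n. 1 / real (Suc n)"] LIMSEQ_Suc[OF lim_1_over_n[where 'a = real]] by simp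
    \<comment> \<open>Dominated convergence is sequential, so the limit at 0 from the right is
      tested along arbitrary positive null sequences.\<close>
    moreover have "((\<lambda>e. trunc_hilbert e (hausdorff f) x) \<longlongrightarrow> hausdorff (hilbert_pv f) x) (at_right 0)"
    proof (rule tendsto_at_right_sequentially[of _ 1])
      fix S :: "nat \<Rightarrow> real" assume S: "\<And>n. 0 < S n" "S \<longlonglongrightarrow> 0"
      show "(\<lambda>n. trunc_hilbert (S n) (hausdorff f) x) \<longlonglongrightarrow> hausdorff (hilbert_pv f) x"
        unfolding trunc_hilbert_hausdorff[OF \<alpha>p f fin S(1)] hausdorff_def[of "hilbert_pv f"] using conv[of S] S by blast
    qed simp
    ultimately show ?case by blast
  qed
qed

end

section \<open>Transfer to Lebesgue measurable functions\<close>

text \<open>In the completion all subsets of null sets are measurable, so a Borel function may be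
  altered on one. This gives measurability of the values of \<open>hausdorff_op\<close>, which are
  identified with a Borel function only almost everywhere.\<close>

lemma borel_measurable_lebesgue_AE:
  fixes F F' :: "real \<Rightarrow> complex"
  assumes ae: "AE x in lborel. F x = F' x" and F' [measurable]: "F' \<in> borel_measurable borel"
  shows "F \<in> borel_measurable lebesgue"
proof (rule measurableI)
  fix B :: "complex set" assume B: "B \<in> sets borel"
  have m: "F' -` B \<inter> space lebesgue \<in> sets lebesgue"
    using measurable_completion[of F' lborel borel] B by (intro measurable_sets) auto
  have "AE x in lebesgue. F x = F' x" using ae by (rule AE_completion)
  then have "AE x in lebesgue. x \<in> F' -` B \<inter> space lebesgue \<longleftrightarrow> x \<in> F -` B \<inter> space lebesgue"
    by eventually_elim simp
  then show "F -` B \<inter> space lebesgue \<in> sets lebesgue"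
    using m by (rule completion.in_sets_AE) simp
qed simp

lemma
  fixes F F' :: "real \<Rightarrow> complex"
  assumes ae: "AE x in lborel. F x = F' x" and F' [measurable]: "F' \<in> borel_measurable borel"
  shows integrable_lebesgue_AE: "integrable lebesgue F \<longleftrightarrow> integrable lborel F'"
    and integral_lebesgue_AE: "(\<integral>x. F x \<partial>lebesgue) = (\<integral>x. F' x \<partial>lborel)"
proof -
  have F: "F \<in> borel_measurable lebesgue" by (rule borel_measurable_lebesgue_AE[OF ae F'])
  have F'l: "F' \<in> borel_measurable lebesgue" by (rule measurable_completion) simp
  have ae': "AE x in lebesgue. F x = F' x" using ae by (rule AE_completion)
  show "integrable lebesgue F \<longleftrightarrow> integrable lborel F'"
    using integrable_cong_AE[OF F F'l ae'] integrable_completion[of F' lborel] by simp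
  show "(\<integral>x. F x \<partial>lebesgue) = (\<integral>x. F' x \<partial>lborel)"
    using integral_cong_AE[OF F F'l ae'] integral_completion[of F' lborel] by simp
qed

lemma lebesgue_borel_version:
  fixes f :: "real \<Rightarrow> complex"
  assumes f: "f \<in> borel_measurable lebesgue"
  obtains f' where "f' \<in> borel_measurable borel" "AE x in lborel. f x = f' x"
proof -
  have "(\<lambda>x. Re (f x)) \<in> borel_measurable lebesgue" "(\<lambda>x. Im (f x)) \<in> borel_measurable lebesgue"
    using f by (auto intro: measurable_compose[OF f])
  then obtain a b where a: "a \<in> borel_measurable lborel" "AE x in lborel. Re (f x) = a x"
    and b: "b \<in> borel_measurable lborel" "AE x in lborel. Im (f x) = b x"
    by (metis completion_ex_borel_measurable_real)
  show ?thesis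
  proof (rule that[of "\<lambda>x. Complex (a x) (b x)"])
    show "(\<lambda>x. Complex (a x) (b x)) \<in> borel_measurable borel"
      using a(1) b(1) unfolding Complex_eq by simp
    show "AE x in lborel. f x = Complex (a x) (b x)"
      using a(2) b(2) by eventually_elim (simp add: complex_eq_iff)
  qed
qed

lemma nn_integral_power_weight:
  assumes f: "f \<in> borel_measurable lebesgue" and ae: "AE x in lborel. f x = f' x"
  shows "(\<integral>\<^sup>+x. ennreal (norm (f x) powr p) \<partial>power_weight \<alpha>) = weighted_integral p \<alpha> f'"
proof -
  have "(\<integral>\<^sup>+x. ennreal (norm (f x) powr p) \<partial>power_weight \<alpha>) = (\<integral>\<^sup>+x. ennreal (\<bar>x\<bar> powr \<alpha>) * ennreal (norm (f x) powr p) \<partial>lebesgue)"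
    unfolding power_weight_def
  proof (rule nn_integral_density)
    show "(\<lambda>x. ennreal (\<bar>x\<bar> powr \<alpha>)) \<in> borel_measurable lebesgue" by (rule measurable_completion) simp
    show "(\<lambda>x. ennreal (norm (f x) powr p)) \<in> borel_measurable lebesgue" using f by (auto intro: measurable_compose[OF f])
  qed
  also have "\<dots> = (\<integral>\<^sup>+x. ennreal (\<bar>x\<bar> powr \<alpha>) * ennreal (norm (f x) powr p) \<partial>lborel)"
    by (rule nn_integral_completion)
  also have "\<dots> = weighted_integral p \<alpha> f'"
    unfolding weighted_integral_def
    by (rule nn_integral_cong_AE) (use ae in \<open>auto elim!: eventually_mono simp: ennreal_mult mult.commute\<close>)
  finally show ?thesis .
qed

lemma
  assumes f: "f \<in> borel_measurable lebesgue" and ae: "AE x in lborel. f x = f' x"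
  shows Lp_space_iff_weighted_integral: "f \<in> Lp_space p \<alpha> \<longleftrightarrow> weighted_integral p \<alpha> f' < \<infinity>"
    and Lp_norm_weighted_integral: "Lp_norm p \<alpha> f = enn2real (weighted_integral p \<alpha> f') powr (1 / p)"
proof -
  have m: "(\<lambda>x. norm (f x) powr p) \<in> borel_measurable (power_weight \<alpha>)"
    unfolding power_weight_def using f by (auto intro: measurable_compose[OF f])
  show "f \<in> Lp_space p \<alpha> \<longleftrightarrow> weighted_integral p \<alpha> f' < \<infinity>"
    unfolding Lp_space_def using f m nn_integral_power_weight[OF f ae, where p = p and \<alpha> = \<alpha>]
    by (simp add: integrable_iff_bounded)
  show "Lp_norm p \<alpha> f = enn2real (weighted_integral p \<alpha> f') powr (1 / p)"
    unfolding Lp_norm_def using nn_integral_power_weight[OF f ae, where p = p and \<alpha> = \<alpha>] m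
    by (subst integral_eq_nn_integral) auto
qed

lemma set_integral_Ioi_AE:
  fixes h :: "real \<Rightarrow> complex"
  assumes "AE t in lborel. 0 < t \<longrightarrow> h t = k t" "k \<in> borel_measurable borel" "\<And>t. t \<le> 0 \<Longrightarrow> k t = 0"
  shows "set_integrable lebesgue {0<..} h \<longleftrightarrow> integrable lborel k"
    and "(LINT t:{0<..}|lebesgue. h t) = (\<integral>t. k t \<partial>lborel)"
proof -
  have "AE t in lborel. indicator {0<..} t *\<^sub>R h t = k t"
    using assms(1) by eventually_elim (use assms(3) in \<open>auto simp: indicator_def\<close>)
  from integrable_lebesgue_AE[OF this assms(2)] integral_lebesgue_AE[OF this assms(2)]
  show "set_integrable lebesgue {0<..} h \<longleftrightarrow> integrable lborel k"
    "(LINT t:{0<..}|lebesgue. h t) = (\<integral>t. k t \<partial>lborel)"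
    unfolding set_integrable_def set_lebesgue_integral_def by auto
qed

lemma
  fixes f f' :: "real \<Rightarrow> complex"
  assumes ae: "AE x in lborel. f x = f' x" and f' [measurable]: "f' \<in> borel_measurable borel"
  shows truncated_hilbert_eq_trunc: "truncated_hilbert e f x = trunc_hilbert e f' x"
    and set_integrable_hilbert_kernel:
      "tempered f' \<Longrightarrow> 0 < e \<Longrightarrow> set_integrable lebesgue {y. e < \<bar>y\<bar>} (\<lambda>y. f (x - y) / of_real y)"
proof -
  let ?k = "\<lambda>t. if e < \<bar>x - t\<bar> then f' t / complex_of_real (x - t) else 0"
  \<comment> \<open>The reflection \<open>y \<mapsto> x - y\<close> preserves null sets, so
    \<open>f\<close> may be replaced by its Borel representative under the integral at every
    \<open>x\<close>, not merely at almost every one.\<close>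
  have ae': "AE y in lborel. indicator {y. e < \<bar>y\<bar>} y *\<^sub>R (f (x - y) / of_real y) = ?k (x + (-1) * y)"
    using AE_lborel_affine[OF ae, of "-1" x] by simp (auto elim!: eventually_mono simp: indicator_def)
  have m: "(\<lambda>y. ?k (x + (-1) * y)) \<in> borel_measurable borel" by measurable
  have "(\<integral>y. indicator {y. e < \<bar>y\<bar>} y *\<^sub>R (f (x - y) / of_real y) \<partial>lebesgue) = (\<integral>y. ?k (x + (-1) * y) \<partial>lborel)"
    by (rule integral_lebesgue_AE[OF ae' m])
  also have "\<dots> = (\<integral>t. ?k t \<partial>lborel)"
    using lborel_integral_real_affine[of "-1" ?k x] by simp
  finally show "truncated_hilbert e f x = trunc_hilbert e f' x"
    unfolding truncated_hilbert_def trunc_hilbert_def set_lebesgue_integral_def by simp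
  assume "tempered f'" "0 < e"
  then have "integrable lborel (\<lambda>y. ?k (x + (-1) * y))"
    by (intro lborel_integrable_real_affine tempered_integrable_kernel) auto
  then show "set_integrable lebesgue {y. e < \<bar>y\<bar>} (\<lambda>y. f (x - y) / of_real y)"
    unfolding set_integrable_def integrable_lebesgue_AE[OF ae' m] .
qed

lemma
  assumes ae: "AE x in lborel. f x = f' x" and sl: "tempered f'" and pv: "pv_exists f' x"
  shows hilbert_defined_atI: "hilbert_defined_at f x"
    and hilbert_transform_eq_hilbert_pv: "hilbert_transform f x = hilbert_pv f' x"
proof -
  note f' = tempered_measurable[OF sl]
  have t: "(\<lambda>e. truncated_hilbert e f x) = (\<lambda>e. trunc_hilbert e f' x)"
    by (rule ext) (rule truncated_hilbert_eq_trunc[OF ae f'])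
  show "hilbert_defined_at f x"
    unfolding hilbert_defined_at_def t using set_integrable_hilbert_kernel[OF ae f' sl] pv
    by (auto simp: pv_exists_def)
  show "hilbert_transform f x = hilbert_pv f' x"
    unfolding hilbert_transform_def t by (rule tendsto_Lim) (auto intro: pv_exists_tendsto[OF pv])
qed

text \<open>The integral condition is insensitive to null sets, so it passes to a Borel
  representative; setting that to 0 off the positive half line gives the normalization of the
  locale.\<close>

lemma hausdorff_kernel_version:
  fixes p \<alpha> :: real and \<phi> :: "real \<Rightarrow> complex"
  assumes p: "1 < p" and \<alpha>: "-1 < \<alpha>"
    and meas: "\<phi> \<in> borel_measurable (restrict_space lebesgue {0<..})"
    and fin: "(\<integral>\<^sup>+t\<in>{0<..}. ennreal (t powr ((1 + \<alpha>) / p - 1) * norm (\<phi> t)) \<partial>lebesgue) < \<infinity>"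
  obtains \<psi> where "hausdorff_kernel p \<alpha> \<psi>" "AE t in lborel. 0 < t \<longrightarrow> \<phi> t = \<psi> t"
proof -
  have "(\<lambda>t. indicator {0<..} t *\<^sub>R \<phi> t) \<in> borel_measurable lebesgue"
    using meas by (subst (asm) borel_measurable_restrict_space_iff) auto
  then obtain \<xi> where \<xi> [measurable]: "\<xi> \<in> borel_measurable borel" "AE t in lborel. indicator {0<..} t *\<^sub>R \<phi> t = \<xi> t"
    by (rule lebesgue_borel_version)
  define \<psi> where "\<psi> = (\<lambda>t. if 0 < t then \<xi> t else 0)"
  have [measurable]: "\<psi> \<in> borel_measurable borel" unfolding \<psi>_def by measurable
  have ae: "AE t in lborel. 0 < t \<longrightarrow> \<phi> t = \<psi> t"
    using \<xi>(2) by eventually_elim (auto simp: \<psi>_def)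
  have "(\<integral>\<^sup>+t. ennreal (t powr ((1 + \<alpha>) / p - 1) * norm (\<psi> t)) \<partial>lborel) = (\<integral>\<^sup>+t\<in>{0<..}. ennreal (t powr ((1 + \<alpha>) / p - 1) * norm (\<phi> t)) \<partial>lborel)"
    by (rule nn_integral_cong_AE) (use ae in \<open>auto elim!: eventually_mono simp: \<psi>_def indicator_def\<close>)
  also have "\<dots> < \<infinity>" using fin by (simp add: nn_integral_completion)
  finally have "hausdorff_kernel p \<alpha> \<psi>"
    by unfold_locales (use p \<alpha> in \<open>auto simp: \<psi>_def\<close>)
  then show ?thesis using ae by (rule that)
qed

context hausdorff_kernel
begin

text \<open>For fixed \<open>x \<noteq> 0\<close> the map \<open>t \<mapsto> x / t\<close> pulls
  null sets back to null sets, so changing \<open>f\<close> on a null set affects neither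
  convergence nor value at any such \<open>x\<close>.\<close>

lemma
  assumes k: "AE t in lborel. 0 < t \<longrightarrow> \<psi> t = \<phi> t"
    and ae: "AE x in lborel. f x = f' x" and f' [measurable]: "f' \<in> borel_measurable borel" and x: "x \<noteq> 0"
  shows hausdorff_defined_at_iff: "hausdorff_defined_at \<psi> f x \<longleftrightarrow> integrable lborel (\<lambda>t. f' (x / t) * (\<phi> t / of_real t))"
    and hausdorff_op_eq_hausdorff: "hausdorff_op \<psi> f x = hausdorff f' x"
proof -
  have 1: "AE t in lborel. 0 < t \<longrightarrow> f (x / t) * (\<psi> t / of_real t) = f' (x / t) * (\<phi> t / of_real t)"
    using k AE_lborel_inversion[OF ae x] by eventually_elim auto
  have 2: "(\<lambda>t. f' (x / t) * (\<phi> t / of_real t)) \<in> borel_measurable borel" by measurable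
  have 3: "f' (x / t) * (\<phi> t / of_real t) = 0" if "t \<le> 0" for t using that by (simp add: \<phi>_zero)
  show "hausdorff_defined_at \<psi> f x \<longleftrightarrow> integrable lborel (\<lambda>t. f' (x / t) * (\<phi> t / of_real t))"
    unfolding hausdorff_defined_at_def by (rule set_integral_Ioi_AE(1)[OF 1 2 3])
  show "hausdorff_op \<psi> f x = hausdorff f' x"
    unfolding hausdorff_op_def hausdorff_def by (rule set_integral_Ioi_AE(2)[OF 1 2 3])
qed

lemma hausdorff_cmult: "hausdorff (\<lambda>u. c * f u) x = c * hausdorff f x"
  unfolding hausdorff_def by (simp only: mult.assoc integral_mult_right_zero)

end

section \<open>Passage to the stated operators and to the operator norm\<close>

theorem theorem1p5:
  fixes p \<alpha> :: real and \<phi> :: "real \<Rightarrow> complex"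
  assumes p: "1 < p" and \<alpha>: "-1 < \<alpha>"
    and meas: "\<phi> \<in> borel_measurable (restrict_space lebesgue {0<..})"
    and fin: "(\<integral>\<^sup>+t\<in>{0<..}. ennreal (t powr ((1 + \<alpha>) / p - 1) * norm (\<phi> t)) \<partial>lebesgue) < \<infinity>"
  shows "(\<forall>f\<in>Lp_space p \<alpha>. AE x in lebesgue. hausdorff_defined_at \<phi> f x) \<and>
         bounded_on_Lp p \<alpha> (hausdorff_op \<phi>) \<and>
         norm (LINT t:{0<..}|lebesgue. of_real (t powr ((1 + \<alpha>) / p - 1)) * \<phi> t)
           \<le> Lp_opnorm p \<alpha> (hausdorff_op \<phi>) \<and>
         Lp_opnorm p \<alpha> (hausdorff_op \<phi>)
           \<le> (LINT t:{0<..}|lebesgue. t powr ((1 + \<alpha>) / p - 1) * norm (\<phi> t)) \<and>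
         (\<alpha> < p - 1 \<longrightarrow>
           (\<forall>f\<in>Lp_space p \<alpha>. AE x in lebesgue.
              hilbert_defined_at f x \<and>
              hilbert_defined_at (hausdorff_op \<phi> f) x \<and>
              hausdorff_defined_at \<phi> (hilbert_transform f) x \<and>
              hilbert_transform (hausdorff_op \<phi> f) x = hausdorff_op \<phi> (hilbert_transform f) x))"
proof -
  obtain \<psi> where \<psi>: "hausdorff_kernel p \<alpha> \<psi>" and k: "AE t in lborel. 0 < t \<longrightarrow> \<phi> t = \<psi> t"
    using hausdorff_kernel_version[OF p \<alpha> meas fin] by blast
  interpret hausdorff_kernel p \<alpha> \<psi> by (rule \<psi>)
  let ?T = "hausdorff_op \<phi>"
  have ne0: "AE x in lborel. x \<noteq> (0::real)" by (rule AE_lborel_singleton)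
  have version: "\<exists>f'. f' \<in> borel_measurable borel \<and> (AE x in lborel. f x = f' x) \<and> weighted_integral p \<alpha> f' < \<infinity> \<and>
      Lp_norm p \<alpha> f = enn2real (weighted_integral p \<alpha> f') powr (1 / p)" if f: "f \<in> Lp_space p \<alpha>" for f
  proof -
    have fm: "f \<in> borel_measurable lebesgue" using f by (simp add: Lp_space_def)
    obtain f' where f': "f' \<in> borel_measurable borel" "AE x in lborel. f x = f' x"
      using lebesgue_borel_version[OF fm] by blast
    then show ?thesis using Lp_space_iff_weighted_integral[OF fm f'(2)] Lp_norm_weighted_integral[OF fm f'(2)] f by auto
  qed
  have T_ae: "AE x in lborel. ?T f x = hausdorff f' x" if "AE x in lborel. f x = f' x" "f' \<in> borel_measurable borel" for f f'
    using ne0 by eventually_elim (rule hausdorff_op_eq_hausdorff[OF k that])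
  have defined: "AE x in lborel. hausdorff_defined_at \<phi> f x" if f: "f \<in> Lp_space p \<alpha>" for f
  proof -
    obtain f' where f': "f' \<in> borel_measurable borel" "AE x in lborel. f x = f' x" "weighted_integral p \<alpha> f' < \<infinity>"
      using version[OF f] by auto
    from AE_hausdorff_abs_finite[OF f'(1,3)] ne0 show ?thesis
    proof eventually_elim
      case (elim x)
      then show ?case using hausdorff_defined_at_iff[OF k f'(2,1)] hausdorff_integrable_iff[OF f'(1)] by blast
    qed
  qed
  have T_Lp: "?T f \<in> Lp_space p \<alpha> \<and> Lp_norm p \<alpha> (?T f) = enn2real (weighted_integral p \<alpha> (hausdorff f')) powr (1 / p)"
    if f': "f' \<in> borel_measurable borel" "AE x in lborel. f x = f' x" "weighted_integral p \<alpha> f' < \<infinity>" for f f'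
  proof -
    have m: "?T f \<in> borel_measurable lebesgue"
      by (rule borel_measurable_lebesgue_AE[OF T_ae[OF f'(2,1)] hausdorff_measurable[OF f'(1)]])
    have "weighted_integral p \<alpha> (hausdorff f') < \<infinity>"
      using le_less_trans[OF weighted_integral_hausdorff_le[OF f'(1)]] f'(3) by (simp add: ennreal_mult_less_top)
    then show ?thesis
      using Lp_space_iff_weighted_integral[OF m T_ae[OF f'(2,1)]] Lp_norm_weighted_integral[OF m T_ae[OF f'(2,1)]] by simp
  qed
  have T_bound: "Lp_norm p \<alpha> (?T f) \<le> A * Lp_norm p \<alpha> f" if f: "f \<in> Lp_space p \<alpha>" for f
  proof -
    obtain f' where f': "f' \<in> borel_measurable borel" "AE x in lborel. f x = f' x" "weighted_integral p \<alpha> f' < \<infinity>"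
      "Lp_norm p \<alpha> f = enn2real (weighted_integral p \<alpha> f') powr (1 / p)"
      using version[OF f] by auto
    have "enn2real (weighted_integral p \<alpha> (hausdorff f')) \<le> enn2real (ennreal (A powr p) * weighted_integral p \<alpha> f')"
      using weighted_integral_hausdorff_le[OF f'(1)] f'(3) by (intro enn2real_mono) (auto simp: ennreal_mult_less_top)
    also have "\<dots> = A powr p * enn2real (weighted_integral p \<alpha> f')" by (simp add: enn2real_mult)
    finally have "enn2real (weighted_integral p \<alpha> (hausdorff f')) powr (1 / p) \<le> (A powr p * enn2real (weighted_integral p \<alpha> f')) powr (1 / p)"
      using p by (intro powr_mono2) auto
    also have "\<dots> = A * enn2real (weighted_integral p \<alpha> f') powr (1 / p)"
      using p A_nonneg by (simp add: powr_mult powr_powr)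
    finally show ?thesis using T_Lp[OF f'(1,2,3)] f'(4) by simp
  qed
  have linear: "AE x in lborel. ?T (\<lambda>y. a * f y + b * g y) x = a * ?T f x + b * ?T g x"
    if "f \<in> Lp_space p \<alpha>" "g \<in> Lp_space p \<alpha>" for f g a b
    using defined[OF that(1)] defined[OF that(2)]
  proof eventually_elim
    case (elim x)
    let ?k = "\<lambda>t. indicator {0<..} t *\<^sub>R (f (x / t) * (\<phi> t / of_real t))"
    let ?l = "\<lambda>t. indicator {0<..} t *\<^sub>R (g (x / t) * (\<phi> t / of_real t))"
    have i: "integrable lebesgue ?k" "integrable lebesgue ?l"
      using elim unfolding hausdorff_defined_at_def set_integrable_def by auto
    have "?T (\<lambda>y. a * f y + b * g y) x = (\<integral>t. a * ?k t + b * ?l t \<partial>lebesgue)"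
      unfolding hausdorff_op_def set_lebesgue_integral_def
      by (intro Bochner_Integration.integral_cong refl) (auto simp: indicator_def algebra_simps)
    also have "\<dots> = (\<integral>t. a * ?k t \<partial>lebesgue) + (\<integral>t. b * ?l t \<partial>lebesgue)"
      by (rule Bochner_Integration.integral_add[OF integrable_mult_right[OF i(1)] integrable_mult_right[OF i(2)]])
    also have "\<dots> = a * ?T f x + b * ?T g x"
      unfolding hausdorff_op_def set_lebesgue_integral_def by (simp only: integral_mult_right_zero)
    finally show ?case .
  qed
  define S where "S = {f \<in> Lp_space p \<alpha>. Lp_norm p \<alpha> f \<le> 1}"
  define C where "C = Lp_opnorm p \<alpha> ?T"
  have C_eq: "C = (SUP f\<in>S. Lp_norm p \<alpha> (?T f))" by (simp add: C_def Lp_opnorm_def S_def)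
  have S_le: "Lp_norm p \<alpha> (?T f) \<le> A" if "f \<in> S" for f
  proof -
    have "Lp_norm p \<alpha> (?T f) \<le> A * Lp_norm p \<alpha> f" using that by (intro T_bound) (simp add: S_def)
    also have "\<dots> \<le> A * 1" using that A_nonneg by (intro mult_left_mono) (auto simp: S_def)
    finally show ?thesis by simp
  qed
  \<comment> \<open>A supremum of reals is meaningful only for a bounded nonempty set:
    \<open>S_le\<close> gives the bound, and the zero function shows that \<open>S\<close> is
    nonempty.\<close>
  have bdd: "bdd_above ((\<lambda>f. Lp_norm p \<alpha> (?T f)) ` S)" using S_le by (auto intro!: bdd_aboveI)
  have zero: "(\<lambda>_. 0) \<in> S"
  proof -
    have "(\<lambda>_. 0::complex) \<in> borel_measurable lebesgue" by simp
    from Lp_space_iff_weighted_integral[OF this, of "\<lambda>_. 0" p \<alpha>] Lp_norm_weighted_integral[OF this, of "\<lambda>_. 0" p \<alpha>] p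
    show ?thesis by (simp add: S_def weighted_integral_def)
  qed
  have C_le: "C \<le> A" unfolding C_eq using zero S_le by (intro cSUP_least) auto
  have C0: "0 \<le> C"
  proof -
    have "0 \<le> Lp_norm p \<alpha> (?T (\<lambda>_. 0))" by (simp add: Lp_norm_def)
    also have "\<dots> \<le> C" unfolding C_eq by (rule cSUP_upper[OF zero bdd])
    finally show ?thesis .
  qed
  have lower: "norm (\<integral>t. of_real (t powr (\<beta> - 1)) * \<psi> t \<partial>lborel) \<le> C"
  proof (rule hausdorff_lower_bound[OF C0])
    fix f :: "real \<Rightarrow> complex" assume f [measurable]: "f \<in> borel_measurable borel" and wf: "weighted_integral p \<alpha> f < \<infinity>"
    obtain W where W: "0 \<le> W" "weighted_integral p \<alpha> f = ennreal W" using wf by (cases "weighted_integral p \<alpha> f") auto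
    show "weighted_integral p \<alpha> (hausdorff f) \<le> ennreal (C powr p) * weighted_integral p \<alpha> f"
    \<comment> \<open>The supremum controls the unit ball only; scaling \<open>f\<close> by
      \<open>c\<close> to weighted integral 1 extends the bound to all functions. For
      \<open>W = 0\<close> no such scaling exists, but the upper bound already gives 0.\<close>
    proof (cases "W = 0")
      case True
      then show ?thesis using weighted_integral_hausdorff_le[OF f] W by simp
    next
      case False
      then have W0: "0 < W" using W by simp
      define c where "c = W powr (- (1 / p))"
      have c: "0 < c" using W0 by (simp add: c_def)
      have cp: "c powr p = 1 / W" unfolding c_def using p W0 by (simp only: powr_powr) (simp add: powr_minus_divide)
      define g where "g = (\<lambda>u. of_real c * f u)"
      have g [measurable]: "g \<in> borel_measurable borel" unfolding g_def by measurable
      have wg: "weighted_integral p \<alpha> g = 1"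
        unfolding g_def using c W W0 by (subst weighted_integral_cmult) (auto simp: cp ennreal_mult'[symmetric])
      have gl: "g \<in> borel_measurable lebesgue" by (rule measurable_completion) simp
      have "g \<in> S"
        unfolding S_def using Lp_space_iff_weighted_integral[OF gl, of g p \<alpha>] Lp_norm_weighted_integral[OF gl, of g p \<alpha>] by (simp add: wg)
      then have "Lp_norm p \<alpha> (?T g) \<le> C" unfolding C_eq using bdd by (intro cSUP_upper) auto
      then have le: "enn2real (weighted_integral p \<alpha> (hausdorff g)) powr (1 / p) \<le> C"
        using T_Lp[OF g, of g] by (simp add: wg)
      have hg: "weighted_integral p \<alpha> (hausdorff g) = ennreal (1 / W) * weighted_integral p \<alpha> (hausdorff f)"
      proof -
        have "hausdorff g = (\<lambda>x. of_real c * hausdorff f x)" unfolding g_def by (rule ext) (rule hausdorff_cmult)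
        then show ?thesis using c by (simp add: weighted_integral_cmult cp)
      qed
      have "weighted_integral p \<alpha> (hausdorff f) < \<infinity>"
        using le_less_trans[OF weighted_integral_hausdorff_le[OF f]] wf by (simp add: ennreal_mult_less_top)
      then obtain V where V: "0 \<le> V" "weighted_integral p \<alpha> (hausdorff f) = ennreal V" by (cases "weighted_integral p \<alpha> (hausdorff f)") auto
      have "(V / W) powr (1 / p) \<le> C"
        using le W0 V unfolding hg by (simp add: ennreal_mult'[symmetric])
      then have "((V / W) powr (1 / p)) powr p \<le> C powr p" using p by (intro powr_mono2) auto
      then have "V / W \<le> C powr p" using p V W0 by (simp add: powr_powr)
      then have "V \<le> C powr p * W" using W0 by (simp add: field_simps)
      then show ?thesis unfolding V W by (simp add: ennreal_mult'[symmetric] ennreal_leI)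
    qed
  qed
  have lower_eq: "(LINT t:{0<..}|lebesgue. of_real (t powr ((1 + \<alpha>) / p - 1)) * \<phi> t) = (\<integral>t. of_real (t powr (\<beta> - 1)) * \<psi> t \<partial>lborel)"
    unfolding \<beta>_def
  proof (rule set_integral_Ioi_AE(2))
    show "AE t in lborel. 0 < t \<longrightarrow> of_real (t powr ((1 + \<alpha>) / p - 1)) * \<phi> t = of_real (t powr ((1 + \<alpha>) / p - 1)) * \<psi> t"
      using k by eventually_elim simp
  qed (auto simp: \<phi>_zero)
  have upper_eq: "(LINT t:{0<..}|lebesgue. t powr ((1 + \<alpha>) / p - 1) * norm (\<phi> t)) = A"
  proof -
    \<comment> \<open>The transfer lemma concerns complex integrands, so the real integral is
      embedded in the complex numbers and read back.\<close>
    have "(LINT t:{0<..}|lebesgue. complex_of_real (t powr ((1 + \<alpha>) / p - 1) * norm (\<phi> t))) = (\<integral>t. complex_of_real (weight t) \<partial>lborel)"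
    proof (rule set_integral_Ioi_AE(2))
      show "AE t in lborel. 0 < t \<longrightarrow> complex_of_real (t powr ((1 + \<alpha>) / p - 1) * norm (\<phi> t)) = complex_of_real (weight t)"
        using k by eventually_elim (simp add: weight_def \<beta>_def)
    qed (auto simp: weight_def \<phi>_zero)
    then show ?thesis unfolding A_def set_integral_complex_of_real integral_complex_of_real of_real_eq_iff .
  qed
  have commute: "AE x in lborel. hilbert_defined_at f x \<and> hilbert_defined_at (?T f) x \<and>
      hausdorff_defined_at \<phi> (hilbert_transform f) x \<and> hilbert_transform (?T f) x = ?T (hilbert_transform f) x"
    if \<alpha>p: "\<alpha> < p - 1" and f: "f \<in> Lp_space p \<alpha>" for f
  proof -
    obtain f' where f': "f' \<in> borel_measurable borel" "AE x in lborel. f x = f' x" "weighted_integral p \<alpha> f' < \<infinity>"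
      using version[OF f] by auto
    have sl: "tempered f'" by (rule weighted_integral_imp_tempered[OF p \<alpha> \<alpha>p f'(1,3)])
    have slh: "tempered (hausdorff f')" by (rule hausdorff_tempered(2)[OF \<alpha>p f'(1,3)])
    have pv: "AE x in lborel. pv_exists f' x" by (rule pv_exists_weighted[OF p \<alpha> \<alpha>p f'(1,3)])
    \<comment> \<open>\<open>hilbert_transform f\<close> is unspecified where the limit fails to
      exist. Agreement with the Borel function \<open>hilbert_pv f'\<close> almost everywhere is
      enough, since \<open>hausdorff_op\<close> ignores null sets at every
      \<open>x \<noteq> 0\<close>.\<close>
    then have hil: "AE x in lborel. hilbert_transform f x = hilbert_pv f' x"
      by eventually_elim (rule hilbert_transform_eq_hilbert_pv[OF f'(2) sl])
    have hilm: "hilbert_pv f' \<in> borel_measurable borel" using f'(1) by simp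
    show ?thesis
      using pv ne0 hausdorff_hilbert_commute[OF \<alpha>p f'(1,3)]
    proof eventually_elim
      case (elim x)
      have pvh: "pv_exists (hausdorff f') x" using elim unfolding pv_exists_def by blast
      have "hilbert_transform (?T f) x = hilbert_pv (hausdorff f') x"
        by (rule hilbert_transform_eq_hilbert_pv[OF T_ae[OF f'(2,1)] slh pvh])
      also have "\<dots> = hausdorff (hilbert_pv f') x" using elim by (intro hilbert_pv_eqI) simp
      also have "\<dots> = ?T (hilbert_transform f) x"
        using hausdorff_op_eq_hausdorff[OF k hil hilm] elim by simp
      finally show ?case
        using hilbert_defined_atI[OF f'(2) sl] hilbert_defined_atI[OF T_ae[OF f'(2,1)] slh pvh]
          hausdorff_defined_at_iff[OF k hil hilm] elim by blast
    qed
  qed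
  have bounded: "bounded_on_Lp p \<alpha> ?T"
    unfolding bounded_on_Lp_def
  proof (intro conjI ballI allI exI)
    fix f assume f: "f \<in> Lp_space p \<alpha>"
    show "?T f \<in> Lp_space p \<alpha>" using version[OF f] T_Lp by blast
    show "Lp_norm p \<alpha> (?T f) \<le> A * Lp_norm p \<alpha> f" by (rule T_bound[OF f])
  next
    fix f g a b assume "f \<in> Lp_space p \<alpha>" "g \<in> Lp_space p \<alpha>"
    then show "AE x in lebesgue. ?T (\<lambda>y. a * f y + b * g y) x = a * ?T f x + b * ?T g x"
      by (intro AE_completion linear)
  qed
  show ?thesis
    using defined bounded lower C_le commute
    unfolding lower_eq upper_eq C_def by (auto intro!: AE_completion)
qed

end
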